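(* Let $1<p<\infty$. Let $f=g+\bar h\in \mathbf{h}^p$ be a harmonic mapping on the unit disk, where $g$ and $h$ are holomorphic on the unit disk, and assume that $\Re(g(0)h(0))=0$. Then $$\left(\int_{\mathbf{T}}(|g|^2+|h|^2)^{p/2}\,d\sigma\right)^{1/p}\le \frac{1}{\left(1-\left|\cos\frac{\pi}{p}\right|\right)^{1/2}}\left(\int_{\mathbf{T}} |g+\bar h|^p\,d\sigma\right)^{1/p},$$ and this inequality is sharp, i.e. for each $p$ the constant $\left(1-\left|\cos\frac{\pi}{p}\right|\right)^{-1/2}$ cannot be replaced by a smaller one. Moreover, for $1<p\le 3$ the inequality holds under the weaker condition $\Re(g(0)h(0))\ge 0$.
   Context: $\mathbf{U}$ is the open unit disk in $\mathbf{C}$, $\mathbf{T}$ the unit circle, $\sigma$ the normalized (probability) arc-length measure on $\mathbf{T}$. For $p>1$, $\mathbf{h}^p$ is the class of complex-valued harmonic functions $f=g+\bar h$ on $\mathbf{U}$ ($g,h$ holomorphic on $\mathbf{U}$) with $\|f\|_p=\sup_{0<r<1}\left(\int_{\mathbf{T}}|f(r\zeta)|^p\,d\sigma(\zeta)\right)^{1/p}<\infty$. On $\mathbf{T}$ the functions are understood as their radial boundary values, which exist almost everywhere, and $\|f\|_p=\left(\int_{\mathbf{T}}|f|^p\,d\sigma\right)^{1/p}$. *)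

theory Defs
  imports "HOL-Complex_Analysis.Complex_Analysis"
begin

text \<open>The underlying space is the circle itself, not the plane: a function given only on the disk is
  arbitrary elsewhere, and must not fail to be measurable because of its values off the disk.\<close>

definition circle_measure :: "complex measure" where
  "circle_measure = distr (uniform_measure lborel {0..2 * pi}) (restrict_space borel (sphere 0 1)) cis"

text \<open>The supremum is taken in the extended reals, so that it is \<open>\<infinity>\<close> when the means are
  unbounded. For each \<open>r < 1\<close> the integrand is continuous on the circle whenever \<open>f\<close> is continuous
  on the disk, so the inner integral is then a genuine one.\<close>

definition hp_norm :: "real \<Rightarrow> (complex \<Rightarrow> complex) \<Rightarrow> ereal" where
  "hp_norm p f =
     (SUP r\<in>{0<..<1}.
        ereal ((LINT \<zeta>|circle_measure. cmod (f (complex_of_real r * \<zeta>)) powr p) powr (1 / p)))"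

text \<open>Only the values on the open unit disk matter.\<close>

definition hp_space :: "real \<Rightarrow> (complex \<Rightarrow> complex) set" where
  "hp_space p =
     {f. (\<exists>g h. g holomorphic_on ball 0 1 \<and> h holomorphic_on ball 0 1 \<and>
                (\<forall>z\<in>ball 0 1. f z = g z + cnj (h z))) \<and>
         hp_norm p f < \<infinity>}"

definition has_radial_limit :: "(complex \<Rightarrow> complex) \<Rightarrow> complex \<Rightarrow> bool" where
  "has_radial_limit f \<zeta> \<longleftrightarrow> (\<exists>l. ((\<lambda>r. f (complex_of_real r * \<zeta>)) \<longlongrightarrow> l) (at_left 1))"

text \<open>Meaningful only where \<^const>\<open>has_radial_limit\<close> holds.\<close>

definition radial_limit :: "(complex \<Rightarrow> complex) \<Rightarrow> complex \<Rightarrow> complex" where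
  "radial_limit f \<zeta> = Lim (at_left 1) (\<lambda>r. f (complex_of_real r * \<zeta>))"

end

theory Submission
  imports Defs
begin

text \<open>
  Write \<open>a = (1 - \<bar>cos (pi / p)\<bar>) powr (- (p / 2))\<close>. The inequality comes from a pointwise estimate
  (\<open>riesz_pointwise\<close>): for complex numbers \<open>z\<close> and \<open>w\<close>,
  \<open>(|z|^2 + |w|^2)^(p/2) \<le> a |z + cnj w|^p - b v(z w)\<close>
  with \<open>b \<ge> 0\<close>, where \<open>v\<close> is a subharmonic function on the plane, homogeneous of degree \<open>p / 2\<close>
  and nonnegative on the right half-plane. If \<open>z\<close> and \<open>w\<close> are replaced by the values of \<open>g\<close> and \<open>h\<close> on
  the circle of radius \<open>r < 1\<close> and the estimate is integrated, the mean of \<open>v(g h)\<close> is at least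
  \<open>v(g(0) h(0)) \<ge> 0\<close>, since \<open>v\<close> composed with the holomorphic function \<open>g h\<close> is subharmonic. This
  proves the inequality on every circle of radius \<open>r < 1\<close> (\<open>riesz_inequality_dilates\<close>).

  The pointwise estimate reduces, by homogeneity and a monotonicity argument, to \<open>|z| = |w|\<close>, where it
  is a comparison between the \<open>p\<close>-th power of a cosine or a sine and \<open>cos (p x)\<close>
  (\<open>sturm_comparison\<close>). Subharmonicity is used in the form of supports: \<open>v\<close> is touched from below at
  every point other than 0 by real parts of holomorphic functions. The maximum principle then holds, also
  for averages over rotations by roots of unity, and these averages tend to circular means
  (\<open>circle_mean_le\<close>).

  To reach the boundary, the constant \<open>h(0)\<close> is moved from \<open>h\<close> to \<open>g\<close>, which does not change
  \<open>f = g + cnj h\<close>; the inequality on circles then bounds the \<open>p\<close>-means of \<open>g\<close> and \<open>h\<close> separately,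
  which is the theorem of M. Riesz. Since \<open>|.|^p\<close> is uniformly convex and \<open>p\<close>-means increase with the
  radius, the dilates of \<open>g\<close> and \<open>h\<close> are Cauchy in the \<open>p\<close>-th mean (\<open>dilates_Cauchy\<close>). Their limits
  are radial limits almost everywhere (\<open>fatou_radial_limit\<close>), because \<open>g\<close> is the derivative of a function
  whose boundary values have a derivative along the circle at almost every point. The inequality passes to
  the limit by Fatou's lemma on the left and convergence in the mean on the right
  (\<open>boundary_values_of_hp\<close>).

  The pointwise estimate is an equality if \<open>|z| = |w|\<close> and \<open>z w\<close> has the argument \<open>\<plusminus> pi / p\<close> (for
  \<open>p \<le> 2\<close>) or \<open>\<plusminus> (pi - pi / p)\<close> (for \<open>p > 2\<close>). Let \<open>g\<close> be the power \<open>((1 + z) / (1 - z))^\<gamma>\<close> and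
  \<open>h = g\<close> or \<open>h = - g\<close>, respectively. On each half of the unit circle \<open>g h\<close> has a constant argument, which tends to a
  critical one as \<open>\<gamma>\<close> increases to \<open>1 / p\<close>, while the \<open>p\<close>-th mean of \<open>g\<close> diverges. Subtracting 1 from the power to make the
  product vanish at 0 therefore does not affect the limiting ratio, which gives sharpness
  (\<open>riesz_constant_sharp\<close>).
\<close>

section \<open>A comparison with the cosine\<close>

text \<open>
  The difference \<open>D\<close> of the two sides vanishes together with its derivative at \<open>\<alpha>\<close>. The function
  \<open>N = D' cos (p x) + p D sin (p x)\<close> has the derivative \<open>(R - p\<^sup>2) cos (p x)\<close> and vanishes at 0 and at \<open>\<alpha>\<close>.
  Since \<open>R\<close> increases, \<open>N\<close> first falls and then rises between these points, so \<open>N \<le> 0\<close> there; beyond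
  \<open>\<alpha>\<close> the cosine is negative and \<open>R \<ge> p\<^sup>2\<close>, so \<open>N\<close> falls again. Hence \<open>D / cos (p x)\<close>, whose derivative
  has the sign of \<open>N\<close>, decreases on both sides of \<open>\<alpha>\<close>. Its limit at \<open>\<alpha>\<close> is 0, and \<open>D \<ge> 0\<close> follows on
  either side from the sign of the cosine.
\<close>

lemma sturm_comparison:
  fixes q q' R :: "real \<Rightarrow> real"
  assumes p: "0 < p" and \<alpha>: "\<alpha> = pi / (2 * p)" and b: "\<alpha> < b" "b \<le> 3 * \<alpha>"
    and dq: "\<And>x. 0 < x \<Longrightarrow> x < b \<Longrightarrow> (q has_real_derivative q' x) (at x)"
    and dq': "\<And>x. 0 < x \<Longrightarrow> x < b \<Longrightarrow> (q' has_real_derivative R x - p\<^sup>2 * q x) (at x)"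
    and mono: "\<And>x y. 0 < x \<Longrightarrow> x \<le> y \<Longrightarrow> y < b \<Longrightarrow> R x \<le> R y"
    and cq: "continuous_on {0..b} q" and cq': "continuous_on {0..<b} q'"
    and q0: "q' 0 = 0" and q\<alpha>: "q \<alpha> = 1"
    and x: "0 \<le> x" "x \<le> b"
  shows "1 - q' \<alpha> / p * cos (p * x) \<le> q x"
proof -
  have \<alpha>0: "0 < \<alpha>" using p \<alpha> by simp
  have p\<alpha>: "p * \<alpha> = pi / 2" using p \<alpha> by simp
  have sp: "sin (p * \<alpha>) = 1" and cp: "cos (p * \<alpha>) = 0" by (simp_all only: p\<alpha> sin_pi_half cos_pi_half)
  define D where "D x = q x - 1 + q' \<alpha> / p * cos (p * x)" for x
  define N where "N x = q' x * cos (p * x) + p * (q x - 1) * sin (p * x)" for x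
  have dN: "(N has_real_derivative (R y - p\<^sup>2) * cos (p * y)) (at y)" if "0 < y" "y < b" for y
    unfolding N_def
    by (rule derivative_eq_intros dq dq' that refl | simp add: algebra_simps power2_eq_square)+
  have cN: "continuous_on {0..<b} N" unfolding N_def
    by (intro continuous_intros cq' continuous_on_subset[OF cq]) auto
  have N0: "N 0 = 0" by (simp add: N_def q0)
  have N\<alpha>: "N \<alpha> = 0" by (simp add: N_def q\<alpha> cp)
  have mvt: "\<exists>\<xi>. u < \<xi> \<and> \<xi> < v \<and> N v - N u = (v - u) * ((R \<xi> - p\<^sup>2) * cos (p * \<xi>))"
    if "0 \<le> u" "u < v" "v < b" for u v
  proof -
    have "\<exists>l z. z > u \<and> z < v \<and> DERIV N z :> l \<and> N v - N u = (v - u) * l"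
    proof (rule MVT)
      show "continuous_on {u..v} N" by (rule continuous_on_subset[OF cN]) (use that in auto)
      show "\<And>x. \<lbrakk>u < x; x < v\<rbrakk> \<Longrightarrow> N differentiable (at x)"
        using dN that by (meson real_differentiable_def order.strict_trans order_le_less_trans)
    qed (use that in auto)
    then obtain l z where z: "z > u" "z < v" "DERIV N z :> l" "N v - N u = (v - u) * l" by blast
    have "l = (R z - p\<^sup>2) * cos (p * z)"
      using DERIV_unique[OF z(3) dN] z that by auto
    then show ?thesis using z by auto
  qed
  have cos_pos: "cos (p * y) > 0" if "0 \<le> y" "y < \<alpha>" for y
  proof -
    have "p * y < p * \<alpha>" using that p by simp
    then show ?thesis using that p p\<alpha> by (intro cos_gt_zero_pi) (auto intro: less_le_trans[of _ 0])
  qed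
  have cos_neg: "cos (p * y) < 0" if "\<alpha> < y" "y < b" for y
  proof -
    have "p * \<alpha> < p * y" "p * y < p * (3 * \<alpha>)" using that p b by auto
    then have "cos (p * y - pi) > 0" using p\<alpha> by (intro cos_gt_zero_pi) auto
    then show ?thesis by (simp add: cos_diff)
  qed
  have N_nonpos: "N y \<le> 0" if y: "0 < y" "y < b" for y
  proof (rule ccontr)
    assume "\<not> N y \<le> 0"
    then have Ny: "N y > 0" by simp
    consider "y < \<alpha>" | "y = \<alpha>" | "\<alpha> < y" by linarith
    then show False
    proof cases
      case 1
      obtain u where u: "0 < u" "u < y" "N y - N 0 = (y - 0) * ((R u - p\<^sup>2) * cos (p * u))"
        using mvt[of 0 y] y by auto
      obtain v where v: "y < v" "v < \<alpha>" "N \<alpha> - N y = (\<alpha> - y) * ((R v - p\<^sup>2) * cos (p * v))"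
        using mvt[of y \<alpha>] y 1 b by auto
      have "(R u - p\<^sup>2) * cos (p * u) > 0" using u N0 Ny y by (metis diff_zero zero_less_mult_pos)
      then have "R u - p\<^sup>2 > 0" using cos_pos[of u] u 1 by (simp add: zero_less_mult_iff)
      moreover have "(\<alpha> - y) * ((R v - p\<^sup>2) * cos (p * v)) < 0" using v N\<alpha> Ny by simp
      then have "R v - p\<^sup>2 < 0" using cos_pos[of v] v y 1
        by (simp add: mult_less_0_iff)
      ultimately show False using mono[of u v] u v b by simp
    next
      case 2 then show False using N\<alpha> Ny by simp
    next
      case 3
      obtain u where u: "0 < u" "u < \<alpha>" "N \<alpha> - N 0 = (\<alpha> - 0) * ((R u - p\<^sup>2) * cos (p * u))"
        using mvt[of 0 \<alpha>] \<alpha>0 b by auto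
      obtain v where v: "\<alpha> < v" "v < y" "N y - N \<alpha> = (y - \<alpha>) * ((R v - p\<^sup>2) * cos (p * v))"
        using mvt[of \<alpha> y] y 3 \<alpha>0 by auto
      have "R u - p\<^sup>2 = 0" using u N0 N\<alpha> \<alpha>0 cos_pos[of u] by auto
      moreover have "(R v - p\<^sup>2) * cos (p * v) > 0" using v N\<alpha> Ny 3
        by (metis diff_zero diff_gt_0_iff_gt zero_less_mult_pos)
      then have "R v - p\<^sup>2 < 0" using cos_neg[of v] v y by (simp add: zero_less_mult_iff)
      ultimately show False using mono[of u v] u v y by simp
    qed
  qed
  \<comment> \<open>A zero of the denominator is at \<open>\<alpha>\<close> only; the value of the quotient there does not matter, its limit does.\<close>
  define \<rho> where "\<rho> y = D y / cos (p * y)" for y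
  have dD: "(D has_real_derivative q' y - q' \<alpha> * sin (p * y)) (at y)" if "0 < y" "y < b" for y
    unfolding D_def using p
    by (auto intro!: derivative_eq_intros dq that)
  have D\<alpha>: "D \<alpha> = 0" by (simp add: D_def q\<alpha> cp)
  have d\<rho>: "(\<rho> has_real_derivative N y / (cos (p * y))\<^sup>2) (at y)" if "0 < y" "y < b" "y \<noteq> \<alpha>" for y
  proof -
    have c: "cos (p * y) \<noteq> 0" using cos_pos[of y] cos_neg[of y] that by force
    have "(\<rho> has_real_derivative
        ((q' y - q' \<alpha> * sin (p * y)) * cos (p * y) - D y * (- sin (p * y) * p)) / (cos (p * y) * cos (p * y))) (at y)"
      unfolding \<rho>_def by (rule derivative_eq_intros dD that refl c | simp)+
    moreover have "((q' y - q' \<alpha> * sin (p * y)) * cos (p * y) - D y * (- sin (p * y) * p)) = N y"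
      unfolding N_def D_def using p by (simp add: field_simps)
    ultimately show ?thesis by (simp add: power2_eq_square)
  qed
  have lim: "(\<rho> \<longlongrightarrow> 0) (at \<alpha>)"
  proof -
    have "((\<lambda>y. (D y - D \<alpha>) / (y - \<alpha>)) \<longlongrightarrow> q' \<alpha> - q' \<alpha> * sin (p * \<alpha>)) (at \<alpha>)"
      using dD[of \<alpha>] \<alpha>0 b by (simp add: has_field_derivative_iff)
    moreover have "((\<lambda>y. cos (p * y)) has_real_derivative (- sin (p * \<alpha>) * p)) (at \<alpha>)"
      by (auto intro!: derivative_eq_intros)
    then have "((\<lambda>y. (cos (p * y) - cos (p * \<alpha>)) / (y - \<alpha>)) \<longlongrightarrow> - sin (p * \<alpha>) * p) (at \<alpha>)"
      by (simp add: has_field_derivative_iff)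
    ultimately have "((\<lambda>y. ((D y - D \<alpha>) / (y - \<alpha>)) / ((cos (p * y) - cos (p * \<alpha>)) / (y - \<alpha>)))
        \<longlongrightarrow> (q' \<alpha> - q' \<alpha> * sin (p * \<alpha>)) / (- sin (p * \<alpha>) * p)) (at \<alpha>)"
      using p by (intro tendsto_divide) (auto simp only: sp)
    then have "((\<lambda>y. ((D y - D \<alpha>) / (y - \<alpha>)) / ((cos (p * y) - cos (p * \<alpha>)) / (y - \<alpha>))) \<longlongrightarrow> 0) (at \<alpha>)"
      by (simp add: sp)
    moreover have "eventually (\<lambda>y. ((D y - D \<alpha>) / (y - \<alpha>)) / ((cos (p * y) - cos (p * \<alpha>)) / (y - \<alpha>)) = \<rho> y) (at \<alpha>)"
      using eventually_neq_at_within[of \<alpha>]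
      by eventually_elim (simp add: \<rho>_def D\<alpha> cp)
    ultimately show ?thesis by (rule Lim_transform_eventually)
  qed
  have inner: "0 \<le> D y" if y: "0 < y" "y < b" for y
  proof -
    consider "y < \<alpha>" | "y = \<alpha>" | "\<alpha> < y" by linarith
    then show ?thesis
    proof cases
      case 1
      have "\<rho> t \<le> \<rho> y" if "y < t" "t < \<alpha>" for t
      proof (rule DERIV_nonpos_imp_nonincreasing[of y t \<rho>])
        show "y \<le> t" using that by simp
        fix u assume "y \<le> u" "u \<le> t"
        then show "\<exists>l. DERIV \<rho> u :> l \<and> l \<le> 0"
          using d\<rho>[of u] N_nonpos[of u] that y b by (intro exI[of _ "N u / (cos (p * u))\<^sup>2"]) (auto intro: divide_nonpos_nonneg)
      qed
      then have "eventually (\<lambda>t. \<rho> t \<le> \<rho> y) (at_left \<alpha>)"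
        by (intro eventually_mono[OF eventually_at_left_real[OF 1]]) auto
      moreover have "(\<rho> \<longlongrightarrow> 0) (at_left \<alpha>)" by (rule tendsto_mono[OF _ lim]) (simp add: at_le)
      ultimately have "0 \<le> \<rho> y" by (intro tendsto_upperbound) auto
      then show ?thesis using cos_pos[of y] 1 y by (simp add: \<rho>_def zero_le_divide_iff)
    next
      case 2 then show ?thesis using D\<alpha> by simp
    next
      case 3
      have "\<rho> t \<ge> \<rho> y" if "t < y" "\<alpha> < t" for t
      proof (rule DERIV_nonpos_imp_nonincreasing[of t y \<rho>])
        show "t \<le> y" using that by simp
        fix u assume "t \<le> u" "u \<le> y"
        then show "\<exists>l. DERIV \<rho> u :> l \<and> l \<le> 0"
          using d\<rho>[of u] N_nonpos[of u] that y b \<alpha>0 by (intro exI[of _ "N u / (cos (p * u))\<^sup>2"]) (auto intro: divide_nonpos_nonneg)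
      qed
      then have "eventually (\<lambda>t. \<rho> y \<le> \<rho> t) (at_right \<alpha>)"
        by (intro eventually_mono[OF eventually_at_right_real[OF 3]]) auto
      moreover have "(\<rho> \<longlongrightarrow> 0) (at_right \<alpha>)" by (rule tendsto_mono[OF _ lim]) (simp add: at_le)
      ultimately have "\<rho> y \<le> 0" by (intro tendsto_lowerbound) auto
      then show ?thesis using cos_neg[of y] 3 y by (simp add: \<rho>_def divide_le_0_iff)
    qed
  qed
  have cl: "closure {0<..<b} = {0..b}" using \<alpha>0 b by (intro closure_greaterThanLessThan) auto
  have "continuous_on {0..b} D" unfolding D_def by (intro continuous_intros cq)
  then have "0 \<le> D x"
    using continuous_ge_on_closure[of "{0<..<b}" D x 0] cl x inner by auto
  then show ?thesis by (simp add: D_def)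
qed

text \<open>
  If \<open>c\<close> is a cosine or a sine, \<open>s\<close> the other one and \<open>P = (c / C)^(p - 2)\<close>, the left-hand side is the second derivative of
  \<open>u = (c / C)^p\<close>. Thus \<open>u'' + p\<^sup>2 u\<close> is a multiple of \<open>P\<close>, and it is monotone when \<open>c\<close> is.
\<close>

lemma powr_ode_identity:
  fixes C P c p s :: real
  assumes "s\<^sup>2 = 1 - c\<^sup>2" "C \<noteq> 0"
  shows "- p * c / C * (c / C * P) + (p - 1) * P * (s / C) * (p * s / C)
    = p * (p - 1) / C\<^sup>2 * P - p\<^sup>2 * ((c / C)\<^sup>2 * P)"
proof -
  have "- p * c / C * (c / C * P) + (p - 1) * P * (s / C) * (p * s / C)
      = P * p / C\<^sup>2 * ((p - 1) * s\<^sup>2 - c\<^sup>2)"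
    using assms(2) by (simp add: power2_eq_square field_simps)
  also have "(p - 1) * s\<^sup>2 - c\<^sup>2 = (p - 1) - p * c\<^sup>2" by (simp add: assms(1) algebra_simps)
  also have "P * p / C\<^sup>2 * ((p - 1) - p * c\<^sup>2) = p * (p - 1) / C\<^sup>2 * P - p\<^sup>2 * ((c / C)\<^sup>2 * P)"
    using assms(2) by (simp add: power2_eq_square field_simps)
  finally show ?thesis .
qed

lemma cos_powr_ge_trig:
  fixes p \<alpha> x :: real
  assumes p: "1 < p" "p \<le> 2" and \<alpha>: "\<alpha> = pi / (2 * p)" and x: "0 \<le> x" "x \<le> pi / 2"
  shows "1 + tan \<alpha> * cos (p * x) \<le> (cos x / cos \<alpha>) powr p"
proof -
  have a1: "\<alpha> < pi / 2" "pi / 2 \<le> 3 * \<alpha>" "0 < \<alpha>" using p unfolding \<alpha> by (auto simp: field_simps)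
  have ca: "cos \<alpha> > 0" using a1 by (intro cos_gt_zero_pi) auto
  define q' where "q' y = - p * sin y / cos \<alpha> * (cos y / cos \<alpha>) powr (p - 1)" for y
  define R where "R y = p * (p - 1) / (cos \<alpha>)\<^sup>2 * (cos y / cos \<alpha>) powr (p - 2)" for y
  have "1 - q' \<alpha> / p * cos (p * x) \<le> (cos x / cos \<alpha>) powr p"
  proof (rule sturm_comparison[OF _ \<alpha>, where b = "pi / 2" and R = R and q' = q'])
    fix y :: real assume y: "0 < y" "y < pi / 2"
    have c: "cos y > 0" using y by (intro cos_gt_zero_pi) auto
    then have c': "cos y / cos \<alpha> > 0" using ca by simp
    have d: "((\<lambda>y. cos y / cos \<alpha>) has_real_derivative - sin y / cos \<alpha>) (at y)"
      using ca by (auto intro!: derivative_eq_intros)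
    show "((\<lambda>y. (cos y / cos \<alpha>) powr p) has_real_derivative q' y) (at y)"
      unfolding q'_def by (rule DERIV_cong[OF DERIV_fun_powr[OF d c', of p]]) simp
    have e: "((\<lambda>y. - p * sin y / cos \<alpha>) has_real_derivative - p * cos y / cos \<alpha>) (at y)"
      using ca by (auto intro!: derivative_eq_intros)
    have "(q' has_real_derivative (- p * cos y / cos \<alpha> * (cos y / cos \<alpha>) powr (p - 1)
        + ((p - 1) * (cos y / cos \<alpha>) powr (p - 1 - of_nat 1) * (- sin y / cos \<alpha>)) * (- p * sin y / cos \<alpha>))) (at y)"
      unfolding q'_def by (rule DERIV_mult[OF e DERIV_fun_powr[OF d c']])
    moreover have "(cos y / cos \<alpha>) powr (p - 1) = (cos y / cos \<alpha>) * (cos y / cos \<alpha>) powr (p - 2)"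
      using powr_add[of "cos y / cos \<alpha>" 1 "p - 2"] c c' ca by simp
    moreover have "(cos y / cos \<alpha>) powr p = (cos y / cos \<alpha>)\<^sup>2 * (cos y / cos \<alpha>) powr (p - 2)"
      using powr_add[of "cos y / cos \<alpha>" 2 "p - 2"] c' by (simp add: powr_numeral)
    moreover have "(sin y)\<^sup>2 = 1 - (cos y)\<^sup>2" by (simp add: sin_squared_eq)
    ultimately show "(q' has_real_derivative R y - p\<^sup>2 * (cos y / cos \<alpha>) powr p) (at y)"
      using powr_ode_identity[of "sin y" "cos y" "cos \<alpha>" p "(cos y / cos \<alpha>) powr (p - 2)"] ca
      by (simp add: R_def)
  next
    fix y z :: real assume yz: "0 < y" "y \<le> z" "z < pi / 2"
    have "cos z \<le> cos y" using yz by (intro cos_monotone_0_pi_le) auto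
    moreover have "cos z > 0" using yz by (intro cos_gt_zero_pi) auto
    ultimately have "(cos y / cos \<alpha>) powr (p - 2) \<le> (cos z / cos \<alpha>) powr (p - 2)"
      using ca p by (intro powr_mono2') (auto simp: divide_right_mono)
    then show "R y \<le> R z" unfolding R_def using p by (intro mult_left_mono) auto
  next
    have pos: "0 \<le> cos y / cos \<alpha>" if "0 \<le> y" "y \<le> pi/2" for y
      using that ca cos_ge_zero[of y] by auto
    show "continuous_on {0..pi / 2} (\<lambda>y. (cos y / cos \<alpha>) powr p)"
      using ca p pos by (intro continuous_on_powr' continuous_intros) auto
    show "continuous_on {0..<pi / 2} q'" unfolding q'_def
      using ca p pos by (intro continuous_on_powr' continuous_intros) auto
  qed (use p a1 x ca in \<open>auto simp: q'_def\<close>)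
  moreover have "q' \<alpha> / p = - tan \<alpha>" using ca p by (simp add: q'_def tan_def)
  ultimately show ?thesis by simp
qed

lemma sin_powr_ge_trig:
  fixes p \<alpha> x :: real
  assumes p: "2 < p" and \<alpha>: "\<alpha> = pi / (2 * p)" and x: "0 \<le> x" "x \<le> 2 * \<alpha>"
  shows "1 - cot \<alpha> * cos (p * x) \<le> (sin x / sin \<alpha>) powr p"
proof -
  have a1: "\<alpha> < pi / 4" "0 < \<alpha>" using p unfolding \<alpha> by (auto simp: field_simps)
  have ca: "sin \<alpha> > 0" using a1 by (intro sin_gt_zero) auto
  define q' where "q' y = p * cos y / sin \<alpha> * (sin y / sin \<alpha>) powr (p - 1)" for y
  define R where "R y = p * (p - 1) / (sin \<alpha>)\<^sup>2 * (sin y / sin \<alpha>) powr (p - 2)" for y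
  have "1 - q' \<alpha> / p * cos (p * x) \<le> (sin x / sin \<alpha>) powr p"
  proof (rule sturm_comparison[OF _ \<alpha>, where b = "2 * \<alpha>" and R = R and q' = q'])
    fix y :: real assume y: "0 < y" "y < 2 * \<alpha>"
    have c: "sin y > 0" using y a1 by (intro sin_gt_zero) auto
    then have c': "sin y / sin \<alpha> > 0" using ca by simp
    have d: "((\<lambda>y. sin y / sin \<alpha>) has_real_derivative cos y / sin \<alpha>) (at y)"
      using ca by (auto intro!: derivative_eq_intros)
    show "((\<lambda>y. (sin y / sin \<alpha>) powr p) has_real_derivative q' y) (at y)"
      unfolding q'_def by (rule DERIV_cong[OF DERIV_fun_powr[OF d c', of p]]) simp
    have e: "((\<lambda>y. p * cos y / sin \<alpha>) has_real_derivative - p * sin y / sin \<alpha>) (at y)"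
      using ca by (auto intro!: derivative_eq_intros)
    have "(q' has_real_derivative (- p * sin y / sin \<alpha> * (sin y / sin \<alpha>) powr (p - 1)
        + ((p - 1) * (sin y / sin \<alpha>) powr (p - 1 - of_nat 1) * (cos y / sin \<alpha>)) * (p * cos y / sin \<alpha>))) (at y)"
      unfolding q'_def by (rule DERIV_mult[OF e DERIV_fun_powr[OF d c']])
    moreover have "(sin y / sin \<alpha>) powr (p - 1) = (sin y / sin \<alpha>) * (sin y / sin \<alpha>) powr (p - 2)"
      using powr_add[of "sin y / sin \<alpha>" 1 "p - 2"] c c' ca by simp
    moreover have "(sin y / sin \<alpha>) powr p = (sin y / sin \<alpha>)\<^sup>2 * (sin y / sin \<alpha>) powr (p - 2)"
      using powr_add[of "sin y / sin \<alpha>" 2 "p - 2"] c' by (simp add: powr_numeral)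
    moreover have "(cos y)\<^sup>2 = 1 - (sin y)\<^sup>2" by (simp add: cos_squared_eq)
    ultimately show "(q' has_real_derivative R y - p\<^sup>2 * (sin y / sin \<alpha>) powr p) (at y)"
      using powr_ode_identity[of "cos y" "sin y" "sin \<alpha>" p "(sin y / sin \<alpha>) powr (p - 2)"] ca
      by (simp add: R_def)
  next
    fix y z :: real assume yz: "0 < y" "y \<le> z" "z < 2 * \<alpha>"
    have "sin y \<le> sin z" using yz a1 by (intro sin_monotone_2pi_le) auto
    moreover have "sin y > 0" using yz a1 by (intro sin_gt_zero) auto
    ultimately have "(sin y / sin \<alpha>) powr (p - 2) \<le> (sin z / sin \<alpha>) powr (p - 2)"
      using ca p by (intro powr_mono2) (auto simp: divide_right_mono)
    then show "R y \<le> R z" unfolding R_def using p by (intro mult_left_mono) auto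
  next
    have pos: "0 \<le> sin y / sin \<alpha>" if "0 \<le> y" "y \<le> 2 * \<alpha>" for y
      using that ca a1 sin_ge_zero[of y] by auto
    show "continuous_on {0..2 * \<alpha>} (\<lambda>y. (sin y / sin \<alpha>) powr p)"
      using ca p pos by (intro continuous_on_powr' continuous_intros) auto
    show "continuous_on {0..<2 * \<alpha>} q'" unfolding q'_def
      using ca p pos by (intro continuous_on_powr' continuous_intros) auto
  qed (use p a1 x ca in \<open>auto simp: q'_def\<close>)
  moreover have "q' \<alpha> / p = cot \<alpha>" using ca p by (simp add: q'_def cot_def)
  ultimately show ?thesis by simp
qed

section \<open>The pointwise inequality\<close>

text \<open>
  Here \<open>X\<close> stands for \<open>|z + cnj w|^2 / (2 |z w|)\<close> and \<open>\<theta>\<close> for \<open>|arg (z w)|\<close>, so that \<open>X - cos \<theta>\<close> is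
  \<open>(|z|^2 + |w|^2) / (2 |z w|)\<close>. The smallest \<open>X\<close> corresponds to \<open>|z| = |w|\<close> and is the trigonometric
  inequality at \<open>\<theta> / 2\<close>. The right-hand side grows at least as fast in \<open>X\<close> as the left-hand side, because the constant
  is at least \<open>2 powr (1 - s)\<close>; this bound follows from the trigonometric inequality at 0.
\<close>

lemma off_diagonal_small:
  fixes p \<alpha> \<theta> X :: real
  defines "s \<equiv> p / 2"
  assumes p: "1 < p" "p \<le> 2" and \<alpha>: "\<alpha> = pi / (2 * p)"
    and \<theta>: "0 \<le> \<theta>" "\<theta> \<le> pi" and X: "1 + cos \<theta> \<le> X"
  shows "(X - cos \<theta>) powr s + tan \<alpha> * cos (s * \<theta>) \<le> (2 * (cos \<alpha>)\<^sup>2) powr (- s) * X powr s"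
proof -
  define a where "a = (2 * (cos \<alpha>)\<^sup>2) powr (- s)"
  have a1: "\<alpha> < pi / 2" "pi / 4 \<le> \<alpha>" "0 < \<alpha>" using p unfolding \<alpha> by (auto simp: field_simps)
  have ca: "cos \<alpha> > 0" using a1 by (intro cos_gt_zero_pi) auto
  have s: "0 < s" "s \<le> 1" using p by (auto simp: s_def)
  have pw: "(cos x / cos \<alpha>) powr p = a * (2 * (cos x)\<^sup>2) powr s" if "cos x \<ge> 0" for x
  proof -
    have "(cos x / cos \<alpha>) powr p = ((cos x / cos \<alpha>) powr 2) powr s"
      by (simp add: powr_powr s_def)
    also have "\<dots> = ((cos x / cos \<alpha>)\<^sup>2) powr s" using that ca by simp
    also have "(cos x / cos \<alpha>)\<^sup>2 = (2 * (cos x)\<^sup>2) / (2 * (cos \<alpha>)\<^sup>2)" by (simp add: power_divide)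
    also have "\<dots> powr s = (2 * (cos x)\<^sup>2) powr s / (2 * (cos \<alpha>)\<^sup>2) powr s"
      by (rule powr_divide)
    also have "\<dots> = a * (2 * (cos x)\<^sup>2) powr s"
      unfolding a_def powr_minus_divide by simp
    finally show ?thesis .
  qed
  have diag: "1 + tan \<alpha> * cos (s * \<theta>) \<le> a * (1 + cos \<theta>) powr s"
  proof -
    have c0: "cos (\<theta> / 2) \<ge> 0" using \<theta> by (intro cos_ge_zero) auto
    have "1 + tan \<alpha> * cos (p * (\<theta> / 2)) \<le> (cos (\<theta> / 2) / cos \<alpha>) powr p"
      using \<theta> by (intro cos_powr_ge_trig p \<alpha>) auto
    also have "\<dots> = a * (2 * (cos (\<theta> / 2))\<^sup>2) powr s" by (rule pw[OF c0])
    also have "2 * (cos (\<theta> / 2))\<^sup>2 = 1 + cos \<theta>" using cos_double_cos[of "\<theta> / 2"] by simp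
    finally show ?thesis by (simp add: s_def)
  qed
  have a_ge: "2 powr (1 - s) \<le> a"
  proof -
    have "tan (pi / 4) \<le> tan \<alpha>" using a1 by (intro tan_mono_le) auto
    then have "2 \<le> 1 + tan \<alpha>" by (simp add: tan_45)
    also have "\<dots> \<le> a * 2 powr s"
      using cos_powr_ge_trig[OF p \<alpha>, of 0] pw[of 0] by simp
    finally have "2 / 2 powr s \<le> a" by (simp add: divide_le_eq)
    then show ?thesis by (simp add: powr_diff)
  qed
  define H where "H Y = a * Y powr s - (Y - cos \<theta>) powr s" for Y
  have "H (1 + cos \<theta>) \<le> H X"
  proof (rule DERIV_nonneg_imp_increasing_open[OF X])
    fix Y assume Y: "1 + cos \<theta> < Y" "Y < X"
    have Y0: "Y > 0" "Y - cos \<theta> > 0" using Y cos_ge_minus_one[of \<theta>] by linarith+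
    have "2 * cos \<theta> \<le> 1 + cos \<theta>" by simp
    then have "2 * cos \<theta> \<le> Y" using Y(1) by (rule order.trans[OF _ less_imp_le])
    then have "Y \<le> 2 * (Y - cos \<theta>)" by (simp add: algebra_simps)
    then have "Y powr (1 - s) \<le> (2 * (Y - cos \<theta>)) powr (1 - s)"
      using s Y0 by (intro powr_mono2) auto
    also have "\<dots> = 2 powr (1 - s) * (Y - cos \<theta>) powr (1 - s)" by (rule powr_mult)
    also have "\<dots> \<le> a * (Y - cos \<theta>) powr (1 - s)" by (intro mult_right_mono a_ge) auto
    finally have "inverse ((Y - cos \<theta>) powr (1 - s)) \<le> a * inverse (Y powr (1 - s))"
      using Y0 by (simp add: field_simps)
    then have "(Y - cos \<theta>) powr (s - 1) \<le> a * Y powr (s - 1)"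
      by (simp add: powr_minus[symmetric])
    then have "0 \<le> s * (a * Y powr (s - 1) - (Y - cos \<theta>) powr (s - 1))" using s by simp
    moreover have "(H has_real_derivative s * (a * Y powr (s - 1) - (Y - cos \<theta>) powr (s - 1))) (at Y)"
      unfolding H_def using Y0 by (auto intro!: derivative_eq_intros simp: algebra_simps)
    ultimately show "\<exists>l. DERIV H Y :> l \<and> 0 \<le> l" by blast
  next
    have "0 \<le> Y" "0 \<le> Y - cos \<theta>" if "1 + cos \<theta> \<le> Y" for Y
      using that cos_ge_minus_one[of \<theta>] by linarith+
    then show "continuous_on {1 + cos \<theta>..X} H" unfolding H_def
      using s by (intro continuous_intros continuous_on_powr') auto
  qed
  then have "a * (1 + cos \<theta>) powr s - 1 \<le> a * X powr s - (X - cos \<theta>) powr s"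
    by (simp add: H_def)
  then show ?thesis using diag by (simp add: a_def)
qed

text \<open>
  Now \<open>\<phi>\<close> stands for \<open>pi - |arg (z w)|\<close>. Again the smallest \<open>X\<close> corresponds to \<open>|z| = |w|\<close> and follows
  from the trigonometric inequality. As long as \<open>cos \<phi> \<le> c1\<close>, the right-hand side grows at least as fast with \<open>X\<close> as the left-hand side. For larger
  cosines the difference has an interior minimum in \<open>X\<close>, whose value comes from Jensen's inequality for
  \<open>t \<mapsto> t^s\<close>. It then suffices that \<open>(cos \<phi>)^s / cos (s \<phi>)\<close> increases in \<open>\<phi>\<close>, since at the angle
  \<open>\<phi>1\<close> with cosine \<open>c1\<close> the claim is again the case \<open>|z| = |w|\<close>.
\<close>

lemma off_diagonal_large:
  fixes p \<alpha> \<phi> X :: real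
  defines "s \<equiv> p / 2"
  assumes p: "2 < p" and \<alpha>: "\<alpha> = pi / (2 * p)"
    and \<phi>: "0 \<le> \<phi>" "\<phi> \<le> pi" and X: "1 - cos \<phi> \<le> X"
  shows "(X + cos \<phi>) powr s - cot \<alpha> * cos (min (s * \<phi>) pi) \<le> (2 * (sin \<alpha>)\<^sup>2) powr (- s) * X powr s"
proof -
  define a where "a = (2 * (sin \<alpha>)\<^sup>2) powr (- s)"
  have a1: "\<alpha> < pi / 4" "0 < \<alpha>" using p unfolding \<alpha> by (auto simp: field_simps)
  have p\<alpha>: "p * \<alpha> = pi / 2" using p \<alpha> by simp
  have sa: "sin \<alpha> > 0" using a1 by (intro sin_gt_zero) auto
  have s: "1 < s" using p by (auto simp: s_def)
  have pw: "(sin x / sin \<alpha>) powr p = a * (2 * (sin x)\<^sup>2) powr s" if "sin x \<ge> 0" for x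
  proof -
    have "(sin x / sin \<alpha>) powr p = ((sin x / sin \<alpha>) powr 2) powr s"
      by (simp add: powr_powr s_def)
    also have "\<dots> = ((sin x / sin \<alpha>)\<^sup>2) powr s" using that sa by simp
    also have "(sin x / sin \<alpha>)\<^sup>2 = (2 * (sin x)\<^sup>2) / (2 * (sin \<alpha>)\<^sup>2)" by (simp add: power_divide)
    also have "\<dots> powr s = (2 * (sin x)\<^sup>2) powr s / (2 * (sin \<alpha>)\<^sup>2) powr s"
      by (rule powr_divide)
    also have "\<dots> = a * (2 * (sin x)\<^sup>2) powr s"
      unfolding a_def powr_minus_divide by simp
    finally show ?thesis .
  qed
  have diag0: "1 - cot \<alpha> * cos (s * \<psi>) \<le> a * (1 - cos \<psi>) powr s" if "0 \<le> \<psi>" "\<psi> \<le> 4 * \<alpha>" for \<psi>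
  proof -
    have c0: "sin (\<psi> / 2) \<ge> 0" using that a1 by (intro sin_ge_zero) auto
    have "1 - cot \<alpha> * cos (p * (\<psi> / 2)) \<le> (sin (\<psi> / 2) / sin \<alpha>) powr p"
      using that by (intro sin_powr_ge_trig p \<alpha>) auto
    also have "\<dots> = a * (2 * (sin (\<psi> / 2))\<^sup>2) powr s" by (rule pw[OF c0])
    also have "2 * (sin (\<psi> / 2))\<^sup>2 = 1 - cos \<psi>" using cos_double_sin[of "\<psi> / 2"] by simp
    finally show ?thesis by (simp add: s_def)
  qed
  have diag: "1 - cot \<alpha> * cos (min (s * \<phi>) pi) \<le> a * (1 - cos \<phi>) powr s"
  proof (cases "\<phi> \<le> 4 * \<alpha>")
    case True
    then have "p * \<phi> \<le> p * (4 * \<alpha>)" using p by simp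
    then have "s * \<phi> \<le> pi" using p\<alpha> by (simp add: s_def)
    then show ?thesis using diag0[OF \<phi>(1) True] by (simp add: min_def)
  next
    case False
    then have "p * \<phi> \<ge> p * (4 * \<alpha>)" using p by simp
    then have "s * \<phi> \<ge> pi" using p\<alpha> by (simp add: s_def)
    then have m: "min (s * \<phi>) pi = pi" by (simp add: min_def)
    have "s * (4 * \<alpha>) = pi" using p\<alpha> by (simp add: s_def algebra_simps)
    then have "1 - cot \<alpha> * cos pi \<le> a * (1 - cos (4 * \<alpha>)) powr s" using diag0[of "4 * \<alpha>"] a1 by simp
    also have "\<dots> \<le> a * (1 - cos \<phi>) powr s"
      using s cos_monotone_0_pi_le[of "4 * \<alpha>" \<phi>] False a1 \<phi>
      by (intro mult_left_mono powr_mono2) (auto simp: a_def)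
    finally show ?thesis using m by simp
  qed
  define d where "d = 2 * (sin \<alpha>)\<^sup>2"
  have "sin \<alpha> < sin (pi / 4)" using a1 by (intro sin_monotone_2pi) auto
  then have "(sin \<alpha>)\<^sup>2 < (sin (pi / 4))\<^sup>2" using sa by (intro power_strict_mono) auto
  then have d: "0 < d" "d < 1" using sa by (auto simp: d_def sin_45 power_divide)
  \<comment> \<open>The derivative in \<open>X\<close> of \<open>a X^s - (X + cos \<phi>)^s\<close> has the sign of \<open>A X - (X + cos \<phi>)\<close>; it is nonnegative for all \<open>X \<ge> 1 - cos \<phi>\<close> iff \<open>cos \<phi> \<le> c1\<close>.\<close>
  define A where "A = a powr (1 / (s - 1))"
  have A_eq: "A = d powr (- s / (s - 1))" by (simp add: A_def a_def d_def powr_powr)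
  have A_pos: "A > 0" using d by (simp add: A_eq)
  have A_pow: "A powr (s - 1) = a" using s sa by (simp add: A_def powr_powr a_def)
  define c1 where "c1 = 1 - 1 / A"
  have "1 / A = d powr (s / (s - 1))" by (simp add: A_eq powr_minus_divide)
  also have "\<dots> < d powr 1" using d s by (intro powr_less_mono') (auto simp: field_simps)
  finally have Ad: "1 / A < d" using d by simp
  have "1 / A < 1" using Ad d by linarith
  then have A1: "A > 1" using A_pos by (simp add: divide_less_eq_1)
  have c1: "0 < c1" "c1 < 1" using Ad d A_pos A1 by (auto simp: c1_def)
  show ?thesis
  proof (cases "cos \<phi> \<le> c1")
    case True
    define H where "H Y = a * Y powr s - (Y + cos \<phi>) powr s" for Y
    have "H (1 - cos \<phi>) \<le> H X"
    proof (rule DERIV_nonneg_imp_increasing_open[OF X])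
      fix Y assume Y: "1 - cos \<phi> < Y" "Y < X"
      have Y0: "Y > 0" "Y + cos \<phi> > 0" using Y cos_le_one[of \<phi>] by linarith+
      have "cos \<phi> \<le> (A - 1) * (1 - cos \<phi>)"
        using True A_pos by (simp add: c1_def field_simps)
      also have "\<dots> \<le> (A - 1) * Y" using A1 Y by (intro mult_left_mono) auto
      finally have "Y + cos \<phi> \<le> A * Y" by (simp add: algebra_simps)
      then have "(Y + cos \<phi>) powr (s - 1) \<le> (A * Y) powr (s - 1)"
        using s Y0 by (intro powr_mono2) auto
      also have "\<dots> = a * Y powr (s - 1)" using Y0 A_pos by (simp add: powr_mult A_pow)
      finally have "0 \<le> s * (a * Y powr (s - 1) - (Y + cos \<phi>) powr (s - 1))" using s by simp
      moreover have "(H has_real_derivative s * (a * Y powr (s - 1) - (Y + cos \<phi>) powr (s - 1))) (at Y)"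
        unfolding H_def using Y0 by (auto intro!: derivative_eq_intros simp: algebra_simps)
      ultimately show "\<exists>l. DERIV H Y :> l \<and> 0 \<le> l" by blast
    next
      have "0 \<le> Y" "0 \<le> Y + cos \<phi>" if "1 - cos \<phi> \<le> Y" for Y using that cos_le_one[of \<phi>] by linarith+
      then show "continuous_on {1 - cos \<phi>..X} H" unfolding H_def
        using s by (intro continuous_intros continuous_on_powr') auto
    qed
    then have "a * (1 - cos \<phi>) powr s - 1 \<le> a * X powr s - (X + cos \<phi>) powr s"
      by (simp add: H_def)
    then show ?thesis using diag by (simp add: a_def)
  next
    case False
    define \<phi>1 where "\<phi>1 = arccos c1"
    have cos1: "cos \<phi>1 = c1" using c1 by (simp add: \<phi>1_def)
    have r1: "0 \<le> \<phi>1" "\<phi>1 \<le> pi" using c1 by (auto simp: \<phi>1_def arccos_lbound arccos_ubound)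
    have lt: "\<phi> < \<phi>1"
      using False cos_monotone_0_pi_le[of \<phi>1 \<phi>] r1 \<phi> cos1 by force
    have "\<phi>1 < 2 * \<alpha>"
    proof -
      have "cos (2 * \<alpha>) < cos \<phi>1" using Ad cos_double_sin[of \<alpha>] by (simp add: cos1 c1_def d_def)
      then show ?thesis using cos_monotone_0_pi_le[of "2 * \<alpha>" \<phi>1] r1 a1 by force
    qed
    then have "p * \<phi>1 < p * (2 * \<alpha>)" using p by simp
    then have s\<phi>1: "s * \<phi>1 < pi / 2" using p\<alpha> by (simp add: s_def)
    have \<phi>1h: "\<phi>1 < pi / 2" using \<open>\<phi>1 < 2 * \<alpha>\<close> a1 by simp
    have cs: "cos (s * \<psi>) > 0" "cos \<psi> > 0" if "0 \<le> \<psi>" "\<psi> \<le> \<phi>1" for \<psi>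
    proof -
      have "s * \<psi> \<le> s * \<phi>1" "0 \<le> s * \<psi>" using that s by auto
      then show "cos (s * \<psi>) > 0" using s\<phi>1 by (intro cos_gt_zero_pi) auto
      show "cos \<psi> > 0" using that \<phi>1h by (intro cos_gt_zero_pi) auto
    qed
    have "1 - cot \<alpha> * cos (s * \<phi>1) \<le> a * (1 / A) powr s"
      using diag0[of \<phi>1] r1 \<open>\<phi>1 < 2 * \<alpha>\<close> by (simp add: cos1 c1_def)
    also have "a * (1 / A) powr s = 1 / A"
      using A_pos by (simp add: A_pow[symmetric] powr_divide powr_diff)
    finally have B: "c1 \<le> cot \<alpha> * cos (s * \<phi>1)" by (simp add: c1_def)
    have "s * ln (cos \<phi>) - ln (cos (s * \<phi>)) \<le> s * ln (cos \<phi>1) - ln (cos (s * \<phi>1))"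
    proof (rule DERIV_nonneg_imp_nondecreasing[of \<phi> \<phi>1 "\<lambda>\<psi>. s * ln (cos \<psi>) - ln (cos (s * \<psi>))"])
      show "\<phi> \<le> \<phi>1" using lt by simp
      fix \<psi> assume \<psi>: "\<phi> \<le> \<psi>" "\<psi> \<le> \<phi>1"
      have c: "cos (s * \<psi>) > 0" "cos \<psi> > 0" using cs[of \<psi>] \<psi> \<phi> by auto
      have "((\<lambda>\<psi>. s * ln (cos \<psi>) - ln (cos (s * \<psi>))) has_real_derivative
          s * (tan (s * \<psi>) - tan \<psi>)) (at \<psi>)"
        using c by (auto intro!: derivative_eq_intros simp: tan_def field_simps)
      moreover have "tan \<psi> \<le> tan (s * \<psi>)"
      proof (rule tan_mono_le)
        show "- (pi / 2) < \<psi>" using \<psi> \<phi> pi_gt_zero by linarith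
        show "\<psi> \<le> s * \<psi>" using s \<psi> \<phi> by (simp add: mult_le_cancel_right1)
        have "s * \<psi> \<le> s * \<phi>1" using \<psi> s by simp
        then show "s * \<psi> < pi / 2" using s\<phi>1 by linarith
      qed
      ultimately show "\<exists>y. ((\<lambda>\<psi>. s * ln (cos \<psi>) - ln (cos (s * \<psi>))) has_real_derivative y) (at \<psi>) \<and> 0 \<le> y"
        using s by (intro exI[of _ "s * (tan (s * \<psi>) - tan \<psi>)"]) auto
    qed
    then have "ln ((cos \<phi> / c1) powr s) \<le> ln (cos (s * \<phi>) / cos (s * \<phi>1))"
      using cs[of \<phi>] cs[of \<phi>1] lt \<phi> r1 by (simp add: ln_powr ln_div cos1 algebra_simps)
    then have ratio: "(cos \<phi> / c1) powr s \<le> cos (s * \<phi>) / cos (s * \<phi>1)"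
      using cs[of \<phi>] cs[of \<phi>1] lt \<phi> r1 c1 by (subst (asm) ln_le_cancel_iff) auto
    have "c1 * (cos \<phi> / c1) powr s \<le> c1 * (cos (s * \<phi>) / cos (s * \<phi>1))"
      using c1 ratio by (intro mult_left_mono) auto
    also have "\<dots> \<le> (cot \<alpha> * cos (s * \<phi>1)) * (cos (s * \<phi>) / cos (s * \<phi>1))"
      using B cs[of \<phi>] cs[of \<phi>1] lt \<phi> r1 by (intro mult_right_mono) auto
    also have "\<dots> = cot \<alpha> * cos (s * \<phi>)" using cs[of \<phi>1] r1 by simp
    finally have low: "c1 * (cos \<phi> / c1) powr s \<le> cot \<alpha> * cos (s * \<phi>)" .
    have cp: "cos \<phi> > 0" using cs[of \<phi>] lt \<phi> by auto
    have X0: "0 \<le> X" using X cos_le_one[of \<phi>] by linarith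
    have jensen: "(X + cos \<phi>) powr s \<le> a * X powr s + c1 * (cos \<phi> / c1) powr s"
    proof (cases "X = 0")
      case True
      have "1 * cos \<phi> powr s \<le> c1 powr (1 - s) * cos \<phi> powr s"
        using powr_mono'[of "1 - s" 0 c1] c1 s by (intro mult_right_mono) auto
      also have "\<dots> = c1 * (cos \<phi> / c1) powr s"
        using c1 cp by (simp add: powr_diff powr_divide)
      finally show ?thesis using True s by simp
    next
      case False
      then have Xp: "0 < X" using X0 by simp
      have "((1 - c1) *\<^sub>R (A * X) + c1 *\<^sub>R (cos \<phi> / c1)) powr s
          \<le> (1 - c1) * (A * X) powr s + c1 * (cos \<phi> / c1) powr s"
        using convex_onD[OF powr_convex[of s], of c1 "A * X" "cos \<phi> / c1"] s c1 Xp A_pos cp by simp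
      moreover have "(1 - c1) *\<^sub>R (A * X) + c1 *\<^sub>R (cos \<phi> / c1) = X + cos \<phi>"
        using A_pos c1 by (simp add: c1_def)
      moreover have "(1 - c1) * (A * X) powr s = a * X powr s"
        using A_pos Xp by (simp add: c1_def powr_mult A_pow[symmetric] powr_diff)
      ultimately show ?thesis by simp
    qed
    have "s * \<phi> \<le> s * \<phi>1" using s lt by simp
    then have "s * \<phi> \<le> pi" using s\<phi>1 pi_gt_zero by linarith
    then have "min (s * \<phi>) pi = s * \<phi>" by (simp add: min_def)
    then show ?thesis using jensen low by (simp add: a_def)
  qed
qed

text \<open>
  Since \<open>arccos (Re w / cmod w)\<close> is \<open>|arg w|\<close>, this is the real part of the principal power \<open>w^(p/2)\<close> if
  \<open>p \<le> 2\<close>. If \<open>p > 2\<close>, it is \<open>- Re ((- w)^(p/2))\<close> in the sector around the negative axis in which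
  \<open>- w\<close> has an argument of modulus at most \<open>2 pi / p\<close>. On the boundary of that sector this equals \<open>|w|^(p/2)\<close>, and
  the function is continued by \<open>|w|^(p/2)\<close>: it stays subharmonic and becomes nonnegative on the right
  half-plane.
\<close>

definition riesz_kernel :: "real \<Rightarrow> complex \<Rightarrow> real" where
  "riesz_kernel p w =
     (if p \<le> 2 then cmod w powr (p / 2) * cos (p / 2 * arccos (Re w / cmod w))
      else - (cmod w powr (p / 2)) * cos (min (p / 2 * arccos (- Re w / cmod w)) pi))"

lemma Re_over_cmod: "-1 \<le> Re w / cmod w" "Re w / cmod w \<le> 1"
  using abs_Re_le_cmod[of w] by (auto simp: divide_le_eq_1 le_divide_eq)

text \<open>
  Both sides are homogeneous, so division by \<open>(2 |z w|)^(p/2)\<close> leaves only the angle of \<open>z w\<close> and the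
  quotient \<open>|z + cnj w|^2 / (2 |z w|)\<close> as variables.
\<close>

lemma riesz_pointwise:
  assumes p: "1 < p"
  obtains b where "0 \<le> b" "\<And>z w. ((cmod z)\<^sup>2 + (cmod w)\<^sup>2) powr (p / 2)
      \<le> (1 - \<bar>cos (pi / p)\<bar>) powr (- (p / 2)) * cmod (z + cnj w) powr p - b * riesz_kernel p (z * w)"
proof -
  define s where "s = p / 2"
  define \<alpha> where "\<alpha> = pi / (2 * p)"
  define B where "B = (if p \<le> 2 then tan \<alpha> else cot \<alpha>)"
  define K where "K w = (if p \<le> 2 then cos (s * arccos (Re w / cmod w))
      else - cos (min (s * arccos (- Re w / cmod w)) pi))" for w
  have a1: "0 < \<alpha>" "\<alpha> < pi / 2" using p by (auto simp: \<alpha>_def field_simps)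
  then have "sin \<alpha> > 0" "cos \<alpha> > 0" by (auto intro!: sin_gt_zero cos_gt_zero_pi)
  then have B0: "0 \<le> B" by (auto simp: B_def cot_def tan_def)
  define a where "a = (1 - \<bar>cos (pi / p)\<bar>) powr (- s)"
  have pa: "pi / p = 2 * \<alpha>" by (simp add: \<alpha>_def)
  have a_eq: "a = (if p \<le> 2 then (2 * (cos \<alpha>)\<^sup>2) powr (- s) else (2 * (sin \<alpha>)\<^sup>2) powr (- s))"
  proof (cases "p \<le> 2")
    case True
    have "cos (2 * \<alpha>) \<le> cos (pi / 2)"
      using True p a1 by (intro cos_monotone_0_pi_le) (auto simp: \<alpha>_def field_simps)
    then show ?thesis using True cos_double_cos[of \<alpha>] by (simp add: a_def pa)
  next
    case False
    have "pi / p \<le> pi / 2" using False by (intro divide_left_mono) auto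
    then have "0 \<le> cos (2 * \<alpha>)" using a1 by (intro cos_ge_zero) (auto simp: pa)
    then show ?thesis using False cos_double_sin[of \<alpha>] by (simp add: a_def pa)
  qed
  have a_ge: "1 \<le> a"
  proof -
    have "cos (pi / p) \<noteq> 1"
      using p cos_monotone_0_pi[of 0 "pi / p"] by (auto simp: field_simps)
    moreover have "cos (pi / p) \<noteq> - 1"
      using p cos_monotone_0_pi[of "pi / p" pi] by (auto simp: field_simps)
    ultimately have "\<bar>cos (pi / p)\<bar> < 1" using abs_cos_le_one[of "pi / p"] by linarith
    then show ?thesis unfolding a_def using p
      by (simp add: s_def powr_minus_divide powr_le1 field_simps)
  qed
  have key: "(X - t) powr s + B * K w \<le> a * X powr s"
    if "t = Re w / cmod w" "1 + t \<le> X" for X t w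
  proof -
    have t: "-1 \<le> t" "t \<le> 1" using that Re_over_cmod by auto
    show ?thesis
    proof (cases "p \<le> 2")
      case True
      show ?thesis
        using off_diagonal_small[OF p True \<alpha>_def, of "arccos t" X] that t True
        by (simp add: K_def B_def a_eq s_def arccos_lbound arccos_ubound)
    next
      case False
      show ?thesis
        using off_diagonal_large[of p \<alpha> "arccos (- t)" X] that t False
        by (simp add: K_def B_def a_eq s_def \<alpha>_def arccos_lbound arccos_ubound)
    qed
  qed
  have v: "riesz_kernel p w = cmod w powr s * K w" for w
    by (simp add: riesz_kernel_def K_def s_def)
  have main: "((cmod z)\<^sup>2 + (cmod w)\<^sup>2) powr s
      \<le> a * cmod (z + cnj w) powr p - (2 powr s * B) * riesz_kernel p (z * w)" for z w
  proof -
    define N where "N = (cmod z)\<^sup>2 + (cmod w)\<^sup>2"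
    define Q where "Q = (cmod (z + cnj w))\<^sup>2"
    define m where "m = cmod (z * w)"
    have QN: "Q = N + 2 * Re (z * w)"
      unfolding Q_def N_def cmod_power2 by (simp add: power2_eq_square algebra_simps)
    have N2: "2 * m \<le> N"
      using sum_squares_bound[of "cmod z" "cmod w"] by (simp add: m_def N_def norm_mult)
    have Qp: "Q powr s = cmod (z + cnj w) powr p"
    proof (cases "z + cnj w = 0")
      case False
      then have "Q = cmod (z + cnj w) powr 2" by (simp add: Q_def)
      then have "Q powr s = cmod (z + cnj w) powr (2 * s)" by (simp only: powr_powr)
      then show ?thesis by (simp add: s_def)
    qed (use p in \<open>simp add: Q_def\<close>)
    show ?thesis
    proof (cases "m = 0")
      case True
      then have "z = 0 \<or> w = 0" by (simp add: m_def)
      then have "Q = N" using QN by auto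
      moreover have "riesz_kernel p (z * w) = 0" using True by (simp add: v m_def)
      moreover have "1 * Q powr s \<le> a * Q powr s" using a_ge by (intro mult_right_mono) auto
      ultimately show ?thesis by (simp add: Qp[symmetric] N_def)
    next
      case False
      then have m: "m > 0" by (simp add: m_def)
      define t where "t = Re (z * w) / m"
      define X where "X = Q / (2 * m)"
      have X: "X - t = N / (2 * m)" using m by (simp add: X_def t_def QN field_simps)
      moreover have "1 \<le> N / (2 * m)" using N2 m by (simp add: le_divide_eq)
      ultimately have "1 + t \<le> X" by linarith
      then have "(X - t) powr s + B * K (z * w) \<le> a * X powr s"
        by (intro key) (simp_all only: t_def m_def)
      then have k: "(N / (2 * m)) powr s + B * K (z * w) \<le> a * (Q / (2 * m)) powr s"
        unfolding X by (simp only: X_def)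
      have "(2 * m) powr s * ((N / (2 * m)) powr s + B * K (z * w)) \<le> (2 * m) powr s * (a * (Q / (2 * m)) powr s)"
        using k by (intro mult_left_mono) auto
      moreover have "(2 * m) powr s * (N / (2 * m)) powr s = N powr s"
        "(2 * m) powr s * (Q / (2 * m)) powr s = Q powr s"
        using m by (simp_all add: powr_divide)
      ultimately have "N powr s + (2 * m) powr s * (B * K (z * w)) \<le> a * Q powr s"
        by (simp add: algebra_simps)
      moreover have "(2 * m) powr s * (B * K (z * w)) = (2 powr s * B) * riesz_kernel p (z * w)"
        using m by (simp add: v powr_mult m_def)
      ultimately show ?thesis by (simp add: Qp N_def)
    qed
  qed
  show ?thesis
    by (rule that[of "2 powr s * B"]) (use B0 main in \<open>auto simp: s_def a_def\<close>)
qed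

lemma arccos_Re_over_cmod:
  assumes "w \<noteq> 0" shows "arccos (Re w / cmod w) = \<bar>Arg w\<bar>"
proof -
  have "\<bar>Arg w\<bar> \<le> pi" using mpi_less_Arg[of w] Arg_le_pi[of w] by (simp add: abs_le_iff)
  then have "arccos (cos \<bar>Arg w\<bar>) = \<bar>Arg w\<bar>" by (intro arccos_cos) auto
  then show ?thesis using cos_Arg[OF assms] by simp
qed

lemma continuous_on_riesz_kernel:
  assumes "1 < p" shows "continuous_on UNIV (riesz_kernel p)"
proof -
  have bound: "\<bar>riesz_kernel p w\<bar> \<le> cmod w powr (p / 2)" for w
    using abs_cos_le_one by (auto simp: riesz_kernel_def abs_mult intro!: mult_left_le)
  have "isCont (riesz_kernel p) w" for w
  proof (cases "w = 0")
    case True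
    have "((\<lambda>w. cmod w powr (p / 2)) \<longlongrightarrow> cmod (0::complex) powr (p / 2)) (at 0)"
      using assms by (intro tendsto_intros) auto
    then have "((\<lambda>w. cmod (w::complex) powr (p / 2)) \<longlongrightarrow> 0) (at 0)" using assms by simp
    then have "(riesz_kernel p \<longlongrightarrow> 0) (at 0)"
      by (rule Lim_null_comparison[rotated]) (use bound in auto)
    then show ?thesis using True by (simp add: isCont_def riesz_kernel_def)
  next
    case False
    have "continuous_on (-{0}) (riesz_kernel p)"
      unfolding riesz_kernel_def using assms Re_over_cmod
      by (cases "p \<le> 2") (auto intro!: continuous_intros simp: minus_le_iff)
    then show ?thesis using False by (simp add: continuous_on_eq_continuous_at open_Compl)
  qed
  then show ?thesis by (simp add: continuous_at_imp_continuous_on)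
qed

section \<open>Harmonic supports and circular means\<close>

text \<open>
  A substitute for subharmonicity: \<open>V\<close> is touched from below at \<open>z\<close> by the real part of a holomorphic
  function. This property is additive, it is inherited by compositions with holomorphic functions, and it
  suffices for the maximum principle.
\<close>

definition harmonic_support :: "(complex \<Rightarrow> real) \<Rightarrow> complex \<Rightarrow> bool" where
  "harmonic_support V z \<longleftrightarrow> (\<exists>H e. 0 < e \<and> H holomorphic_on ball z e \<and> Re (H z) = V z \<and>
     (\<forall>x\<in>ball z e. Re (H x) \<le> V x))"

lemma harmonic_supportI:
  assumes "open S" "z \<in> S" "H holomorphic_on S" "Re (H z) = V z" "\<And>x. x \<in> S \<Longrightarrow> Re (H x) \<le> V x"
  shows "harmonic_support V z"
proof -
  obtain e where "0 < e" "ball z e \<subseteq> S" using assms(1,2) openE by blast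
  then show ?thesis unfolding harmonic_support_def using assms holomorphic_on_subset
    by (intro exI[of _ H] exI[of _ e]) auto
qed

lemma harmonic_support_const: "harmonic_support (\<lambda>_. c) z"
  by (rule harmonic_supportI[of UNIV z "\<lambda>_. of_real c"]) auto

lemma harmonic_support_add:
  assumes "harmonic_support V z" "harmonic_support W z"
  shows "harmonic_support (\<lambda>x. V x + W x) z"
proof -
  obtain H d where H: "0 < d" "H holomorphic_on ball z d" "Re (H z) = V z" "\<forall>x\<in>ball z d. Re (H x) \<le> V x"
    using assms(1) unfolding harmonic_support_def by blast
  obtain K e where K: "0 < e" "K holomorphic_on ball z e" "Re (K z) = W z" "\<forall>x\<in>ball z e. Re (K x) \<le> W x"
    using assms(2) unfolding harmonic_support_def by blast
  show ?thesis
    by (rule harmonic_supportI[of "ball z d \<inter> ball z e" z "\<lambda>x. H x + K x"])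
      (use H K in \<open>auto intro!: holomorphic_intros add_mono elim: holomorphic_on_subset\<close>)
qed

lemma harmonic_support_cmult:
  assumes "harmonic_support V z" "0 \<le> c"
  shows "harmonic_support (\<lambda>x. c * V x) z"
proof -
  obtain H d where H: "0 < d" "H holomorphic_on ball z d" "Re (H z) = V z" "\<forall>x\<in>ball z d. Re (H x) \<le> V x"
    using assms(1) unfolding harmonic_support_def by blast
  show ?thesis
    by (rule harmonic_supportI[of "ball z d" z "\<lambda>x. of_real c * H x"])
      (use H assms(2) in \<open>auto intro!: holomorphic_intros mult_left_mono\<close>)
qed

lemma harmonic_support_sum:
  assumes "finite A" "\<And>k. k \<in> A \<Longrightarrow> harmonic_support (V k) z"
  shows "harmonic_support (\<lambda>x. \<Sum>k\<in>A. V k x) z"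
  using assms
proof (induction A rule: finite_induct)
  case (insert k A)
  then have "harmonic_support (\<lambda>x. V k x + (\<Sum>k\<in>A. V k x)) z"
    by (intro harmonic_support_add) auto
  then show ?case using insert.hyps by simp
qed (simp add: harmonic_support_const)

lemma harmonic_support_compose:
  assumes "harmonic_support V (F z)" and S: "open S" "z \<in> S" "F holomorphic_on S"
  shows "harmonic_support (\<lambda>x. V (F x)) z"
proof -
  obtain H d where H: "0 < d" "H holomorphic_on ball (F z) d" "Re (H (F z)) = V (F z)"
    "\<forall>x\<in>ball (F z) d. Re (H x) \<le> V x"
    using assms(1) unfolding harmonic_support_def by blast
  have "open (S \<inter> F -` ball (F z) d)"
    using continuous_open_preimage[OF holomorphic_on_imp_continuous_on[OF S(3)] S(1) open_ball] .
  then show ?thesis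
    by (rule harmonic_supportI[where H = "H \<circ> F"])
      (use H S in \<open>auto intro!: holomorphic_on_compose_gen[where t = "ball (F z) d"] elim: holomorphic_on_subset\<close>)
qed

lemma harmonic_support_cong:
  assumes "harmonic_support V z" "open S" "z \<in> S" "\<And>x. x \<in> S \<Longrightarrow> V x = W x"
  shows "harmonic_support W z"
proof -
  obtain H d where H: "0 < d" "H holomorphic_on ball z d" "Re (H z) = V z" "\<forall>x\<in>ball z d. Re (H x) \<le> V x"
    using assms(1) unfolding harmonic_support_def by blast
  show ?thesis
    by (rule harmonic_supportI[of "ball z d \<inter> S" z H])
      (use H assms(2,3) assms(4)[symmetric] in \<open>auto elim: holomorphic_on_subset\<close>)
qed

lemma harmonic_support_ln_norm:
  assumes "w \<noteq> 0" shows "harmonic_support (\<lambda>x. ln (cmod x)) w"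
proof (rule harmonic_supportI[of "ball w (cmod w)" w "\<lambda>x. Ln (x / w) + of_real (ln (cmod w))"])
  have nz: "x \<noteq> 0" if "x \<in> ball w (cmod w)" for x using that by auto
  have "x / w \<notin> \<real>\<^sub>\<le>\<^sub>0" if "x \<in> ball w (cmod w)" for x
  proof -
    have "cmod (x / w - 1) * cmod w < 1 * cmod w"
      using that assms by (simp add: norm_mult[symmetric] dist_norm norm_minus_commute left_diff_distrib)
    then have "cmod (x / w - 1) < 1" using assms by simp
    then have "\<bar>Re (x / w - 1)\<bar> < 1" using abs_Re_le_cmod[of "x / w - 1"] by linarith
    then show ?thesis by (auto simp: complex_nonpos_Reals_iff)
  qed
  then show "(\<lambda>x. Ln (x / w) + of_real (ln (cmod w))) holomorphic_on ball w (cmod w)"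
    using assms by (intro holomorphic_intros) auto
  show "Re (Ln (x / w) + of_real (ln (cmod w))) \<le> ln (cmod x)" if "x \<in> ball w (cmod w)" for x
    using nz[OF that] assms by (simp add: norm_divide ln_div)
qed (use assms in auto)

text \<open>
  The principle is stated for \<open>U = exp V\<close>, so that zeros of \<open>U\<close> can represent the value \<open>-\<infinity>\<close> of \<open>V\<close>.
  If \<open>H\<close> supports \<open>ln U\<close> at an interior maximum, \<open>exp H\<close> is holomorphic, bounded in modulus by \<open>U\<close> and
  equal to it in modulus at the point itself. By the maximum modulus principle it is constant, so the set of maxima is open.
\<close>

lemma support_maximum_principle:
  assumes U: "continuous_on (cball 0 R) U" "\<And>z. z \<in> cball 0 R \<Longrightarrow> 0 \<le> U z"
    and R: "0 < R"
    and supp: "\<And>z. z \<in> ball 0 R \<Longrightarrow> 0 < U z \<Longrightarrow> harmonic_support (\<lambda>x. ln (U x)) z"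
    and z0: "z0 \<in> cball 0 R"
  obtains \<zeta> where "cmod \<zeta> = R" "U z0 \<le> U \<zeta>"
proof -
  have "compact (cball (0::complex) R)" "cball (0::complex) R \<noteq> {}" using R by auto
  then obtain z1 where z1: "z1 \<in> cball 0 R" "\<And>z. z \<in> cball 0 R \<Longrightarrow> U z \<le> U z1"
    using continuous_attains_sup[OF _ _ U(1)] by blast
  define m where "m = U z1"
  have Rs: "complex_of_real R \<in> cball 0 R" "cmod (complex_of_real R) = R" using R by auto
  show ?thesis
  proof (cases "m \<le> 0 \<or> cmod z1 = R")
    case True
    then show ?thesis
    proof
      assume "m \<le> 0"
      then have "U z0 \<le> U (of_real R)" using z1(2)[OF z0] U(2)[OF Rs(1)] by (simp add: m_def)
      then show ?thesis using that Rs by blast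
    qed (use that z1 z0 in blast)
  next
    case False
    then have m: "0 < m" and z1b: "z1 \<in> ball 0 R" using z1 by (auto simp: less_le)
    define T where "T = {z \<in> ball 0 R. U z = m}"
    have Ub: "continuous_on (ball 0 R) U" by (rule continuous_on_subset[OF U(1)]) auto
    have "open T"
      unfolding open_contains_ball
    proof
      fix z assume "z \<in> T"
      then have z: "z \<in> ball 0 R" "U z = m" by (auto simp: T_def)
      obtain H e where H: "0 < e" "H holomorphic_on ball z e" "Re (H z) = ln (U z)"
        "\<forall>x\<in>ball z e. Re (H x) \<le> ln (U x)"
        using supp[OF z(1)] z(2) m unfolding harmonic_support_def by auto
      have "open (ball 0 R \<inter> U -` {0<..})"
        by (intro continuous_open_preimage Ub) auto
      moreover have "z \<in> ball 0 R \<inter> U -` {0<..}" using z m by auto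
      ultimately obtain d where d: "0 < d" "ball z d \<subseteq> ball 0 R \<inter> U -` {0<..}" using openE by blast
      define r where "r = min d e"
      have r: "0 < r" "ball z r \<subseteq> ball z e" "ball z r \<subseteq> ball z d" using H d by (auto simp: r_def)
      have upper: "cmod (exp (H x)) \<le> U x" if "x \<in> ball z r" for x
      proof -
        have "0 < U x" "Re (H x) \<le> ln (U x)" using that d r H by auto
        then have "exp (Re (H x)) \<le> U x" by (metis exp_le_cancel_iff exp_ln)
        then show ?thesis by simp
      qed
      have at: "cmod (exp (H z)) = m" using H z m by simp
      have "(\<lambda>x. exp (H x)) constant_on ball z r"
      proof (rule maximum_modulus_principle[of _ "ball z r" "ball z r" z])
        show "(\<lambda>x. exp (H x)) holomorphic_on ball z r"
          using H(2) r holomorphic_on_subset by (intro holomorphic_intros) blast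
        fix x assume x: "x \<in> ball z r"
        then have "U x \<le> m" using z1(2)[of x] d r by (force simp: m_def)
        then show "cmod (exp (H x)) \<le> cmod (exp (H z))" using upper[OF x] at by linarith
      qed (use r in auto)
      then have const: "exp (H x) = exp (H z)" if "x \<in> ball z r" for x
        using that r unfolding constant_on_def by (metis centre_in_ball)
      have "ball z r \<subseteq> T"
      proof
        fix x assume x: "x \<in> ball z r"
        then have "x \<in> ball 0 R" using d r by blast
        moreover have "U x \<le> m" using z1(2)[of x] \<open>x \<in> ball 0 R\<close> by (simp add: m_def)
        moreover have "m \<le> U x" using upper[OF x] const[OF x] at by simp
        ultimately show "x \<in> T" by (simp add: T_def)
      qed
      then show "\<exists>e>0. ball z e \<subseteq> T" using r by blast
    qed
    moreover have "closedin (top_of_set (ball 0 R)) T"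
      unfolding T_def by (rule continuous_closedin_preimage_constant[OF Ub])
    moreover have "T \<noteq> {}" using z1b by (auto simp: T_def m_def)
    moreover have "openin (top_of_set (ball 0 R)) T"
      by (rule open_subset[OF _ \<open>open T\<close>]) (auto simp: T_def)
    ultimately have "T = ball 0 R"
      using connected_ball[of "0::complex" R] unfolding connected_clopen by blast
    then have Um: "U z = m" if "z \<in> ball 0 R" for z using that T_def by blast
    have "U (of_real R) = m"
      by (rule continuous_constant_on_closure[of "ball 0 R" U m]) (use U(1) Um Rs(1) R in \<open>simp_all add: closure_ball\<close>)
    moreover have "U z0 \<le> m" using z1(2)[OF z0] by (simp add: m_def)
    ultimately show ?thesis using that Rs by metis
  qed
qed

definition circle_mean :: "real \<Rightarrow> (complex \<Rightarrow> real) \<Rightarrow> real" where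
  "circle_mean r V = integral {0..2 * pi} (\<lambda>t. V (of_real r * cis t)) / (2 * pi)"

lemma riemann_sum_bound:
  fixes u :: "real \<Rightarrow> real"
  assumes cu: "continuous_on UNIV u" and h: "0 \<le> h" and \<eta>: "0 \<le> \<eta>"
    and close: "\<And>x y. \<bar>x - y\<bar> \<le> h \<Longrightarrow> \<bar>u x - u y\<bar> \<le> \<eta>"
  shows "\<bar>integral {a..a + real n * h} u - h * (\<Sum>k<n. u (a + real k * h))\<bar> \<le> real n * h * \<eta>"
proof (induction n)
  case (Suc n)
  have int: "u integrable_on {x..y}" for x y
    by (intro integrable_continuous_real continuous_on_subset[OF cu]) auto
  define b where "b = a + real n * h"
  have e: "a + real (Suc n) * h = b + h" by (simp add: b_def algebra_simps)
  have ab: "a \<le> b" using h by (simp add: b_def)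
  have split: "integral {a..b + h} u = integral {a..b} u + integral {b..b + h} u"
    using Henstock_Kurzweil_Integration.integral_combine[OF ab _ int, of "b + h"] h by simp
  have "\<bar>integral {b..b + h} (\<lambda>x. u x - u b)\<bar> \<le> \<eta> * (b + h - b)"
  proof -
    have "norm (integral {b..b + h} (\<lambda>x. u x - u b)) \<le> \<eta> * (b + h - b)"
      using h close by (intro integral_bound continuous_intros continuous_on_subset[OF cu]) auto
    then show ?thesis by simp
  qed
  moreover have "integral {b..b + h} (\<lambda>x. u x - u b) = integral {b..b + h} u - h * u b"
    using h by (subst Henstock_Kurzweil_Integration.integral_diff[OF int]) auto
  ultimately have "\<bar>integral {b..b + h} u - h * u b\<bar> \<le> h * \<eta>" by (simp add: mult.commute)
  moreover have "(\<Sum>k<Suc n. u (a + real k * h)) = (\<Sum>k<n. u (a + real k * h)) + u b"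
    by (simp add: b_def)
  moreover have "\<bar>integral {a..b} u - h * (\<Sum>k<n. u (a + real k * h))\<bar> \<le> real n * h * \<eta>"
    using Suc.IH by (simp add: b_def)
  ultimately show ?case unfolding e split by (simp add: algebra_simps abs_le_iff)
qed simp

lemma integral_periodic_shift:
  fixes u :: "real \<Rightarrow> real"
  assumes cu: "continuous_on UNIV u" and per: "\<And>x. u (x + T) = u x" and T: "0 \<le> T"
  shows "integral {a..a + T} u = integral {0..T} u"
proof -
  have int: "u integrable_on {x..y}" for x y
    by (intro integrable_continuous_real continuous_on_subset[OF cu]) auto
  have shift: "integral {x + T..y + T} u = integral {x..y} u" for x y
    using integral_shift_Icc_real[of x y u T] per by (simp add: o_def add.commute)
  have *: "integral {b..b + T} u = integral {c..c + T} u" if "c \<le> b" for b c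
    using Henstock_Kurzweil_Integration.integral_combine[OF that _ int, of "b + T"]
      Henstock_Kurzweil_Integration.integral_combine[OF _ _ int, of c "c + T" "b + T"] shift[of c b] that T
    by simp
  show ?thesis using *[of "min a 0" a] *[of "min a 0" 0] by simp
qed

text \<open>
  The bound has to be uniform in the starting point \<open>a\<close>, because nothing is known about the position of the
  boundary maximum that the maximum principle provides.
\<close>

lemma riemann_sum_uniform:
  fixes u :: "real \<Rightarrow> real"
  assumes cu: "continuous_on UNIV u" and per: "\<And>x. u (x + 2 * pi) = u x" and \<eta>: "0 < \<eta>"
  obtains N where "\<And>n a. N \<le> n \<Longrightarrow> 0 < n \<Longrightarrow>
     \<bar>(\<Sum>k<n. u (a + 2 * pi * real k / real n)) / real n - integral {0..2 * pi} u / (2 * pi)\<bar> \<le> \<eta>"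
proof -
  have "uniformly_continuous_on {-1..2 * pi + 1} u"
    by (intro compact_uniformly_continuous continuous_on_subset[OF cu]) auto
  then obtain d where d: "0 < d" "\<And>x y. x \<in> {-1..2 * pi + 1} \<Longrightarrow> y \<in> {-1..2 * pi + 1} \<Longrightarrow> dist y x < d \<Longrightarrow> dist (u y) (u x) < \<eta>"
    unfolding uniformly_continuous_on_def using \<eta> by meson
  have close: "\<bar>u x - u y\<bar> \<le> \<eta>" if "\<bar>x - y\<bar> < min d 1" for x y
  proof -
    define m where "m = \<lfloor>x / (2 * pi)\<rfloor>"
    have per': "u (z + 2 * pi * of_int j) = u z" for z j
    proof (induction j rule: int_induct[where k = 0])
      case (step1 i) then show ?case using per[of "z + 2 * pi * of_int i"] by (simp add: algebra_simps)
    next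
      case (step2 i) then show ?case using per[of "z + 2 * pi * of_int (i - 1)"] by (simp add: algebra_simps)
    qed simp
    define x' where "x' = x - 2 * pi * of_int m"
    define y' where "y' = y - 2 * pi * of_int m"
    have "of_int m \<le> x / (2 * pi)" "x / (2 * pi) < of_int m + 1" by (simp_all add: m_def)
    then have "0 \<le> x'" "x' \<le> 2 * pi" unfolding x'_def by (simp_all add: field_simps)
    moreover have "x' - y' = x - y" by (simp add: x'_def y'_def)
    ultimately have "dist (u x') (u y') < \<eta>" using that by (intro d(2)) (auto simp: dist_real_def abs_less_iff)
    moreover have "u x' = u x" "u y' = u y"
      using per'[of x' m] per'[of y' m] by (simp_all add: x'_def y'_def)
    ultimately show ?thesis by (simp add: dist_real_def)
  qed
  define N where "N = nat \<lceil>2 * pi / min d 1\<rceil> + 1"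
  show ?thesis
  proof (rule that[of N])
    fix n :: nat and a :: real assume n: "N \<le> n" "0 < n"
    define h where "h = 2 * pi / real n"
    have "2 * pi / min d 1 < real n" using n(1) unfolding N_def by linarith
    then have "2 * pi < min d 1 * real n" using d(1) by (simp add: divide_less_eq mult.commute)
    then have h: "0 < h" "h < min d 1" using n(2) by (simp_all only: h_def divide_less_eq) auto
    have nh: "real n * h = 2 * pi" using n by (simp add: h_def)
    have "\<bar>integral {a..a + real n * h} u - h * (\<Sum>k<n. u (a + real k * h))\<bar> \<le> real n * h * \<eta>"
      using h \<eta> by (intro riemann_sum_bound cu close) auto
    then have "\<bar>integral {0..2 * pi} u - h * (\<Sum>k<n. u (a + real k * h))\<bar> \<le> 2 * pi * \<eta>"
      using integral_periodic_shift[OF cu per, of a] by (simp add: nh)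
    then have "\<bar>integral {0..2 * pi} u - h * (\<Sum>k<n. u (a + real k * h))\<bar> / (2 * pi) \<le> \<eta>"
      by (simp add: divide_le_eq mult.commute)
    moreover have "h * (\<Sum>k<n. u (a + real k * h)) / (2 * pi) = (\<Sum>k<n. u (a + 2 * pi * real k / real n)) / real n"
      by (simp add: h_def mult_ac)
    moreover have "\<bar>integral {0..2 * pi} u - h * (\<Sum>k<n. u (a + real k * h))\<bar> / (2 * pi)
        = \<bar>h * (\<Sum>k<n. u (a + real k * h)) / (2 * pi) - integral {0..2 * pi} u / (2 * pi)\<bar>"
      by (simp add: diff_divide_distrib[symmetric] abs_divide abs_minus_commute)
    ultimately show "\<bar>(\<Sum>k<n. u (a + 2 * pi * real k / real n)) / real n - integral {0..2 * pi} u / (2 * pi)\<bar> \<le> \<eta>"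
      by simp
  qed
qed

text \<open>
  The average of \<open>V\<close> over rotations by the \<open>n\<close>-th roots of unity still has supports, and by the maximum principle
  its value at \<open>\<rho>\<close> is at most its value at some point of modulus \<open>R\<close>. For large \<open>n\<close> both values are close
  to the circular means. At the zeros of \<open>E\<close>, where \<open>V\<close> may lack a support, a term \<open>\<epsilon> ln |E|\<close> is added,
  which is \<open>-\<infinity>\<close> there; finally \<open>\<epsilon>\<close> tends to 0.
\<close>

lemma circle_mean_le:
  assumes R: "0 < R" and \<rho>: "0 \<le> \<rho>" "\<rho> < R"
    and V: "continuous_on (cball 0 R) V"
    and E: "continuous_on (cball 0 R) E" "E holomorphic_on ball 0 R"
    and E0: "\<And>z. cmod z = \<rho> \<Longrightarrow> E z \<noteq> 0"
    and supp: "\<And>z. z \<in> ball 0 R \<Longrightarrow> E z \<noteq> 0 \<Longrightarrow> harmonic_support V z"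
  shows "circle_mean \<rho> V \<le> circle_mean R V"
proof (rule field_le_epsilon)
  fix \<delta> :: real assume \<delta>: "0 < \<delta>"
  define u where "u r t = V (of_real r * cis t)" for r t
  have cu: "continuous_on UNIV (u r)" if "0 \<le> r" "r \<le> R" for r
    unfolding u_def by (rule continuous_on_compose2[OF V])
      (use that in \<open>auto intro!: continuous_intros simp: norm_mult\<close>)
  have per: "u r (t + 2 * pi) = u r t" for r t by (simp add: u_def cis_mult[symmetric])
  have cE: "compact (sphere (0::complex) \<rho>)" "sphere (0::complex) \<rho> \<noteq> {}"
    using \<rho> by (auto intro!: exI[of _ "of_real \<rho>"])
  have "continuous_on (sphere 0 \<rho>) (\<lambda>z. cmod (E z))"
    by (intro continuous_intros continuous_on_subset[OF E(1)]) (use \<rho> in auto)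
  then obtain z2 where z2: "z2 \<in> sphere 0 \<rho>" "\<And>z. z \<in> sphere 0 \<rho> \<Longrightarrow> cmod (E z2) \<le> cmod (E z)"
    using continuous_attains_inf[OF cE] by blast
  define c where "c = cmod (E z2)"
  have c: "0 < c" "\<And>z. cmod z = \<rho> \<Longrightarrow> c \<le> cmod (E z)" using z2 E0 by (auto simp: c_def)
  have "compact (E ` cball 0 R)" by (intro compact_continuous_image E) auto
  then obtain B where B: "0 < B" "\<And>z. z \<in> cball 0 R \<Longrightarrow> cmod (E z) \<le> B"
    using compact_imp_bounded bounded_pos by (metis image_eqI)
  define \<epsilon> where "\<epsilon> = \<delta> / (3 * (1 + \<bar>ln B - ln c\<bar>))"
  have pos: "0 < 1 + \<bar>ln B - ln c\<bar>" by linarith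
  then have \<epsilon>: "0 < \<epsilon>" unfolding \<epsilon>_def using \<delta> by (intro divide_pos_pos mult_pos_pos) auto
  have "\<epsilon> * (ln B - ln c) \<le> \<epsilon> * (1 + \<bar>ln B - ln c\<bar>)" using \<epsilon> by (intro mult_left_mono) auto
  also have "\<dots> = \<delta> / 3" 
  proof -
    have "\<delta> / (3 * y) * y = \<delta> / 3" if "0 < y" for y using that by (simp add: field_simps)
    then show ?thesis using pos by (simp only: \<epsilon>_def)
  qed
  finally have \<epsilon>\<delta>: "\<epsilon> * (ln B - ln c) \<le> \<delta> / 3" .
  obtain N1 where N1: "\<And>n a. N1 \<le> n \<Longrightarrow> 0 < n \<Longrightarrow>
     \<bar>(\<Sum>k<n. u \<rho> (a + 2 * pi * real k / real n)) / real n - integral {0..2 * pi} (u \<rho>) / (2 * pi)\<bar> \<le> \<delta> / 3"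
    using riemann_sum_uniform[OF cu per, of \<rho> "\<delta> / 3"] \<delta> \<rho> by auto
  obtain N2 where N2: "\<And>n a. N2 \<le> n \<Longrightarrow> 0 < n \<Longrightarrow>
     \<bar>(\<Sum>k<n. u R (a + 2 * pi * real k / real n)) / real n - integral {0..2 * pi} (u R) / (2 * pi)\<bar> \<le> \<delta> / 3"
    using riemann_sum_uniform[OF cu per, of R "\<delta> / 3"] \<delta> R by auto
  define n where "n = Suc (max N1 N2)"
  have n: "N1 \<le> n" "N2 \<le> n" "0 < n" by (auto simp: n_def)
  define \<omega> where "\<omega> k = cis (2 * pi * real k / real n)" for k
  have \<omega>: "cmod (\<omega> k) = 1" for k by (simp add: \<omega>_def)
  define A where "A z = (\<Sum>k<n. V (\<omega> k * z)) / real n" for z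
  \<comment> \<open>The exponential of the rotation average of \<open>V + \<epsilon> ln |E|\<close>, continued by 0.\<close>
  define U where "U z = exp (A z) * (\<Prod>k<n. cmod (E (\<omega> k * z)) powr (\<epsilon> / real n))" for z
  have inR: "\<omega> k * z \<in> cball 0 R \<longleftrightarrow> z \<in> cball 0 R" "\<omega> k * z \<in> ball 0 R \<longleftrightarrow> z \<in> ball 0 R" for k z
    by (simp_all add: norm_mult \<omega>)
  have rot: "continuous_on (cball 0 R) (\<lambda>z. f (\<omega> k * z))" if "continuous_on (cball 0 R) f"
    for f :: "complex \<Rightarrow> 'z::topological_space" and k
    by (rule continuous_on_compose2[OF that]) (use inR in \<open>auto intro!: continuous_intros\<close>)
  have cU: "continuous_on (cball 0 R) U"
    unfolding U_def A_def using \<epsilon> n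
    by (intro continuous_intros continuous_on_powr' rot[OF V] rot[OF E(1)]) auto
  have Upos: "E (\<omega> k * z) \<noteq> 0" if "0 < U z" "k < n" for z k
  proof
    assume "E (\<omega> k * z) = 0"
    then have "(\<Prod>k<n. cmod (E (\<omega> k * z)) powr (\<epsilon> / real n)) = 0" using that(2) by (auto intro!: prod_zero)
    then show False using that(1) by (simp only: U_def mult_zero_right less_irrefl)
  qed
  have lnU: "ln (U z) = (1 / real n) * (\<Sum>k<n. V (\<omega> k * z)) + (\<epsilon> / real n) * (\<Sum>k<n. ln (cmod (E (\<omega> k * z))))"
    if nz: "0 < U z" for z
  proof -
    have "ln (U z) = A z + ln (\<Prod>k<n. cmod (E (\<omega> k * z)) powr (\<epsilon> / real n))"
      using Upos[OF nz] unfolding U_def by (subst ln_mult_pos) (auto intro!: prod_pos)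
    also have "ln (\<Prod>k<n. cmod (E (\<omega> k * z)) powr (\<epsilon> / real n)) = (\<Sum>k<n. ln (cmod (E (\<omega> k * z)) powr (\<epsilon> / real n)))"
      using Upos[OF nz] by (intro ln_prod) auto
    also have "\<dots> = (\<epsilon> / real n) * (\<Sum>k<n. ln (cmod (E (\<omega> k * z))))"
      using Upos[OF nz] by (simp add: ln_powr sum_distrib_left)
    finally show ?thesis by (simp add: A_def)
  qed
  have rotsupp: "harmonic_support (\<lambda>x. W (\<omega> k * x)) z" if "harmonic_support W (\<omega> k * z)" for W k z
    by (rule harmonic_support_compose[where F = "\<lambda>x. \<omega> k * x" and S = UNIV])
      (use that in \<open>auto intro!: holomorphic_intros\<close>)
  have suppU: "harmonic_support (\<lambda>x. ln (U x)) z" if z: "z \<in> ball 0 R" "0 < U z" for z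
  proof (rule harmonic_support_cong)
    have "harmonic_support (\<lambda>x. ln (cmod (E x))) (\<omega> k * z)" if "k < n" for k
      by (rule harmonic_support_compose[where F = E, OF harmonic_support_ln_norm open_ball _ E(2)])
        (use Upos[OF z(2) that] z inR in auto)
    then show "harmonic_support (\<lambda>z. (1 / real n) * (\<Sum>k<n. V (\<omega> k * z)) + (\<epsilon> / real n) * (\<Sum>k<n. ln (cmod (E (\<omega> k * z))))) z"
      using Upos[OF z(2)] z(1) \<epsilon> inR
      by (intro harmonic_support_add harmonic_support_cmult harmonic_support_sum rotsupp supp) auto
    have "continuous_on (ball 0 R) U" by (rule continuous_on_subset[OF cU]) auto
    then show "open (ball 0 R \<inter> U -` {0<..})" by (intro continuous_open_preimage) auto
    show "z \<in> ball 0 R \<inter> U -` {0<..}" using z by auto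
  qed (use lnU in auto)
  have Unn: "0 \<le> U z" for z unfolding U_def by (intro mult_nonneg_nonneg prod_nonneg) auto
  obtain \<zeta> where \<zeta>: "cmod \<zeta> = R" "U (of_real \<rho>) \<le> U \<zeta>"
    by (rule support_maximum_principle[of R U "of_real \<rho>", OF cU _ R suppU])
      (use \<rho> Unn in auto)
  have Eb: "cmod (E (\<omega> k * \<zeta>)) \<le> B" for k using B(2) inR \<zeta> by auto
  have Ec: "c \<le> cmod (E (\<omega> k * of_real \<rho>))" for k using c(2) \<rho> by (auto simp: norm_mult \<omega>)
  have "exp (A (of_real \<rho>) + \<epsilon> * ln c) = exp (A (of_real \<rho>)) * (\<Prod>k<n. c powr (\<epsilon> / real n))"
    using c n by (simp add: exp_add powr_def exp_of_nat_mult[symmetric] mult.commute)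
  also have "\<dots> \<le> U (of_real \<rho>)" unfolding U_def
    using c Ec \<epsilon> by (intro mult_left_mono prod_mono conjI powr_mono2) auto
  also have "\<dots> \<le> U \<zeta>" by (rule \<zeta>)
  also have "U \<zeta> \<le> exp (A \<zeta>) * (\<Prod>k<n. B powr (\<epsilon> / real n))" unfolding U_def
    using Eb \<epsilon> by (intro mult_left_mono prod_mono conjI powr_mono2) auto
  also have "\<dots> = exp (A \<zeta> + \<epsilon> * ln B)"
    using B n by (simp add: exp_add powr_def exp_of_nat_mult[symmetric] mult.commute)
  finally have "A (of_real \<rho>) + \<epsilon> * ln c \<le> A \<zeta> + \<epsilon> * ln B" by simp
  moreover have "A (of_real \<rho>) = (\<Sum>k<n. u \<rho> (0 + 2 * pi * real k / real n)) / real n"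
    by (simp add: A_def u_def \<omega>_def mult.commute)
  moreover have "A \<zeta> = (\<Sum>k<n. u R (Arg \<zeta> + 2 * pi * real k / real n)) / real n"
  proof -
    have "\<zeta> = of_real R * cis (Arg \<zeta>)" using \<zeta>(1) R rcis_cmod_Arg[of \<zeta>] by (simp add: rcis_def)
    then have "\<omega> k * \<zeta> = of_real R * cis (Arg \<zeta> + 2 * pi * real k / real n)" for k
      unfolding \<omega>_def cis_mult[symmetric] by (metis mult.commute mult.assoc)
    then show ?thesis by (simp add: A_def u_def)
  qed
  moreover have "circle_mean \<rho> V = integral {0..2 * pi} (u \<rho>) / (2 * pi)"
    "circle_mean R V = integral {0..2 * pi} (u R) / (2 * pi)"
    by (simp_all add: circle_mean_def u_def[abs_def])
  ultimately show "circle_mean \<rho> V \<le> circle_mean R V + \<delta>"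
    using N1[OF n(1,3), of 0] N2[OF n(2,3), of "Arg \<zeta>"] \<epsilon>\<delta>
    unfolding abs_le_iff right_diff_distrib by linarith
qed

lemma harmonic_support_mono:
  assumes "harmonic_support V z" "open S" "z \<in> S" "V z = W z" "\<And>x. x \<in> S \<Longrightarrow> V x \<le> W x"
  shows "harmonic_support W z"
proof -
  obtain H d where H: "0 < d" "H holomorphic_on ball z d" "Re (H z) = V z" "\<forall>x\<in>ball z d. Re (H x) \<le> V x"
    using assms(1) unfolding harmonic_support_def by blast
  show ?thesis
    by (rule harmonic_supportI[of "ball z d \<inter> S" z H])
      (use H assms(2-4) order_trans[OF _ assms(5)] in \<open>auto elim: holomorphic_on_subset\<close>)
qed

section \<open>Means of powers of the modulus and of the Riesz kernel\<close>

text \<open>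
  At \<open>w = 0\<close> the constant 0 is a support. Elsewhere \<open>|x|^q = exp (q ln |x|)\<close> lies above the tangent of the
  exponential function at \<open>q ln |w|\<close>, and \<open>ln |x|\<close> is harmonic.
\<close>

lemma harmonic_support_norm_powr:
  assumes "0 < q" shows "harmonic_support (\<lambda>x. cmod x powr q) w"
proof (cases "w = 0")
  case True
  show ?thesis
    by (rule harmonic_support_mono[OF harmonic_support_const[of 0] open_UNIV]) (use True assms in auto)
next
  case False
  define V where "V x = (cmod w powr q * q) * ln (cmod x) + cmod w powr q * (1 - q * ln (cmod w))" for x :: complex
  have "harmonic_support V w" unfolding V_def using assms False
    by (intro harmonic_support_add harmonic_support_cmult harmonic_support_ln_norm harmonic_support_const) auto
  then show ?thesis
  proof (rule harmonic_support_mono[where S = "-{0}"])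
    show "V w = cmod w powr q" by (simp add: V_def algebra_simps)
    fix x :: complex assume "x \<in> -{0}"
    then have x: "x \<noteq> 0" by simp
    have "cmod w powr q * (1 + q * (ln (cmod x) - ln (cmod w))) \<le> cmod w powr q * exp (q * (ln (cmod x) - ln (cmod w)))"
      by (intro mult_left_mono exp_ge_add_one_self) auto
    also have "\<dots> = cmod x powr q"
      using x False by (simp add: powr_def exp_add[symmetric] algebra_simps)
    finally show "V x \<le> cmod x powr q" by (simp add: V_def algebra_simps)
  qed (use False in auto)
qed

lemma circle_mean_norm_powr_mono:
  assumes g: "g holomorphic_on ball 0 1" and r: "0 \<le> \<rho>" "\<rho> \<le> r" "r < 1" and q: "0 < q"
  shows "circle_mean \<rho> (\<lambda>z. cmod (g z) powr q) \<le> circle_mean r (\<lambda>z. cmod (g z) powr q)"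
proof (cases "\<rho> = r")
  case False
  have sub: "ball 0 r \<subseteq> ball (0::complex) 1" "cball 0 r \<subseteq> ball (0::complex) 1" using r by auto
  have cg: "continuous_on (cball 0 r) g"
    by (rule continuous_on_subset[OF holomorphic_on_imp_continuous_on[OF g] sub(2)])
  show ?thesis
  proof (rule circle_mean_le[where E = "\<lambda>_. 1"])
    show "continuous_on (cball 0 r) (\<lambda>z. cmod (g z) powr q)"
      using q by (intro continuous_on_powr' continuous_intros cg) auto
    fix z :: complex assume "z \<in> ball 0 r"
    then show "harmonic_support (\<lambda>z. cmod (g z) powr q) z"
      using sub by (intro harmonic_support_compose[where F = g, OF harmonic_support_norm_powr open_ball _ g] q) auto
  qed (use r False in auto)
qed simp

lemma Re_exp_real_Ln:
  assumes "w \<noteq> 0"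
  shows "Re (exp (of_real s * Ln w)) = cmod w powr s * cos (s * Arg w)"
  using assms by (simp add: Re_exp powr_def Arg_eq_Im_Ln)

text \<open>
  Off the negative axis the kernel is the real part of a holomorphic power. Near a point of the negative axis
  it is the maximum of the continuations of this power from above and from below, because
  \<open>cos (s (pi + d)) \<le> cos (s (pi - d))\<close> for \<open>0 \<le> d \<le> pi\<close>; so the continuation from above is a support.
\<close>

lemma harmonic_support_riesz_kernel_small:
  assumes p: "1 < p" "p \<le> 2" and w: "w \<noteq> 0"
  shows "harmonic_support (riesz_kernel p) w"
proof -
  define s where "s = p / 2"
  have s: "0 < s" "s \<le> 1" using p by (auto simp: s_def)
  have v: "riesz_kernel p x = cmod x powr s * cos (s * Arg x)" if "x \<noteq> 0" for x
    using p arccos_Re_over_cmod[OF that] by (cases "0 \<le> Arg x") (simp_all add: riesz_kernel_def s_def)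
  show ?thesis
  proof (cases "w \<in> \<real>\<^sub>\<le>\<^sub>0")
    case False
    have nz: "x \<noteq> 0" if "x \<notin> \<real>\<^sub>\<le>\<^sub>0" for x :: complex using that by auto
    show ?thesis
      by (rule harmonic_supportI[of "- \<real>\<^sub>\<le>\<^sub>0" w "\<lambda>x. exp (of_real s * Ln x)"])
        (use False in \<open>auto intro!: holomorphic_intros simp: open_Compl Re_exp_real_Ln[OF nz] v[OF nz]\<close>)
  next
    case True
    then have wr: "Re w < 0" "Im w = 0" using w by (auto simp: complex_nonpos_Reals_iff complex_eq_iff)
    then have Aw: "Arg w = pi" by (simp add: Arg_eq_pi)
    have H: "Re (exp (of_real s * (Ln (- x) + \<i> * pi))) = cmod x powr s * cos (s * (Arg (- x) + pi))" if "x \<noteq> 0" for x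
      using that by (simp add: Re_exp powr_def Arg_eq_Im_Ln)
    show ?thesis
    proof (rule harmonic_supportI[of "{x. Re x < 0}" w "\<lambda>x. exp (of_real s * (Ln (- x) + \<i> * pi))"])
      show "open {x. Re x < 0}" by (simp add: open_halfspace_Re_lt)
      show "(\<lambda>x. exp (of_real s * (Ln (- x) + \<i> * pi))) holomorphic_on {x. Re x < 0}"
        by (intro holomorphic_intros) (auto simp: complex_nonpos_Reals_iff)
      have "Arg (- w) = 0" using wr by (simp add: Arg_eq_0 complex_is_Real_iff)
      then show "Re (exp (of_real s * (Ln (- w) + \<i> * pi))) = riesz_kernel p w"
        using w by (simp add: H v Aw del: Re_exp)
      fix x assume "x \<in> {x. Re x < 0}"
      then have x: "Re x < 0" "x \<noteq> 0" by auto
      have "cos (s * (Arg (- x) + pi)) \<le> cos (s * Arg x)"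
      proof (cases "0 < Arg x")
        case True
        then show ?thesis using x(2) by (simp add: Arg_minus)
      next
        case False
        then have A: "Arg (- x) = Arg x + pi" using x(2) by (simp add: Arg_minus)
        define d where "d = Arg x + pi"
        have d: "0 < d" "d \<le> pi" using mpi_less_Arg[of x] False by (auto simp: d_def)
        have "0 \<le> sin (s * pi)" "0 \<le> sin (s * d)"
          using s d mult_mono[of s 1 d pi] by (auto intro!: sin_ge_zero)
        then have "cos (s * pi + s * d) \<le> cos (s * pi - s * d)"
          using mult_nonneg_nonneg by (simp add: cos_add cos_diff)
        also have "s * pi - s * d = - (s * Arg x)" by (simp add: d_def algebra_simps)
        finally show ?thesis by (simp add: A d_def algebra_simps)
      qed
      then show "Re (exp (of_real s * (Ln (- x) + \<i> * pi))) \<le> riesz_kernel p x"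
        using H[OF x(2)] v[OF x(2)] by (simp only: mult_left_mono powr_ge_zero)
    qed (use wr in auto)
  qed
qed

text \<open>
  The cosine of \<open>min t pi\<close> is at most the cosine of \<open>t\<close>, so \<open>- Re ((- x)^s)\<close> lies below the kernel and touches
  it in the closed sector around the negative axis. At all other points the kernel is locally \<open>|x|^s\<close>.
\<close>

lemma harmonic_support_riesz_kernel_large:
  assumes p: "2 < p" and w: "w \<noteq> 0"
  shows "harmonic_support (riesz_kernel p) w"
proof -
  define s where "s = p / 2"
  have s: "1 < s" using p by (auto simp: s_def)
  have v: "riesz_kernel p x = - (cmod x powr s * cos (min (s * \<bar>Arg (- x)\<bar>) pi))" if "x \<noteq> 0" for x
    using p arccos_Re_over_cmod[of "- x"] that by (simp add: riesz_kernel_def s_def)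
  have H: "Re (- exp (of_real s * Ln (- x))) = - (cmod x powr s * cos (s * \<bar>Arg (- x)\<bar>))" if "x \<noteq> 0" for x
    using Re_exp_real_Ln[of "- x" s] that by (cases "0 \<le> Arg (- x)") simp_all
  show ?thesis
  proof (cases "s * \<bar>Arg (- w)\<bar> \<le> pi")
    case True
    have "\<bar>Arg (- w)\<bar> < pi"
    proof (cases "Arg (- w) = 0")
      case False
      then have "1 * \<bar>Arg (- w)\<bar> < s * \<bar>Arg (- w)\<bar>" using s by (intro mult_strict_right_mono) auto
      then show ?thesis using True by simp
    qed simp
    then have wn: "- w \<notin> \<real>\<^sub>\<le>\<^sub>0"
      using w Arg_eq_pi[of "- w"] by (auto simp: complex_nonpos_Reals_iff complex_eq_iff less_le)
    show ?thesis
    proof (rule harmonic_supportI[of "uminus -` (- \<real>\<^sub>\<le>\<^sub>0)" w "\<lambda>x. - exp (of_real s * Ln (- x))"])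
      show "open (uminus -` (- \<real>\<^sub>\<le>\<^sub>0 :: complex set))" by (intro continuous_open_vimage) (auto intro!: continuous_intros simp: open_Compl)
      show "(\<lambda>x. - exp (of_real s * Ln (- x))) holomorphic_on uminus -` (- \<real>\<^sub>\<le>\<^sub>0)"
        by (intro holomorphic_intros) auto
      show "Re (- exp (of_real s * Ln (- w))) = riesz_kernel p w"
        using H[OF w] v[OF w] True by (simp only: min_absorb1)
      fix x :: complex assume "x \<in> uminus -` (- \<real>\<^sub>\<le>\<^sub>0)"
      then have x: "x \<noteq> 0" by auto
      have "cos (min (s * \<bar>Arg (- x)\<bar>) pi) \<le> cos (s * \<bar>Arg (- x)\<bar>)"
        by (cases "s * \<bar>Arg (- x)\<bar> \<le> pi") (auto simp: min_def)
      then show "Re (- exp (of_real s * Ln (- x))) \<le> riesz_kernel p x"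
        using H[OF x] v[OF x] by (simp only: neg_le_iff_le mult_left_mono powr_ge_zero)
    qed (use wn in auto)
  next
    case False
    define S where "S = {x \<in> -{0}. pi / s < arccos (- Re x / cmod x)}"
    have "continuous_on (-{0}) (\<lambda>x. arccos (- Re x / cmod x))"
      using Re_over_cmod by (auto intro!: continuous_intros simp: minus_le_iff)
    then have "open ((-{0}) \<inter> (\<lambda>x. arccos (- Re x / cmod x)) -` {pi / s<..})"
      by (intro continuous_open_preimage) auto
    moreover have "(-{0}) \<inter> (\<lambda>x. arccos (- Re x / cmod x)) -` {pi / s<..} = S" by (auto simp: S_def)
    ultimately have oS: "open S" by simp
    have arc: "arccos (- Re x / cmod x) = \<bar>Arg (- x)\<bar>" if "x \<noteq> 0" for x
      using arccos_Re_over_cmod[of "- x"] that by simp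
    show ?thesis
    proof (rule harmonic_support_cong[OF _ oS])
      show "harmonic_support (\<lambda>x. cmod x powr s) w" using s by (intro harmonic_support_norm_powr) auto
      show "w \<in> S" using False w s arc[OF w] by (simp add: S_def divide_less_eq mult.commute)
      fix x assume "x \<in> S"
      then have x: "x \<noteq> 0" "pi < s * \<bar>Arg (- x)\<bar>" using s arc by (auto simp: S_def divide_less_eq mult.commute)
      then show "cmod x powr s = riesz_kernel p x" by (simp add: v min_def)
    qed
  qed
qed

lemma riesz_kernel_nonneg:
  assumes p: "1 < p" and w: "0 \<le> Re w" shows "0 \<le> riesz_kernel p w"
proof (cases "p \<le> 2")
  case True
  have "arccos (Re w / cmod w) \<le> arccos 0"
    using w Re_over_cmod[of w] by (intro arccos_le_arccos) auto
  then have "p / 2 * arccos (Re w / cmod w) \<le> 1 * (pi / 2)"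
    using True p Re_over_cmod[of w] by (intro mult_mono) (auto simp: arccos_lbound)
  moreover have "0 \<le> p / 2 * arccos (Re w / cmod w)"
    using p Re_over_cmod[of w] by (intro mult_nonneg_nonneg arccos_lbound) auto
  ultimately have "0 \<le> cos (p / 2 * arccos (Re w / cmod w))"
    by (intro cos_ge_zero) auto
  then show ?thesis using True by (simp add: riesz_kernel_def)
next
  case False
  have "arccos 0 \<le> arccos (- Re w / cmod w)"
    using w Re_over_cmod[of w] by (intro arccos_le_arccos) auto
  then have "1 * (pi / 2) \<le> p / 2 * arccos (- Re w / cmod w)"
    using False by (intro mult_mono) auto
  then have "cos (min (p / 2 * arccos (- Re w / cmod w)) pi) \<le> cos (pi / 2)"
    by (intro cos_monotone_0_pi_le) auto
  then have "0 \<le> cmod w powr (p / 2) * - cos (min (p / 2 * arccos (- Re w / cmod w)) pi)"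
    by (intro mult_nonneg_nonneg) auto
  then show ?thesis using False by (simp add: riesz_kernel_def)
qed

text \<open>
  The mean at radius 0 is the kernel at \<open>F 0\<close>. The kernel has no support at 0, which is why the zeros of \<open>F\<close>
  are exceptional points. If \<open>F 0\<close> itself is 0, a small positive constant is added to \<open>F\<close> and then removed by continuity.
\<close>

lemma circle_mean_riesz_kernel_nonneg:
  assumes F: "F holomorphic_on ball 0 1" and F0: "0 \<le> Re (F 0)" and p: "1 < p" and r: "0 < r" "r < 1"
  shows "0 \<le> circle_mean r (\<lambda>z. riesz_kernel p (F z))"
proof -
  have supp: "harmonic_support (riesz_kernel p) w" if "w \<noteq> 0" for w
    using harmonic_support_riesz_kernel_small[OF p] harmonic_support_riesz_kernel_large that by fastforce
  have sub: "ball 0 r \<subseteq> ball (0::complex) 1" "cball 0 r \<subseteq> ball (0::complex) 1" using r by auto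
  note cv = continuous_on_riesz_kernel[OF p]
  have cF: "continuous_on (cball 0 r) F"
    by (rule continuous_on_subset[OF holomorphic_on_imp_continuous_on[OF F] sub(2)])
  have pos: "0 \<le> circle_mean r (\<lambda>z. riesz_kernel p (F z + of_real \<eta>))"
    if \<eta>: "0 \<le> \<eta>" "F 0 + of_real \<eta> \<noteq> 0" for \<eta>
  proof -
    define G where "G z = F z + of_real \<eta>" for z
    have G: "G holomorphic_on ball 0 1" unfolding G_def by (intro holomorphic_intros F)
    have cG: "continuous_on (cball 0 r) G" unfolding G_def by (intro continuous_intros cF)
    have "0 \<le> riesz_kernel p (G 0)" using F0 \<eta> by (intro riesz_kernel_nonneg p) (auto simp: G_def)
    also have "\<dots> = circle_mean 0 (\<lambda>z. riesz_kernel p (G z))" by (simp add: circle_mean_def)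
    also have "\<dots> \<le> circle_mean r (\<lambda>z. riesz_kernel p (G z))"
    proof (rule circle_mean_le[where E = G])
      show "continuous_on (cball 0 r) (\<lambda>z. riesz_kernel p (G z))"
        by (rule continuous_on_compose2[OF cv cG]) auto
      show "G holomorphic_on ball 0 r" by (rule holomorphic_on_subset[OF G sub(1)])
      fix z assume "z \<in> ball 0 r" "G z \<noteq> 0"
      then show "harmonic_support (\<lambda>z. riesz_kernel p (G z)) z"
        using sub by (intro harmonic_support_compose[where F = G, OF supp open_ball _ G]) auto
    qed (use r \<eta> cG in \<open>auto simp: G_def\<close>)
    finally show ?thesis by (simp add: G_def)
  qed
  show ?thesis
  proof (cases "F 0 = 0")
    case False
    then show ?thesis using pos[of 0] by simp
  next
    case True
    define u where "u x = integral {0..2 * pi} (\<lambda>t. riesz_kernel p (F (of_real r * cis t) + of_real x))" for x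
    have "continuous_on {0..1} u"
      unfolding u_def
    proof (rule integral_continuous_on_param[of "{0..1::real}" 0 "2 * pi", simplified])
      have cF': "continuous_on ({0..1} \<times> {0..2 * pi}) (\<lambda>y. F (of_real r * cis (snd y)))"
        by (rule continuous_on_compose2[OF cF]) (use r in \<open>auto intro!: continuous_intros simp: norm_mult\<close>)
      show "continuous_on ({0..1} \<times> {0..2 * pi}) (\<lambda>(x, t). riesz_kernel p (F (of_real r * cis t) + of_real x))"
        unfolding case_prod_beta
        by (rule continuous_on_compose2[OF cv]) (auto intro!: continuous_intros cF')
    qed
    then have "(u \<longlongrightarrow> u 0) (at 0 within {0..1})" by (simp add: continuous_on_def)
    then have "(u \<longlongrightarrow> u 0) (at_right 0)"
      by (metis at_within_Icc_at_right zero_less_one)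
    moreover have "0 \<le> u x" if "0 < x" for x
    proof -
      have "0 \<le> u x / (2 * pi)" using pos[of x] that True by (simp add: circle_mean_def u_def)
      then have "0 \<le> u x / (2 * pi) * (2 * pi)" by (intro mult_nonneg_nonneg) auto
      then show ?thesis by simp
    qed
    then have "eventually (\<lambda>x. 0 \<le> u x) (at_right 0)"
      by (intro eventually_at_right_less[THEN eventually_mono]) auto
    ultimately have "0 \<le> u 0" by (intro tendsto_lowerbound) auto
    then show ?thesis by (simp add: u_def circle_mean_def)
  qed
qed

section \<open>Integration over the unit circle\<close>

lemma cis_measurable [measurable]: "cis \<in> borel \<rightarrow>\<^sub>M restrict_space borel (sphere 0 1)"
  by (intro measurable_restrict_space2 borel_measurable_continuous_onI) (auto intro: continuous_intros)

lemma sets_circle_measure [measurable_cong]: "sets circle_measure = sets (restrict_space borel (sphere 0 1))"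
  by (simp add: circle_measure_def)

lemma space_circle_measure: "space circle_measure = sphere 0 1"
  by (simp add: circle_measure_def space_restrict_space)

lemma emeasure_circle_measure: "emeasure circle_measure (sphere 0 1) = 1"
proof -
  have "sphere 0 1 \<in> sets (restrict_space borel (sphere (0::complex) 1))"
    by (simp add: sets_restrict_space_iff)
  moreover have "cis -` sphere 0 1 = UNIV" by auto
  ultimately show ?thesis
    unfolding circle_measure_def by (simp add: emeasure_distr emeasure_uniform_measure ennreal_divide_self)
qed

interpretation circle: finite_measure circle_measure
  by (rule finite_measureI) (simp add: space_circle_measure emeasure_circle_measure)

lemma measure_circle_measure: "measure circle_measure (sphere 0 1) = 1"
  by (simp add: measure_def emeasure_circle_measure)

lemma uniform_measure_2pi:
  "uniform_measure lborel {0..2 * pi} = density lborel (\<lambda>t. ennreal (indicator {0..2 * pi} t / (2 * pi)))"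
  unfolding uniform_measure_def
  by (intro density_cong) (auto simp: indicator_def divide_ennreal simp flip: ennreal_1)

lemma integrable_circle_measure_iff:
  fixes f :: "complex \<Rightarrow> 'b::euclidean_space"
  assumes [measurable]: "f \<in> borel_measurable circle_measure"
  shows "integrable circle_measure f \<longleftrightarrow> set_integrable lborel {0..2 * pi} (\<lambda>t. f (cis t))"
proof -
  have [measurable]: "f \<in> borel_measurable (restrict_space borel (sphere 0 1))"
    using assms measurable_cong_sets[OF sets_circle_measure refl] by auto
  have [measurable]: "(\<lambda>t. f (cis t)) \<in> borel_measurable borel" by measurable
  have "integrable circle_measure f \<longleftrightarrow> integrable (uniform_measure lborel {0..2 * pi}) (\<lambda>t. f (cis t))"
    unfolding circle_measure_def by (rule integrable_distr_eq) simp_all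
  also have "\<dots> \<longleftrightarrow> integrable lborel (\<lambda>t. (indicator {0..2 * pi} t / (2 * pi)) *\<^sub>R f (cis t))"
    unfolding uniform_measure_2pi by (rule integrable_density) auto
  also have "(\<lambda>t. (indicator {0..2 * pi} t / (2 * pi)) *\<^sub>R f (cis t)) = (\<lambda>t. (1 / (2 * pi)) *\<^sub>R (indicator {0..2 * pi} t *\<^sub>R f (cis t)))"
    by auto
  also have "integrable lborel \<dots> \<longleftrightarrow> integrable lborel (\<lambda>t. indicator {0..2 * pi} t *\<^sub>R f (cis t))"
  proof
    assume "integrable lborel (\<lambda>t. (1 / (2 * pi)) *\<^sub>R (indicator {0..2 * pi} t *\<^sub>R f (cis t)))"
    then have "integrable lborel (\<lambda>t. (2 * pi) *\<^sub>R ((1 / (2 * pi)) *\<^sub>R (indicator {0..2 * pi} t *\<^sub>R f (cis t))))"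
      by (rule integrable_scaleR_right)
    then show "integrable lborel (\<lambda>t. indicator {0..2 * pi} t *\<^sub>R f (cis t))" by simp
  qed (rule integrable_scaleR_right)
  finally show ?thesis by (simp add: set_integrable_def)
qed

lemma integral_circle_measure:
  fixes f :: "complex \<Rightarrow> 'b::euclidean_space"
  assumes f: "integrable circle_measure f"
  shows "integral\<^sup>L circle_measure f = (1 / (2 * pi)) *\<^sub>R integral {0..2 * pi} (\<lambda>t. f (cis t))"
    and "(\<lambda>t. f (cis t)) absolutely_integrable_on {0..2 * pi}"
proof -
  have fm: "f \<in> borel_measurable circle_measure" using f by simp
  have [measurable]: "f \<in> borel_measurable (restrict_space borel (sphere 0 1))"
    using fm measurable_cong_sets[OF sets_circle_measure refl] by auto
  have [measurable]: "(\<lambda>t. f (cis t)) \<in> borel_measurable borel" by measurable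
  have si: "set_integrable lborel {0..2 * pi} (\<lambda>t. f (cis t))"
    using f integrable_circle_measure_iff[OF fm] by simp
  have "integral\<^sup>L circle_measure f = integral\<^sup>L (uniform_measure lborel {0..2 * pi}) (\<lambda>t. f (cis t))"
    unfolding circle_measure_def by (rule integral_distr) simp_all
  also have "\<dots> = integral\<^sup>L lborel (\<lambda>t. (indicator {0..2 * pi} t / (2 * pi)) *\<^sub>R f (cis t))"
    unfolding uniform_measure_2pi by (rule integral_density) auto
  also have "(\<lambda>t. (indicator {0..2 * pi} t / (2 * pi)) *\<^sub>R f (cis t)) = (\<lambda>t. (1 / (2 * pi)) *\<^sub>R (indicator {0..2 * pi} t *\<^sub>R f (cis t)))"
    by auto
  also have "integral\<^sup>L lborel \<dots> = (1 / (2 * pi)) *\<^sub>R (LINT t:{0..2 * pi}|lborel. f (cis t))"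
    unfolding set_lebesgue_integral_def by (rule integral_scaleR_right)
  finally show "integral\<^sup>L circle_measure f = (1 / (2 * pi)) *\<^sub>R integral {0..2 * pi} (\<lambda>t. f (cis t))"
    by (simp add: set_borel_integral_eq_integral(2)[OF si])
  show "(\<lambda>t. f (cis t)) absolutely_integrable_on {0..2 * pi}"
    using si by (simp add: absolutely_integrable_on_def set_integrable_def integrable_completion)
qed

lemma AE_circle_measureI:
  assumes m: "{\<zeta> \<in> sphere 0 1. P \<zeta>} \<in> sets circle_measure"
    and ae: "AE t in lborel. t \<in> {0..2 * pi} \<longrightarrow> P (cis t)"
  shows "AE \<zeta> in circle_measure. P \<zeta>"
proof -
  have "AE t in uniform_measure lborel {0..2 * pi}. P (cis t)"
    by (rule AE_uniform_measureI[OF _ ae]) simp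
  moreover have "{\<zeta> \<in> space (restrict_space borel (sphere 0 1)). P \<zeta>} \<in> sets (restrict_space borel (sphere 0 1))"
    using m by (simp add: sets_circle_measure space_restrict_space)
  ultimately show ?thesis
    unfolding circle_measure_def by (subst AE_distr_iff) auto
qed

lemma continuous_on_sphere_measurable:
  fixes f :: "complex \<Rightarrow> 'b::topological_space"
  assumes "continuous_on (sphere 0 1) f" shows "f \<in> borel_measurable circle_measure"
  using borel_measurable_continuous_on_restrict[OF assms] measurable_cong_sets[OF sets_circle_measure refl] by auto

lemma continuous_on_sphere_integrable:
  fixes f :: "complex \<Rightarrow> 'b::euclidean_space"
  assumes "continuous_on (sphere 0 1) f" shows "integrable circle_measure f"
proof -
  have "compact (f ` sphere 0 1)" by (intro compact_continuous_image assms) auto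
  then obtain B where "\<And>x. x \<in> sphere 0 1 \<Longrightarrow> norm (f x) \<le> B"
    using compact_imp_bounded bounded_iff by (metis image_eqI)
  then show ?thesis
    by (intro circle.integrable_const_bound[where B = B] continuous_on_sphere_measurable assms)
      (auto simp: space_circle_measure intro!: AE_I2)
qed

lemma integral_circle_measure_mean:
  assumes "continuous_on (sphere 0 1) (\<lambda>\<zeta>. V (of_real r * \<zeta>))"
  shows "(LINT \<zeta>|circle_measure. V (of_real r * \<zeta>)) = circle_mean r V"
  using integral_circle_measure(1)[OF continuous_on_sphere_integrable[OF assms]]
  by (simp add: circle_mean_def)

lemma continuous_on_sphere_dilate:
  fixes g :: "complex \<Rightarrow> 'b::topological_space"
  assumes "continuous_on (ball 0 1) g" "0 \<le> r" "r < 1"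
  shows "continuous_on (sphere 0 1) (\<lambda>\<zeta>. g (of_real r * \<zeta>))"
  by (rule continuous_on_compose2[OF assms(1)])
    (use assms in \<open>auto intro!: continuous_intros simp: norm_mult\<close>)

section \<open>Convexity of powers of the modulus\<close>

text \<open>
  Either \<open>b \<le> \<epsilon> a\<close> or \<open>a \<le> b / \<epsilon>\<close>. In integrated form this replaces Minkowski's inequality.
\<close>

lemma powr_add_le_weighted:
  fixes a b :: real
  assumes "0 \<le> a" "0 \<le> b" "0 < \<epsilon>" "0 < p"
  shows "(a + b) powr p \<le> (1 + \<epsilon>) powr p * a powr p + (1 + 1 / \<epsilon>) powr p * b powr p"
proof (cases "b \<le> \<epsilon> * a")
  case True
  then have "(a + b) powr p \<le> ((1 + \<epsilon>) * a) powr p"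
    using assms by (intro powr_mono2) (auto simp: algebra_simps)
  also have "\<dots> = (1 + \<epsilon>) powr p * a powr p" by (rule powr_mult)
  finally show ?thesis by (simp add: add_increasing2)
next
  case False
  then have "a \<le> b / \<epsilon>" using assms by (simp add: field_simps)
  then have "(a + b) powr p \<le> ((1 + 1 / \<epsilon>) * b) powr p"
    using assms by (intro powr_mono2) (auto simp: algebra_simps)
  also have "\<dots> = (1 + 1 / \<epsilon>) powr p * b powr p" by (rule powr_mult)
  finally show ?thesis by (simp add: add_increasing)
qed

text \<open>
  If \<open>|a + b| < |a| + |b|\<close>, it suffices that \<open>t^p\<close> is convex and increasing. Otherwise \<open>a\<close> and \<open>b\<close> are on a common ray,
  so \<open>|a| \<noteq> |b|\<close>, and the strict convexity of \<open>t^p\<close> applies.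
\<close>

lemma norm_powr_midpoint_strict:
  fixes a b :: complex
  assumes p: "1 < p" and ab: "a \<noteq> b"
  shows "cmod ((a + b) / 2) powr p < (cmod a powr p + cmod b powr p) / 2"
proof -
  define m where "m = (cmod a + cmod b) / 2"
  have m: "0 < m" using ab by (cases "a = 0") (auto simp: m_def add_pos_nonneg)
  have bern: "1 + p * (x - 1) \<le> x powr p \<and> (x \<noteq> 1 \<longrightarrow> 1 + p * (x - 1) < x powr p)" if "0 \<le> x" for x
  proof (cases "x = 0 \<or> x = 1")
    case False
    have d: "((\<lambda>x. x powr p) has_real_derivative p * z powr (p - 1)) (at z)" if "0 < z" for z
      using that by (auto intro!: derivative_eq_intros)
    consider "x < 1" | "1 < x" using False by linarith
    then show ?thesis
    proof cases
      case 1
      have x0: "0 < x" using that False by simp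
      have "\<exists>z>x. z < 1 \<and> 1 powr p - x powr p = (1 - x) * (p * z powr (p - 1))"
        by (rule MVT2[where f = "\<lambda>x. x powr p"]) (use 1 x0 d in auto)
      then obtain z where z: "x < z" "z < 1" "1 powr p - x powr p = (1 - x) * (p * z powr (p - 1))" by blast
      have "z powr (p - 1) < 1 powr (p - 1)" using z that p by (intro powr_less_mono2) auto
      then have "(1 - x) * (p * z powr (p - 1)) < (1 - x) * (p * 1)"
        using 1 p by (intro mult_strict_left_mono) auto
      then show ?thesis using z by (simp add: algebra_simps)
    next
      case 2
      have "\<exists>z>1. z < x \<and> x powr p - 1 powr p = (x - 1) * (p * z powr (p - 1))"
        by (rule MVT2[where f = "\<lambda>x. x powr p"]) (use 2 d in auto)
      then obtain z where z: "1 < z" "z < x" "x powr p - 1 powr p = (x - 1) * (p * z powr (p - 1))" by blast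
      have "1 powr (p - 1) < z powr (p - 1)" using z p by (intro powr_less_mono2) auto
      then have "(x - 1) * (p * 1) < (x - 1) * (p * z powr (p - 1))"
        using 2 p by (intro mult_strict_left_mono) auto
      then show ?thesis using z by (simp add: algebra_simps)
    qed
  qed (use p in auto)
  define x where "x = cmod a / m"
  define y where "y = cmod b / m"
  have "x + y = (cmod a + cmod b) / m" by (simp add: x_def y_def add_divide_distrib)
  also have "cmod a + cmod b = 2 * m" by (simp add: m_def)
  finally have xy: "0 \<le> x" "0 \<le> y" "x + y = 2" using m by (simp_all add: x_def y_def)
  have "p * (x - 1) + p * (y - 1) = p * (x + y - 2)" by (simp add: algebra_simps)
  then have py: "p * (x - 1) + p * (y - 1) = 0" using xy(3) by simp
  have le: "2 \<le> x powr p + y powr p" using bern[OF xy(1)] bern[OF xy(2)] py by linarith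
  have scale: "m powr p * (x powr p + y powr p) = cmod a powr p + cmod b powr p"
    using m by (simp add: x_def y_def powr_divide distrib_left)
  have mid: "cmod ((a + b) / 2) \<le> m" using norm_triangle_ineq[of a b] by (simp add: m_def norm_divide)
  show ?thesis
  proof (cases "cmod ((a + b) / 2) < m")
    case True
    then have "cmod ((a + b) / 2) powr p < m powr p" using p by (intro powr_less_mono2) auto
    also have "m powr p * 2 \<le> m powr p * (x powr p + y powr p)" using le by (intro mult_left_mono) auto
    then have "m powr p \<le> (cmod a powr p + cmod b powr p) / 2" by (simp add: scale)
    finally show ?thesis .
  next
    case False
    then have eq: "cmod ((a + b) / 2) = m" using mid by simp
    then have "cmod (a + b) = cmod a + cmod b" by (simp add: m_def norm_divide)
    then have "cmod a *\<^sub>R b = cmod b *\<^sub>R a" by (simp add: norm_triangle_eq)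
    then have "cmod a \<noteq> cmod b" using ab by auto
    then have "x \<noteq> 1" using m by (auto simp: x_def m_def)
    then have "2 < x powr p + y powr p" using bern[OF xy(1)] bern[OF xy(2)] py by linarith
    then have "m powr p * 2 < m powr p * (x powr p + y powr p)" using m by (intro mult_strict_left_mono) auto
    then have "m powr p * 2 < cmod a powr p + cmod b powr p" by (simp only: scale)
    then show ?thesis unfolding eq by (subst pos_less_divide_eq) simp_all
  qed
qed

text \<open>
  A pointwise form of the uniform convexity of \<open>L^p\<close>: integrated, it shows that two functions are close in
  the \<open>p\<close>-th mean if their midpoint has almost as large a \<open>p\<close>-th mean as they have. If \<open>|a - b|\<close> is
  not small compared with \<open>max |a| |b|\<close>, the midpoint defect is bounded below by homogeneity, compactness and
  strict convexity.
\<close>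

lemma norm_powr_uniformly_convex:
  assumes p: "1 < p" and \<epsilon>: "0 < \<epsilon>"
  obtains \<delta> where "0 < \<delta>" "\<And>a b :: complex. cmod (a - b) powr p
     \<le> \<epsilon> * (cmod a powr p + cmod b powr p)
       + (1 / \<delta>) * ((cmod a powr p + cmod b powr p) / 2 - cmod ((a + b) / 2) powr p)"
proof -
  define D where "D = (\<lambda>(a::complex, b::complex). (cmod a powr p + cmod b powr p) / 2 - cmod ((a + b) / 2) powr p)"
  define K where "K = {(a::complex, b::complex). max (cmod a) (cmod b) = 1 \<and> \<epsilon> \<le> cmod (a - b) powr p}"
  have D_nonneg: "0 \<le> D (a, b)" for a b
    using norm_powr_midpoint_strict[OF p, of a b] by (cases "a = b") (auto simp: D_def)
  have cD: "continuous_on UNIV D" unfolding D_def case_prod_beta using p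
    by (intro continuous_intros continuous_on_powr') auto
  have K_eq: "K = {x. max (cmod (fst x)) (cmod (snd x)) = 1} \<inter> {x. \<epsilon> \<le> cmod (fst x - snd x) powr p}"
    by (auto simp: K_def)
  have "closed K" unfolding K_eq using p
    by (intro closed_Int closed_Collect_eq closed_Collect_le continuous_intros continuous_on_powr') auto
  moreover have "K \<subseteq> cball 0 1 \<times> cball 0 1" by (auto simp: K_def)
  then have "bounded K" by (rule bounded_subset[OF bounded_Times[OF bounded_cball bounded_cball]])
  ultimately have cK: "compact K" by (simp add: compact_eq_bounded_closed)
  obtain \<delta>0 where \<delta>0: "0 < \<delta>0" "\<And>x. x \<in> K \<Longrightarrow> \<delta>0 \<le> D x"
  proof (cases "K = {}")
    case False
    then obtain x where x: "x \<in> K" "\<And>y. y \<in> K \<Longrightarrow> D x \<le> D y"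
      using continuous_attains_inf[OF cK False continuous_on_subset[OF cD]] by blast
    have "fst x \<noteq> snd x" using x(1) \<epsilon> by (auto simp: K_def)
    then have "0 < D x" using norm_powr_midpoint_strict[OF p, of "fst x" "snd x"] by (simp add: D_def case_prod_beta)
    then show ?thesis using that x by blast
  qed (use that[of 1] in auto)
  define \<delta> where "\<delta> = \<delta>0 / 2 powr p"
  show ?thesis
  proof (rule that[of \<delta>])
    show \<delta>: "0 < \<delta>" using \<delta>0 by (simp add: \<delta>_def)
    fix a b :: complex
    define m where "m = max (cmod a) (cmod b)"
    have Dm: "(cmod a powr p + cmod b powr p) / 2 - cmod ((a + b) / 2) powr p = D (a, b)" by (simp add: D_def)
    show "cmod (a - b) powr p \<le> \<epsilon> * (cmod a powr p + cmod b powr p)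
       + (1 / \<delta>) * ((cmod a powr p + cmod b powr p) / 2 - cmod ((a + b) / 2) powr p)"
    proof (cases "m = 0")
      case True
      then have "a = 0" "b = 0" by (auto simp: m_def max_def split: if_splits)
      then show ?thesis by simp
    next
      case False
      then have m: "0 < m" by (auto simp: m_def max_def)
      have mp: "m powr p \<le> cmod a powr p + cmod b powr p" by (auto simp: m_def max_def)
      show ?thesis
      proof (cases "\<epsilon> * m powr p \<le> cmod (a - b) powr p")
        case False
        then have "cmod (a - b) powr p \<le> \<epsilon> * (cmod a powr p + cmod b powr p)"
          using mult_left_mono[OF mp, of \<epsilon>] \<epsilon> by linarith
        moreover have "0 \<le> (1 / \<delta>) * D (a, b)" using \<delta> D_nonneg by simp
        ultimately show ?thesis unfolding Dm by linarith
      next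
        case True
        define c where "c = complex_of_real (1 / m)"
        have n: "cmod (c * z) = cmod z / m" for z using m by (simp add: c_def norm_mult norm_divide)
        have np: "cmod (c * z) powr p = cmod z powr p / m powr p" for z unfolding n by (rule powr_divide)
        have mid: "(c * a + c * b) / 2 = c * ((a + b) / 2)" by (simp add: algebra_simps add_divide_distrib)
        have hom: "D (c * a, c * b) = D (a, b) / m powr p"
          unfolding D_def case_prod_conv mid np by (simp add: diff_divide_distrib add_divide_distrib)
        have "c * a - c * b = c * (a - b)" by (simp only: right_diff_distrib)
        then have "cmod (c * a - c * b) powr p = cmod (a - b) powr p / m powr p" by (simp only: np)
        moreover have "max (cmod a / m) (cmod b / m) = 1" using m by (auto simp: m_def max_def)
        moreover have "\<epsilon> \<le> cmod (a - b) powr p / m powr p" using True m by (simp add: pos_le_divide_eq)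
        ultimately have "(c * a, c * b) \<in> K" by (simp only: K_def mem_Collect_eq case_prod_conv n)
        then have "\<delta>0 \<le> D (a, b) / m powr p" using \<delta>0(2) hom by metis
        then have low: "\<delta>0 * m powr p \<le> D (a, b)" using m by (simp add: pos_le_divide_eq)
        have "cmod (a - b) powr p \<le> (2 * m) powr p"
          using p norm_triangle_ineq4[of a b] by (intro powr_mono2) (auto simp: m_def max_def)
        also have "\<dots> = (1 / \<delta>) * (\<delta>0 * m powr p)" using \<delta>0 by (simp add: \<delta>_def powr_mult)
        also have "\<dots> \<le> (1 / \<delta>) * D (a, b)" using low \<delta> by (intro mult_left_mono) auto
        finally have "cmod (a - b) powr p \<le> (1 / \<delta>) * D (a, b)" .
        moreover have "0 \<le> \<epsilon> * (cmod a powr p + cmod b powr p)" using \<epsilon> by simp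
        ultimately show ?thesis unfolding Dm by linarith
      qed
    qed
  qed
qed

section \<open>Boundary functions in the mean\<close>

lemma integral_le_AE_limit:
  fixes f :: "nat \<Rightarrow> 'a \<Rightarrow> real"
  assumes f: "\<And>n. integrable M (f n)" "\<And>n x. 0 \<le> f n x"
    and F: "F \<in> borel_measurable M" "AE x in M. (\<lambda>n. f n x) \<longlonglongrightarrow> F x"
    and c: "eventually (\<lambda>n. integral\<^sup>L M (f n) \<le> c) sequentially"
  shows "integrable M F" "integral\<^sup>L M F \<le> c"
proof -
  have F0: "AE x in M. 0 \<le> F x"
    using F(2) by eventually_elim (rule LIMSEQ_le_const, use f in auto)
  obtain n where "integral\<^sup>L M (f n) \<le> c" using c by (meson eventually_happens sequentially_bot)
  moreover have "0 \<le> integral\<^sup>L M (f n)" by (rule integral_nonneg_AE) (use f in auto)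
  ultimately have c0: "0 \<le> c" by linarith
  have "(\<integral>\<^sup>+x. ennreal (F x) \<partial>M) = (\<integral>\<^sup>+x. liminf (\<lambda>n. ennreal (f n x)) \<partial>M)"
  proof (rule nn_integral_cong_AE)
    show "AE x in M. ennreal (F x) = liminf (\<lambda>n. ennreal (f n x))"
      using F(2)
    proof eventually_elim
      case (elim x)
      then have "(\<lambda>n. ennreal (f n x)) \<longlonglongrightarrow> ennreal (F x)" by (rule tendsto_ennrealI)
      then show ?case by (rule lim_imp_Liminf[symmetric, rotated]) simp
    qed
  qed
  also have "\<dots> \<le> liminf (\<lambda>n. \<integral>\<^sup>+x. ennreal (f n x) \<partial>M)"
    using f by (intro nn_integral_liminf) auto
  also have "\<dots> \<le> ennreal c"
  proof -
    have "eventually (\<lambda>n. (\<integral>\<^sup>+x. ennreal (f n x) \<partial>M) \<le> ennreal c) sequentially"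
      using c by eventually_elim (use f in \<open>simp add: nn_integral_eq_integral ennreal_leI\<close>)
    then have "liminf (\<lambda>n. \<integral>\<^sup>+x. ennreal (f n x) \<partial>M) \<le> liminf (\<lambda>n. ennreal c)"
      by (rule Liminf_mono)
    then show ?thesis by (simp add: Liminf_const)
  qed
  finally have le: "(\<integral>\<^sup>+x. ennreal (F x) \<partial>M) \<le> ennreal c" .
  then have "(\<integral>\<^sup>+x. ennreal (F x) \<partial>M) < \<infinity>" by (rule le_less_trans) simp
  then show int: "integrable M F" using F(1) F0 by (intro integrableI_nonneg)
  show "integral\<^sup>L M F \<le> c"
    using le nn_integral_eq_integral[OF int F0] c0 by simp
qed

text \<open>
  Let \<open>S\<close> be the supremum of the \<open>p\<close>-th means of \<open>g\<close> and \<open>\<rho>\<close> a radius at which the mean is almost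
  \<open>S\<close>. The \<open>p\<close>-th mean of \<open>(g(r z) + g(s z)) / 2\<close> over the unit circle is at least that over the
  circle of radius \<open>\<rho>\<close>, and as \<open>r\<close> and \<open>s\<close> tend to 1 the latter tends to the mean of \<open>g\<close> at radius
  \<open>\<rho>\<close>. So the midpoint of the two dilates has almost the maximal mean, and uniform convexity applies.
\<close>

lemma dilates_Cauchy:
  assumes p: "1 < p" and g: "g holomorphic_on ball 0 1"
    and bd: "\<And>r. 0 < r \<Longrightarrow> r < 1 \<Longrightarrow> (LINT \<zeta>|circle_measure. cmod (g (of_real r * \<zeta>)) powr p) \<le> C"
    and \<epsilon>: "0 < \<epsilon>"
  obtains R where "0 \<le> R" "R < 1" "\<And>r s. R < r \<Longrightarrow> r < 1 \<Longrightarrow> R < s \<Longrightarrow> s < 1 \<Longrightarrow>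
     (LINT \<zeta>|circle_measure. cmod (g (of_real r * \<zeta>) - g (of_real s * \<zeta>)) powr p) \<le> \<epsilon>"
proof -
  note cg = holomorphic_on_imp_continuous_on[OF g]
  have cgr: "continuous_on (sphere 0 1) (\<lambda>\<zeta>. g (of_real r * \<zeta>))" if "0 \<le> r" "r < 1" for r
    by (rule continuous_on_sphere_dilate[OF cg that])
  have cp: "continuous_on (sphere 0 1) (\<lambda>\<zeta>. cmod (f \<zeta>) powr p)" if "continuous_on (sphere 0 1) f" for f :: "complex \<Rightarrow> complex"
    using p that by (intro continuous_on_powr' continuous_intros) auto
  define I where "I r = circle_mean r (\<lambda>z. cmod (g z) powr p)" for r
  have I: "(LINT \<zeta>|circle_measure. cmod (g (of_real r * \<zeta>)) powr p) = I r" if "0 \<le> r" "r < 1" for r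
    unfolding I_def by (rule integral_circle_measure_mean[OF cp[OF cgr[OF that]]])
  define S where "S = (SUP r\<in>{0<..<1}. I r)"
  have bdd: "bdd_above (I ` {0<..<1})" using bd I by (auto simp: bdd_above_def intro!: exI[of _ C])
  have IS: "I r \<le> S" if "0 < r" "r < 1" for r unfolding S_def using that by (intro cSUP_upper bdd) auto
  have "0 \<le> I (1/2)" using I[of "1/2"] by (simp flip: I)
  then have S0: "0 \<le> S" using IS[of "1/2"] by simp
  obtain \<delta> where \<delta>: "0 < \<delta>" "\<And>a b :: complex. cmod (a - b) powr p
     \<le> \<epsilon> / (4 * (S + 1)) * (cmod a powr p + cmod b powr p)
       + (1 / \<delta>) * ((cmod a powr p + cmod b powr p) / 2 - cmod ((a + b) / 2) powr p)"
    using norm_powr_uniformly_convex[OF p, of "\<epsilon> / (4 * (S + 1))"] \<epsilon> S0 by auto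
  define \<eta> where "\<eta> = \<delta> * \<epsilon> / 4"
  have \<eta>: "0 < \<eta>" using \<delta> \<epsilon> by (simp add: \<eta>_def)
  obtain \<rho> where \<rho>: "0 < \<rho>" "\<rho> < 1" "S - \<eta> < I \<rho>"
  proof -
    have "S - \<eta> < (SUP r\<in>{0<..<1}. I r)" using \<eta> by (simp add: S_def)
    then show ?thesis using that by (subst (asm) less_cSUP_iff[OF _ bdd]) auto
  qed
  define \<Phi> where "\<Phi> x = integral {0..2 * pi} (\<lambda>t. cmod ((g (of_real (fst x * \<rho>) * cis t) + g (of_real (snd x * \<rho>) * cis t)) / 2) powr p)"
    for x :: "real \<times> real"
  have "continuous_on ({0..1} \<times> {0..1}) \<Phi>"
    unfolding \<Phi>_def
  proof (rule integral_continuous_on_param[of "{0..1} \<times> {0..1}" 0 "2 * pi", simplified])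
    have m: "a * \<rho> < 1" if "0 \<le> a" "a \<le> 1" for a :: real
    proof -
      have "a * \<rho> \<le> 1 * \<rho>" using that \<rho> by (intro mult_right_mono) auto
      then show ?thesis using \<rho> by linarith
    qed
    have "continuous_on (({0..1} \<times> {0..1}) \<times> {0..2 * pi}) (\<lambda>y. g (of_real (fst (fst y) * \<rho>) * cis (snd y)))"
      "continuous_on (({0..1} \<times> {0..1}) \<times> {0..2 * pi}) (\<lambda>y. g (of_real (snd (fst y) * \<rho>) * cis (snd y)))"
      by (rule continuous_on_compose2[OF cg]; use m \<rho> in \<open>auto intro!: continuous_intros simp: norm_mult abs_mult\<close>)+
    then show "continuous_on (({0..1} \<times> {0..1}) \<times> {0..2 * pi})
       (\<lambda>(x, t). cmod ((g (of_real (fst x * \<rho>) * cis t) + g (of_real (snd x * \<rho>) * cis t)) / 2) powr p)"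
      unfolding case_prod_beta using p by (intro continuous_on_powr' continuous_intros) auto
  qed
  then obtain d where d: "0 < d" "\<And>x. x \<in> {0..1} \<times> {0..1} \<Longrightarrow> dist x (1, 1) < d \<Longrightarrow> dist (\<Phi> x) (\<Phi> (1, 1)) < 2 * pi * \<eta>"
    unfolding continuous_on_iff using \<eta> by (metis atLeastAtMost_iff mem_Times_iff fst_conv snd_conv order_refl zero_le_one mult_pos_pos pi_gt_zero zero_less_numeral)
  have \<Phi>1: "\<Phi> (1, 1) = 2 * pi * I \<rho>" by (simp add: \<Phi>_def I_def circle_mean_def)
  define R where "R = max 0 (1 - d / 2)"
  show ?thesis
  proof (rule that[of R])
    show "0 \<le> R" "R < 1" using d by (auto simp: R_def)
    fix r s assume rs: "R < r" "r < 1" "R < s" "s < 1"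
    then have rs0: "0 < r" "0 < s" by (auto simp: R_def)
    define J where "J = (LINT \<zeta>|circle_measure. cmod ((g (of_real r * \<zeta>) + g (of_real s * \<zeta>)) / 2) powr p)"
    \<comment> \<open>The midpoint \<open>F\<close> is rescaled by \<open>t\<close> so that it is holomorphic on the unit disk and the dilates of \<open>g\<close> by \<open>r\<close> and \<open>s\<close> occur on the circle of radius \<open>t < 1\<close>.\<close>
    define t where "t = (1 + max r s) / 2"
    have t: "r < t" "s < t" "t < 1" "0 < t" using rs rs0 by (auto simp: t_def)
    define F where "F z = (g (of_real (r / t) * z) + g (of_real (s / t) * z)) / 2" for z
    have lt: "cmod (of_real (x / t) * z) < 1" if "0 < x" "x < t" "cmod z < 1" for x z
    proof -
      have "x / t < 1" "0 \<le> x / t" using that t by auto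
      then have "x / t * cmod z \<le> 1 * cmod z" by (intro mult_right_mono) auto
      moreover have "cmod (of_real (x / t) * z) = x / t * cmod z"
        using \<open>0 \<le> x / t\<close> by (simp only: norm_mult norm_of_real abs_of_nonneg)
      ultimately show ?thesis using that(3) by linarith
    qed
    have "F holomorphic_on ball 0 1" unfolding F_def
      using lt rs0 t
      by (intro holomorphic_intros holomorphic_on_compose_gen[OF _ g, unfolded o_def]) auto
    then have FF: "circle_mean (\<rho> * t) (\<lambda>z. cmod (F z) powr p) \<le> circle_mean t (\<lambda>z. cmod (F z) powr p)"
      using p \<rho> t mult_right_mono[of \<rho> 1 t] by (intro circle_mean_norm_powr_mono) auto
    have Jc: "continuous_on (sphere 0 1) (\<lambda>\<zeta>. cmod ((g (of_real r * \<zeta>) + g (of_real s * \<zeta>)) / 2) powr p)"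
      using rs rs0 by (intro cp continuous_intros cgr) auto
    have J: "J = circle_mean t (\<lambda>z. cmod (F z) powr p)"
    proof -
      have eq: "(\<lambda>\<zeta>. cmod (F (of_real t * \<zeta>)) powr p) = (\<lambda>\<zeta>. cmod ((g (of_real r * \<zeta>) + g (of_real s * \<zeta>)) / 2) powr p)"
        using t by (simp add: F_def)
      have "continuous_on (sphere 0 1) (\<lambda>\<zeta>. cmod (F (of_real t * \<zeta>)) powr p)"
        unfolding eq by (rule Jc)
      then show ?thesis unfolding J_def eq[symmetric] by (rule integral_circle_measure_mean)
    qed
    have "circle_mean (\<rho> * t) (\<lambda>z. cmod (F z) powr p) = \<Phi> (r, s) / (2 * pi)"
      using t by (simp add: circle_mean_def \<Phi>_def F_def mult_ac)
    moreover have "dist (\<Phi> (r, s)) (\<Phi> (1, 1)) < 2 * pi * \<eta>"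
    proof (rule d(2))
      have "\<bar>r - 1\<bar> < d / 2" "\<bar>s - 1\<bar> < d / 2" using rs by (auto simp: R_def)
      moreover have "dist (r, s) (1, 1) \<le> \<bar>r - 1\<bar> + \<bar>s - 1\<bar>"
        using sqrt_sum_squares_le_sum_abs[of "r - 1" "s - 1"] by (simp add: dist_Pair_Pair dist_real_def)
      ultimately show "dist (r, s) (1, 1) < d" by linarith
    qed (use rs rs0 in auto)
    ultimately have "2 * pi * I \<rho> < 2 * pi * (circle_mean (\<rho> * t) (\<lambda>z. cmod (F z) powr p) + \<eta>)"
      unfolding \<Phi>1 dist_real_def abs_less_iff by (simp add: distrib_left)
    then have "I \<rho> < circle_mean (\<rho> * t) (\<lambda>z. cmod (F z) powr p) + \<eta>" by simp
    then have "I \<rho> - \<eta> \<le> J" using FF J by linarith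
    then have Jlow: "S - 2 * \<eta> \<le> J" using \<rho> by simp
    have ints: "integrable circle_measure (\<lambda>\<zeta>. cmod (g (of_real r * \<zeta>)) powr p)"
      "integrable circle_measure (\<lambda>\<zeta>. cmod (g (of_real s * \<zeta>)) powr p)"
      "integrable circle_measure (\<lambda>\<zeta>. cmod (g (of_real r * \<zeta>) - g (of_real s * \<zeta>)) powr p)"
      using rs rs0 by (auto intro!: continuous_on_sphere_integrable cp cgr continuous_intros)
    note intJ = continuous_on_sphere_integrable[OF Jc]
    have "(LINT \<zeta>|circle_measure. cmod (g (of_real r * \<zeta>) - g (of_real s * \<zeta>)) powr p)
      \<le> (LINT \<zeta>|circle_measure. \<epsilon> / (4 * (S + 1)) * (cmod (g (of_real r * \<zeta>)) powr p + cmod (g (of_real s * \<zeta>)) powr p)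
       + (1 / \<delta>) * ((cmod (g (of_real r * \<zeta>)) powr p + cmod (g (of_real s * \<zeta>)) powr p) / 2
          - cmod ((g (of_real r * \<zeta>) + g (of_real s * \<zeta>)) / 2) powr p))"
      by (intro integral_mono ints \<delta>(2) Bochner_Integration.integrable_add Bochner_Integration.integrable_diff
          integrable_mult_right integrable_divide intJ)
    also have "\<dots> = \<epsilon> / (4 * (S + 1)) * (I r + I s) + (1 / \<delta>) * ((I r + I s) / 2 - J)"
      using ints intJ rs rs0 by (simp add: I J_def)
    also have "\<dots> \<le> \<epsilon> / (4 * (S + 1)) * (2 * (S + 1)) + (1 / \<delta>) * (2 * \<eta>)"
    proof -
      have le: "I r \<le> S" "I s \<le> S" using IS rs rs0 by auto
      have "I r + I s \<le> 2 * (S + 1)" "(I r + I s) / 2 - J \<le> 2 * \<eta>" using le Jlow unfolding distrib_left add_divide_distrib by linarith+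
      then show ?thesis using \<epsilon> S0 \<delta>(1) by (intro add_mono mult_left_mono) auto
    qed
    also have "\<dots> = \<epsilon>" using S0 \<delta>(1) by (simp add: \<eta>_def field_simps)
    finally show "(LINT \<zeta>|circle_measure. cmod (g (of_real r * \<zeta>) - g (of_real s * \<zeta>)) powr p) \<le> \<epsilon>" .
  qed
qed

text \<open>
  Along a suitable sequence of radii the increments of the dilates are summable almost everywhere, which
  defines the boundary function \<open>G\<close>. Fatou's lemma then turns the Cauchy property into convergence to \<open>G\<close>
  for all radii.
\<close>

lemma hardy_boundary_function:
  assumes p: "1 < p" and g: "g holomorphic_on ball 0 1"
    and bd: "\<And>r. 0 < r \<Longrightarrow> r < 1 \<Longrightarrow> (LINT \<zeta>|circle_measure. cmod (g (of_real r * \<zeta>)) powr p) \<le> C"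
  obtains G where "G \<in> borel_measurable circle_measure"
    "integrable circle_measure (\<lambda>\<zeta>. cmod (G \<zeta>) powr p)"
    "\<And>r. 0 < r \<Longrightarrow> r < 1 \<Longrightarrow> integrable circle_measure (\<lambda>\<zeta>. cmod (g (of_real r * \<zeta>) - G \<zeta>) powr p)"
    "((\<lambda>r. LINT \<zeta>|circle_measure. cmod (g (of_real r * \<zeta>) - G \<zeta>) powr p) \<longlongrightarrow> 0) (at_left 1)"
proof -
  note cg = holomorphic_on_imp_continuous_on[OF g]
  have cgr: "continuous_on (sphere 0 1) (\<lambda>\<zeta>. g (of_real r * \<zeta>))" if "0 \<le> r" "r < 1" for r
    by (rule continuous_on_sphere_dilate[OF cg that])
  have cp: "continuous_on (sphere 0 1) (\<lambda>\<zeta>. cmod (f \<zeta>) powr p)" if "continuous_on (sphere 0 1) f" for f :: "complex \<Rightarrow> complex"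
    using p that by (intro continuous_on_powr' continuous_intros) auto
  define D where "D r s = (LINT \<zeta>|circle_measure. cmod (g (of_real r * \<zeta>) - g (of_real s * \<zeta>)) powr p)" for r s
  have "\<forall>\<epsilon>>0. \<exists>R. 0 \<le> R \<and> R < 1 \<and> (\<forall>r s. R < r \<longrightarrow> r < 1 \<longrightarrow> R < s \<longrightarrow> s < 1 \<longrightarrow> D r s \<le> \<epsilon>)"
  proof (intro allI impI)
    fix \<epsilon> :: real assume \<epsilon>: "0 < \<epsilon>"
    show "\<exists>R. 0 \<le> R \<and> R < 1 \<and> (\<forall>r s. R < r \<longrightarrow> r < 1 \<longrightarrow> R < s \<longrightarrow> s < 1 \<longrightarrow> D r s \<le> \<epsilon>)"
    proof (rule dilates_Cauchy[of p g C \<epsilon>])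
      fix R assume "0 \<le> R" "R < 1" "\<And>r s. R < r \<Longrightarrow> r < 1 \<Longrightarrow> R < s \<Longrightarrow> s < 1 \<Longrightarrow>
         (LINT \<zeta>|circle_measure. cmod (g (of_real r * \<zeta>) - g (of_real s * \<zeta>)) powr p) \<le> \<epsilon>"
      then show ?thesis unfolding D_def by (intro exI[of _ R]) simp
    qed (use p g bd \<epsilon> in simp_all)
  qed
  then have "\<exists>R. \<forall>\<epsilon>>0. 0 \<le> R \<epsilon> \<and> R \<epsilon> < 1 \<and> (\<forall>r s. R \<epsilon> < r \<longrightarrow> r < 1 \<longrightarrow> R \<epsilon> < s \<longrightarrow> s < 1 \<longrightarrow> D r s \<le> \<epsilon>)"
    by (intro choice) blast
  then obtain R where R: "\<And>\<epsilon>. 0 < \<epsilon> \<Longrightarrow> 0 \<le> R \<epsilon>" "\<And>\<epsilon>. 0 < \<epsilon> \<Longrightarrow> R \<epsilon> < 1"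
    "\<And>\<epsilon> r s. 0 < \<epsilon> \<Longrightarrow> R \<epsilon> < r \<Longrightarrow> r < 1 \<Longrightarrow> R \<epsilon> < s \<Longrightarrow> s < 1 \<Longrightarrow> D r s \<le> \<epsilon>"
    by blast
  \<comment> \<open>With this tolerance the \<open>p\<close>-th mean of the \<open>k\<close>-th increment, multiplied by \<open>2 powr (k (p - 1))\<close>, is at most \<open>(1 / 2) ^ k\<close>; an increment \<open>x\<close> is at most \<open>(1 / 2) ^ k + 2 powr (k (p - 1)) * x powr p\<close>.\<close>
  define e where "e k = (1 / 2) powr (real k * p)" for k :: nat
  have e: "0 < e k" for k by (simp add: e_def)
  define \<rho> where "\<rho> k = (1 + Max ((\<lambda>j. R (e j)) ` {..k} \<union> {1 - 1 / (real k + 1)})) / 2" for k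
  have \<rho>: "R (e j) < \<rho> k" "\<rho> k < 1" "1 - 1 / (real k + 1) < \<rho> k" if "j \<le> k" for j k
  proof -
    define A where "A = (\<lambda>j. R (e j)) ` {..k} \<union> {1 - 1 / (real k + 1)}"
    have fin: "finite A" by (simp add: A_def)
    have "Max A \<in> A" by (rule Max_in[OF fin]) (simp add: A_def)
    then have m1: "Max A < 1" using R(2) e by (auto simp: A_def)
    have "R (e j) \<le> Max A" using that by (intro Max_ge fin) (auto simp: A_def)
    moreover have "1 - 1 / (real k + 1) \<le> Max A" by (intro Max_ge fin) (auto simp: A_def)
    ultimately show "R (e j) < \<rho> k" "\<rho> k < 1" "1 - 1 / (real k + 1) < \<rho> k"
      using m1 unfolding \<rho>_def A_def[symmetric] add_divide_distrib by linarith+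
  qed
  have \<rho>0: "0 < \<rho> k" "\<rho> k < 1" for k using \<rho>[of 0 k] R(1)[OF e, of 0] by auto
  have \<rho>1: "\<rho> \<longlonglongrightarrow> 1"
  proof (rule tendsto_sandwich)
    show "(\<lambda>k. 1 - 1 / (real k + 1)) \<longlonglongrightarrow> 1" by real_asymp
    show "\<forall>\<^sub>F k in sequentially. 1 - 1 / (real k + 1) \<le> \<rho> k"
      by (intro always_eventually allI less_imp_le \<rho>(3)[OF order_refl])
    show "\<forall>\<^sub>F k in sequentially. \<rho> k \<le> 1"
      by (intro always_eventually allI less_imp_le \<rho>0)
  qed simp
  define \<Delta> where "\<Delta> k \<zeta> = g (of_real (\<rho> (Suc k)) * \<zeta>) - g (of_real (\<rho> k) * \<zeta>)" for k \<zeta>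
  have c\<Delta>: "continuous_on (sphere 0 1) (\<Delta> k)" for k
    unfolding \<Delta>_def using \<rho>0 by (intro continuous_intros cgr) (auto intro: less_imp_le)
  have i\<Delta>: "integrable circle_measure (\<lambda>\<zeta>. cmod (\<Delta> k \<zeta>) powr p)" for k
    by (intro continuous_on_sphere_integrable cp c\<Delta>)
  have \<Delta>e: "(LINT \<zeta>|circle_measure. cmod (\<Delta> k \<zeta>) powr p) \<le> e k" for k
    using R(3)[OF e, of k "\<rho> (Suc k)" "\<rho> k"] \<rho>[of k "Suc k"] \<rho>[of k k] by (simp add: D_def \<Delta>_def)
  define h where "h k \<zeta> = 2 powr (real k * (p - 1)) * cmod (\<Delta> k \<zeta>) powr p" for k \<zeta>
  have h0: "0 \<le> h k \<zeta>" for k \<zeta> by (simp add: h_def)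
  have ih: "integrable circle_measure (h k)" for k unfolding h_def using i\<Delta> by simp
  have hsum: "(LINT \<zeta>|circle_measure. h k \<zeta>) \<le> (1 / 2) ^ k" for k
  proof -
    have "(LINT \<zeta>|circle_measure. h k \<zeta>) \<le> 2 powr (real k * (p - 1)) * e k"
      unfolding h_def using \<Delta>e[of k] by simp
    also have "\<dots> = (1 / 2) ^ k"
      by (simp add: e_def powr_divide powr_realpow[symmetric] powr_diff[symmetric] divide_simps powr_add[symmetric] algebra_simps)
    finally show ?thesis .
  qed
  have "AE \<zeta> in circle_measure. summable (\<lambda>k. h k \<zeta>)"
  proof -
    have hm: "h k \<in> borel_measurable circle_measure" for k using ih by simp
    have "(\<integral>\<^sup>+\<zeta>. (\<Sum>k. ennreal (h k \<zeta>)) \<partial>circle_measure) = (\<Sum>k. \<integral>\<^sup>+\<zeta>. ennreal (h k \<zeta>) \<partial>circle_measure)"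
      using hm by (intro nn_integral_suminf) auto
    also have "\<dots> \<le> (\<Sum>k. ennreal ((1 / 2) ^ k))"
      using hsum h0 ih by (intro suminf_le) (auto simp: nn_integral_eq_integral ennreal_leI)
    also have "\<dots> = ennreal (\<Sum>k. (1 / 2) ^ k)" by (intro suminf_ennreal2) (auto intro!: summable_geometric)
    also have "\<dots> < \<infinity>" by simp
    finally have "AE \<zeta> in circle_measure. (\<Sum>k. ennreal (h k \<zeta>)) \<noteq> \<infinity>"
      using hm by (intro nn_integral_PInf_AE) auto
    then show ?thesis
      by eventually_elim (rule summable_suminf_not_top, use h0 in auto)
  qed
  then have conv: "AE \<zeta> in circle_measure. convergent (\<lambda>k. g (of_real (\<rho> k) * \<zeta>))"
  proof eventually_elim
    case (elim \<zeta>)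
    have b: "cmod (\<Delta> k \<zeta>) \<le> (1 / 2) ^ k + h k \<zeta>" for k
    proof (cases "cmod (\<Delta> k \<zeta>) \<le> (1 / 2) ^ k")
      case False
      define x where "x = cmod (\<Delta> k \<zeta>)"
      have x: "(1 / 2) ^ k < x" "0 < x" using False zero_less_power[of "1/2::real" k] by (auto simp: x_def simp del: zero_less_power)
      have "1 < 2 ^ k * x" using x(1) by (simp add: field_simps power_divide)
      then have "1 powr (p - 1) \<le> (2 ^ k * x) powr (p - 1)" using p by (intro powr_mono2) auto
      then have "1 * x \<le> (2 ^ k * x) powr (p - 1) * x" using x by (intro mult_right_mono) auto
      also have "\<dots> = h k \<zeta>"
        using x powr_add[of x "p - 1" 1]
        by (simp add: h_def x_def[symmetric] powr_mult powr_realpow[symmetric] powr_powr)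
      finally have "x \<le> h k \<zeta>" by simp
      moreover have "(0::real) \<le> (1 / 2) ^ k" by simp
      ultimately show ?thesis unfolding x_def by linarith
    qed (use h0[of k \<zeta>] in auto)
    have "summable (\<lambda>k. (1 / 2) ^ k + h k \<zeta>)"
      by (intro summable_add elim summable_geometric) simp
    then have "summable (\<lambda>k. \<Delta> k \<zeta>)"
      by (rule summable_comparison_test'[where N = 0]) (rule b)
    then have "convergent (\<lambda>n. \<Sum>k<n. \<Delta> k \<zeta>)" by (simp add: summable_iff_convergent)
    moreover have "(\<Sum>k<n. \<Delta> k \<zeta>) = g (of_real (\<rho> n) * \<zeta>) - g (of_real (\<rho> 0) * \<zeta>)" for n
      unfolding \<Delta>_def by (rule sum_lessThan_telescope)
    ultimately have "convergent (\<lambda>n. g (of_real (\<rho> n) * \<zeta>) - g (of_real (\<rho> 0) * \<zeta>))" by simp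
    then show ?case by (simp add: convergent_diff_const_right_iff)
  qed
  define G where "G \<zeta> = lim (\<lambda>k. g (of_real (\<rho> k) * \<zeta>))" for \<zeta>
  have mgr: "(\<lambda>\<zeta>. g (of_real r * \<zeta>)) \<in> borel_measurable circle_measure" if "0 \<le> r" "r < 1" for r
    by (intro continuous_on_sphere_measurable cgr that)
  have Gm: "G \<in> borel_measurable circle_measure"
    unfolding G_def using mgr \<rho>0 by (intro borel_measurable_lim_metric) (auto intro: less_imp_le)
  have Glim: "AE \<zeta> in circle_measure. (\<lambda>k. g (of_real (\<rho> k) * \<zeta>)) \<longlonglongrightarrow> G \<zeta>"
    using conv unfolding G_def by (simp add: convergent_LIMSEQ_iff)
  have pm: "(\<lambda>\<zeta>. cmod (f \<zeta>) powr p) \<in> borel_measurable circle_measure" if "f \<in> borel_measurable circle_measure" for f :: "complex \<Rightarrow> complex"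
    using that by measurable
  have iG: "integrable circle_measure (\<lambda>\<zeta>. cmod (G \<zeta>) powr p)"
  proof (rule integral_le_AE_limit(1)[where f = "\<lambda>k \<zeta>. cmod (g (of_real (\<rho> k) * \<zeta>)) powr p"])
    show "integrable circle_measure (\<lambda>\<zeta>. cmod (g (of_real (\<rho> k) * \<zeta>)) powr p)" for k
      using \<rho>0[of k] by (intro continuous_on_sphere_integrable cp cgr) auto
    show "AE \<zeta> in circle_measure. (\<lambda>k. cmod (g (of_real (\<rho> k) * \<zeta>)) powr p) \<longlonglongrightarrow> cmod (G \<zeta>) powr p"
      using Glim by eventually_elim (use p in \<open>auto intro!: tendsto_powr2 tendsto_norm\<close>)
    show "eventually (\<lambda>k. (LINT \<zeta>|circle_measure. cmod (g (of_real (\<rho> k) * \<zeta>)) powr p) \<le> C) sequentially"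
      using bd \<rho>0 by auto
  qed (use pm[OF Gm] in auto)
  have close: "integrable circle_measure (\<lambda>\<zeta>. cmod (g (of_real r * \<zeta>) - G \<zeta>) powr p)"
     "(LINT \<zeta>|circle_measure. cmod (g (of_real r * \<zeta>) - G \<zeta>) powr p) \<le> \<epsilon>" if "0 < \<epsilon>" "R \<epsilon> < r" "r < 1" for r \<epsilon>
  proof -
    have r0: "0 \<le> r" using R(1)[OF that(1)] that by simp
    have ev: "eventually (\<lambda>k. R \<epsilon> < \<rho> k) sequentially" using order_tendstoD(1)[OF \<rho>1 R(2)[OF that(1)]] .
    have *: "integrable circle_measure (\<lambda>\<zeta>. cmod (g (of_real r * \<zeta>) - g (of_real (\<rho> k) * \<zeta>)) powr p)" for k
      using \<rho>0[of k] that r0 by (intro continuous_on_sphere_integrable cp continuous_intros cgr) auto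
    have **: "(\<lambda>\<zeta>. cmod (g (of_real r * \<zeta>) - G \<zeta>) powr p) \<in> borel_measurable circle_measure"
      using mgr[OF r0 that(3)] Gm by (intro pm) auto
    have ***: "AE \<zeta> in circle_measure. (\<lambda>k. cmod (g (of_real r * \<zeta>) - g (of_real (\<rho> k) * \<zeta>)) powr p)
        \<longlonglongrightarrow> cmod (g (of_real r * \<zeta>) - G \<zeta>) powr p"
      using Glim by eventually_elim (use p in \<open>auto intro!: tendsto_powr2 tendsto_intros\<close>)
    have ****: "eventually (\<lambda>k. (LINT \<zeta>|circle_measure. cmod (g (of_real r * \<zeta>) - g (of_real (\<rho> k) * \<zeta>)) powr p) \<le> \<epsilon>) sequentially"
      using ev by eventually_elim (use R(3)[OF that(1,2,3)] \<rho>0 in \<open>auto simp: D_def\<close>)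
    show "integrable circle_measure (\<lambda>\<zeta>. cmod (g (of_real r * \<zeta>) - G \<zeta>) powr p)"
     "(LINT \<zeta>|circle_measure. cmod (g (of_real r * \<zeta>) - G \<zeta>) powr p) \<le> \<epsilon>"
      using integral_le_AE_limit[OF * _ ** *** ****] by auto
  qed
  show ?thesis
  proof (rule that[OF Gm iG])
    fix r :: real assume r: "0 < r" "r < 1"
    show "integrable circle_measure (\<lambda>\<zeta>. cmod (g (of_real r * \<zeta>) - G \<zeta>) powr p)"
    proof (rule Bochner_Integration.integrable_bound)
      show "integrable circle_measure (\<lambda>\<zeta>. 2 powr p * cmod (g (of_real r * \<zeta>)) powr p + 2 powr p * cmod (G \<zeta>) powr p)"
        using r by (intro Bochner_Integration.integrable_add integrable_mult_right iG continuous_on_sphere_integrable cp cgr) auto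
      show "(\<lambda>\<zeta>. cmod (g (of_real r * \<zeta>) - G \<zeta>) powr p) \<in> borel_measurable circle_measure"
        using mgr[of r] r Gm by (intro pm) auto
      show "AE \<zeta> in circle_measure. norm (cmod (g (of_real r * \<zeta>) - G \<zeta>) powr p)
        \<le> norm (2 powr p * cmod (g (of_real r * \<zeta>)) powr p + 2 powr p * cmod (G \<zeta>) powr p)"
      proof (rule AE_I2)
        fix \<zeta>
        have "cmod (g (of_real r * \<zeta>) - G \<zeta>) powr p \<le> (cmod (g (of_real r * \<zeta>)) + cmod (G \<zeta>)) powr p"
          using p by (intro powr_mono2 norm_triangle_ineq4) auto
        also have "\<dots> \<le> (1 + 1) powr p * cmod (g (of_real r * \<zeta>)) powr p + (1 + 1 / 1) powr p * cmod (G \<zeta>) powr p"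
          using p by (intro powr_add_le_weighted) auto
        finally show "norm (cmod (g (of_real r * \<zeta>) - G \<zeta>) powr p)
        \<le> norm (2 powr p * cmod (g (of_real r * \<zeta>)) powr p + 2 powr p * cmod (G \<zeta>) powr p)" by simp
      qed
    qed
  next
    show "((\<lambda>r. LINT \<zeta>|circle_measure. cmod (g (of_real r * \<zeta>) - G \<zeta>) powr p) \<longlongrightarrow> 0) (at_left 1)"
    proof (rule tendstoI)
      fix \<epsilon> :: real assume "0 < \<epsilon>"
      then have \<epsilon>: "0 < \<epsilon> / 2" by simp
      show "eventually (\<lambda>r. dist (LINT \<zeta>|circle_measure. cmod (g (of_real r * \<zeta>) - G \<zeta>) powr p) 0 < \<epsilon>) (at_left 1)"
        using eventually_at_left_real[OF R(2)[OF \<epsilon>]]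
      proof eventually_elim
        case (elim r)
        then have "(LINT \<zeta>|circle_measure. cmod (g (of_real r * \<zeta>) - G \<zeta>) powr p) \<le> \<epsilon> / 2"
          using close(2)[OF \<epsilon>] by auto
        moreover have "0 \<le> (LINT \<zeta>|circle_measure. cmod (g (of_real r * \<zeta>) - G \<zeta>) powr p)" by simp
        ultimately show ?case using \<epsilon> by (simp add: dist_real_def)
      qed
    qed
  qed
qed

section \<open>A kernel for radial limits\<close>

text \<open>
  With \<open>z = r e^(i t0)\<close> and the reflected point \<open>z' = e^(i t0) / r\<close>, this is Cauchy's kernel
  \<open>(w - z)^(-2)\<close> for derivatives minus \<open>(w - z')^(-2)\<close>, where \<open>w = e^(i t)\<close>; the factor \<open>e^(i t)\<close> comes
  from \<open>dw\<close>. The second term integrates to 0 against holomorphic functions, and with it the kernel is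
  \<open>O((1 - r) |w - z|^(-3))\<close>. Cauchy's kernel alone would not do: the integral of its modulus times \<open>|t - t0|\<close> grows
  logarithmically as \<open>r\<close> tends to 1.
\<close>

definition fatou_kernel :: "real \<Rightarrow> real \<Rightarrow> real \<Rightarrow> complex" where
  "fatou_kernel t0 r t = cis t * (1 / (cis t - of_real r * cis t0)\<^sup>2 - 1 / (cis t - cis t0 / of_real r)\<^sup>2)"

lemma fatou_kernel_reproduces:
  assumes F: "F holomorphic_on ball 0 \<rho>" "1 < \<rho>" and r: "0 < r" "r < 1"
    and d: "(F has_field_derivative d) (at (of_real r * cis t0))"
  shows "((\<lambda>t. F (cis t) * fatou_kernel t0 r t) has_integral 2 * of_real pi * d) {0..2 * pi}"
proof -
  define z where "z = of_real r * cis t0"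
  define zs where "zs = cis t0 / of_real r"
  have z: "cmod z < 1" "cmod zs = 1 / r" using r by (simp_all add: z_def zs_def norm_mult norm_divide)
  have sub: "cball 0 1 \<subseteq> ball (0::complex) \<rho>" "ball 0 1 \<subseteq> ball (0::complex) \<rho>" using F(2) by auto
  note C = Cauchy_derivative_integral_circlepath[of 0 1 F z]
  have cF: "continuous_on (cball 0 1) F" "F holomorphic_on ball 0 1" "z \<in> ball 0 1"
    using F(1) sub z(1) holomorphic_on_imp_continuous_on continuous_on_subset holomorphic_on_subset by auto
  have "d = 1 / (2 * of_real pi * \<i>) * contour_integral (circlepath 0 1) (\<lambda>u. F u / (u - z)\<^sup>2)"
    using DERIV_unique[OF d[folded z_def] C(2)[OF cF]] .
  then have ci: "contour_integral (circlepath 0 1) (\<lambda>u. F u / (u - z)\<^sup>2) = 2 * of_real pi * \<i> * d"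
    by simp
  have h1: "((\<lambda>u. F u / (u - z)\<^sup>2) has_contour_integral (2 * of_real pi * \<i> * d)) (circlepath 0 1)"
    using has_contour_integral_integral[OF C(1)[OF cF]] unfolding ci .
  have h2: "((\<lambda>u. F u / (u - zs)\<^sup>2) has_contour_integral 0) (circlepath 0 1)"
  proof (rule Cauchy_theorem_disc_simple[where a = 0 and e = "min \<rho> (1 / r)"])
    show "(\<lambda>u. F u / (u - zs)\<^sup>2) holomorphic_on ball 0 (min \<rho> (1 / r))"
      using z(2) by (intro holomorphic_intros holomorphic_on_subset[OF F(1)]) auto
    show "path_image (circlepath 0 1) \<subseteq> ball 0 (min \<rho> (1 / r))"
      using F(2) r by auto
  qed auto
  have "((\<lambda>u. F u / (u - z)\<^sup>2 - F u / (u - zs)\<^sup>2) has_contour_integral (2 * of_real pi * \<i> * d - 0)) (circlepath 0 1)"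
    by (rule has_contour_integral_diff[OF h1 h2])
  then have "((\<lambda>t. (F (cis t) / (cis t - z)\<^sup>2 - F (cis t) / (cis t - zs)\<^sup>2) * \<i> * cis t) has_integral (2 * of_real pi * \<i> * d)) {0..2 * pi}"
    unfolding circlepath_def by (subst (asm) has_contour_integral_part_circlepath_iff) auto
  then have "((\<lambda>t. - \<i> * ((F (cis t) / (cis t - z)\<^sup>2 - F (cis t) / (cis t - zs)\<^sup>2) * \<i> * cis t)) has_integral (- \<i> * (2 * of_real pi * \<i> * d))) {0..2 * pi}"
    by (rule has_integral_mult_right)
  moreover have "- \<i> * ((F (cis t) / (cis t - z)\<^sup>2 - F (cis t) / (cis t - zs)\<^sup>2) * \<i> * cis t) = F (cis t) * fatou_kernel t0 r t" for t
    by (simp add: fatou_kernel_def z_def zs_def algebra_simps)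
  moreover have "- \<i> * (2 * of_real pi * \<i> * d) = 2 * of_real pi * d"
    using i_squared by algebra
  ultimately show ?thesis by (simp only:)
qed

lemma continuous_on_fatou_kernel:
  assumes r: "0 < r" "r < 1" shows "continuous_on A (fatou_kernel t0 r)"
proof -
  have "cis t \<noteq> of_real r * cis t0" for t
    using r by (metis abs_of_pos less_irrefl norm_cis norm_mult norm_of_real mult.right_neutral)
  moreover have "cis t \<noteq> cis t0 / of_real r" for t
  proof
    assume "cis t = cis t0 / of_real r"
    then have "cmod (cis t) = cmod (cis t0 / of_real r)" by simp
    then show False using r by (simp add: norm_divide)
  qed
  ultimately show ?thesis unfolding fatou_kernel_def by (auto intro!: continuous_intros)
qed

text \<open>
  Reflection in the unit circle gives \<open>|w - z'| = |w - z| / r\<close>, so all factors of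
  \<open>1 / A\<^sup>2 - 1 / B\<^sup>2 = (B - A) (B + A) / (A\<^sup>2 B\<^sup>2)\<close> can be expressed by \<open>|w - z|\<close> and \<open>r\<close>.
\<close>

lemma norm_fatou_kernel_le:
  assumes r: "0 < r" "r < 1"
  shows "cmod (fatou_kernel t0 r t) \<le> 4 * (1 - r) / cmod (cis t - of_real r * cis t0) ^ 3"
proof -
  define A where "A = cis t - of_real r * cis t0"
  define B where "B = cis t - cis t0 / of_real r"
  have "cis t \<noteq> of_real r * cis t0"
    using r by (metis abs_of_pos less_irrefl norm_cis norm_mult norm_of_real mult.right_neutral)
  then have A0: "0 < cmod A" by (simp add: A_def)
  have B: "cmod B = cmod A / r"
  proof -
    have e: "cis t * cnj (cis t) = 1" "cis t0 * cnj (cis t0) = 1" by (simp_all add: cis_mult cis_cnj)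
    have "of_real r * B = - (cis t * cis t0) * cnj A"
      using r e by (simp add: A_def B_def algebra_simps)
    then have "cmod (of_real r * B) = cmod (- (cis t * cis t0) * cnj A)" by simp
    then have "r * cmod B = cmod A" using r by (simp add: norm_mult)
    then show ?thesis using r by (simp add: field_simps)
  qed
  then have B0: "0 < cmod B" using A0 r by simp
  have BA: "cmod (B - A) \<le> (1 / r - r)"
  proof -
    have "B - A = of_real (r - 1 / r) * cis t0" by (simp add: A_def B_def field_simps)
    then have "cmod (B - A) = \<bar>r - 1 / r\<bar>" by (simp only: norm_mult norm_of_real norm_cis mult_1_right)
    also have "\<dots> = 1 / r - r"
    proof -
      have "r * r < 1 * 1" using r by (intro mult_strict_mono) auto
      then have "r < 1 / r" using r by (simp add: less_divide_eq)
      then show ?thesis by simp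
    qed
    finally show ?thesis by simp
  qed
  have nz: "A \<noteq> 0" "B \<noteq> 0" using A0 B0 by auto
  have "1 / A\<^sup>2 - 1 / B\<^sup>2 = (B - A) * (B + A) / (A\<^sup>2 * B\<^sup>2)"
    using nz by (simp add: divide_simps) (simp add: power2_eq_square algebra_simps)
  then have "cmod (fatou_kernel t0 r t) = cmod (B - A) * cmod (B + A) / ((cmod A)\<^sup>2 * (cmod B)\<^sup>2)"
    by (simp add: fatou_kernel_def A_def[symmetric] B_def[symmetric] norm_mult norm_divide norm_power)
  also have "\<dots> \<le> (1 / r - r) * (cmod A / r + cmod A) / ((cmod A)\<^sup>2 * (cmod B)\<^sup>2)"
    using BA order_trans[OF norm_ge_zero BA] norm_triangle_ineq[of B A] r B by (intro divide_right_mono mult_mono) auto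
  also have "\<dots> = (1 - r) * (1 + r)\<^sup>2 / cmod A ^ 3"
    unfolding B using A0 r by (simp add: divide_simps) (simp add: power2_eq_square power3_eq_cube power4_eq_xxxx algebra_simps)
  also have "\<dots> \<le> (1 - r) * 4 / cmod A ^ 3"
  proof -
    have "(1 + r)\<^sup>2 \<le> 2\<^sup>2" using r by (intro power_mono) auto
    then show ?thesis using r A0 by (intro divide_right_mono mult_left_mono) auto
  qed
  finally show ?thesis by (simp add: A_def mult.commute)
qed

lemma sin_ge_linear:
  fixes X x :: real
  assumes "0 < X" "X < pi" "0 \<le> x" "x \<le> X"
  shows "x * sin X / X \<le> sin x"
proof -
  have "convex_on {0..pi} (\<lambda>x. - sin x)"
  proof (rule f''_ge0_imp_convex[where f' = "\<lambda>x. - cos x" and f'' = sin])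
    fix y :: real assume "y \<in> {0..pi}"
    then show "0 \<le> sin y" by (auto intro: sin_ge_zero)
  qed (auto intro!: derivative_eq_intros)
  from convex_onD[OF this, of "x / X" 0 X] show ?thesis using assms by (simp add: divide_le_eq)
qed

text \<open>
  The interval \<open>[0, 2 pi]\<close> is not centred at \<open>t0\<close>; the half-angle \<open>|t - t0| / 2\<close> still stays below a bound
  less than \<open>pi\<close>, and this bound determines \<open>\<kappa>\<close>.
\<close>

lemma dist_sq_circle_lower:
  assumes t0: "0 < t0" "t0 < 2 * pi"
  obtains \<kappa> where "0 < \<kappa>" "\<And>r t. 1 / 2 \<le> r \<Longrightarrow> r < 1 \<Longrightarrow> 0 \<le> t \<Longrightarrow> t \<le> 2 * pi \<Longrightarrow>
     (1 - r)\<^sup>2 + \<kappa> * (t - t0)\<^sup>2 \<le> (cmod (cis t - of_real r * cis t0))\<^sup>2"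
proof -
  define X where "X = max t0 (2 * pi - t0) / 2"
  have X: "0 < X" "X < pi" using t0 by (auto simp: X_def max_def)
  define c where "c = sin X / X"
  have c: "0 < c" using X by (simp add: c_def sin_gt_zero)
  show ?thesis
  proof (rule that[of "c\<^sup>2 / 2"])
    show "0 < c\<^sup>2 / 2" using c by simp
    fix r t :: real assume r: "1 / 2 \<le> r" "r < 1" and t: "0 \<le> t" "t \<le> 2 * pi"
    define x where "x = \<bar>t - t0\<bar> / 2"
    have "0 \<le> x" "x \<le> X" using t by (auto simp: x_def X_def abs_if max_def)
    then have "c * x \<le> sin x" using sin_ge_linear[OF X] by (simp add: c_def mult.commute)
    then have "(c * x)\<^sup>2 \<le> (sin x)\<^sup>2" using c \<open>0 \<le> x\<close> by (intro power_mono) auto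
    moreover have "(sin x)\<^sup>2 = (sin ((t - t0) / 2))\<^sup>2"
      by (cases "0 \<le> t - t0") (simp_all add: x_def, metis minus_diff_eq minus_divide_left power2_minus sin_minus)
    moreover have "(c * x)\<^sup>2 = c\<^sup>2 * (t - t0)\<^sup>2 / 4" by (simp add: x_def power_mult_distrib power_divide)
    ultimately have s: "c\<^sup>2 * (t - t0)\<^sup>2 / 4 \<le> (sin ((t - t0) / 2))\<^sup>2" by simp
    have "(cmod (cis t - of_real r * cis t0))\<^sup>2 = (cos t - r * cos t0)\<^sup>2 + (sin t - r * sin t0)\<^sup>2"
      by (simp add: cmod_power2)
    also have "\<dots> = ((cos t)\<^sup>2 + (sin t)\<^sup>2) + r\<^sup>2 * ((cos t0)\<^sup>2 + (sin t0)\<^sup>2) - 2 * r * (cos t * cos t0 + sin t * sin t0)"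
      unfolding power2_eq_square by (simp only: algebra_simps)
    also have "\<dots> = 1 + r\<^sup>2 * 1 - 2 * r * cos (t - t0)" by (simp only: cos_diff sin_cos_squared_add2)
    also have "cos (t - t0) = cos (2 * ((t - t0) / 2))" by (simp only: nonzero_mult_div_cancel_left times_divide_eq_right)
    also have "\<dots> = 1 - 2 * (sin ((t - t0) / 2))\<^sup>2" by (rule cos_double_sin)
    finally have e: "(cmod (cis t - of_real r * cis t0))\<^sup>2 = (1 - r)\<^sup>2 + 4 * r * (sin ((t - t0) / 2))\<^sup>2"
      by (simp add: power2_eq_square algebra_simps)
    have "c\<^sup>2 / 2 * (t - t0)\<^sup>2 = 2 * (c\<^sup>2 * (t - t0)\<^sup>2 / 4)" by simp
    also have "\<dots> \<le> 2 * (sin ((t - t0) / 2))\<^sup>2" using s by simp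
    also have "\<dots> \<le> 4 * r * (sin ((t - t0) / 2))\<^sup>2" using r by (intro mult_right_mono) auto
    finally show "(1 - r)\<^sup>2 + c\<^sup>2 / 2 * (t - t0)\<^sup>2 \<le> (cmod (cis t - of_real r * cis t0))\<^sup>2" using e by simp
  qed
qed

text \<open>
  The integrand has the primitive \<open>\<minusplus> (\<delta> / \<kappa>) (\<delta>\<^sup>2 + \<kappa> (t - t0)\<^sup>2)^(-1/2)\<close> on the two sides of \<open>t0\<close>. The bound does not
  depend on \<open>\<delta>\<close>, which is the distance \<open>1 - r\<close> from the circle.
\<close>

lemma has_integral_kernel_majorant:
  fixes \<delta> \<kappa> t0 :: real
  assumes \<delta>: "0 < \<delta>" and \<kappa>: "0 < \<kappa>" and ab: "a \<le> t0" "t0 \<le> b"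
  obtains I where "((\<lambda>t. \<bar>t - t0\<bar> * \<delta> / sqrt (\<delta>\<^sup>2 + \<kappa> * (t - t0)\<^sup>2) ^ 3) has_integral I) {a..b}" "I \<le> 2 / \<kappa>"
proof -
  define q where "q t = \<delta>\<^sup>2 + \<kappa> * (t - t0)\<^sup>2" for t
  have q: "0 < q t" for t using \<delta> \<kappa> by (simp add: q_def add_pos_nonneg)
  define H where "H t = - (\<delta> / \<kappa>) / sqrt (q t)" for t
  have dH: "(H has_real_derivative (t - t0) * \<delta> / sqrt (q t) ^ 3) (at t within S)" for t S
  proof -
    have "(q has_real_derivative \<kappa> * (2 * (t - t0))) (at t within S)"
      unfolding q_def by (auto intro!: derivative_eq_intros)
    then have "((\<lambda>t. sqrt (q t)) has_real_derivative \<kappa> * (2 * (t - t0)) * (inverse (sqrt (q t)) / 2)) (at t within S)"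
      using q[of t] by (auto intro!: derivative_eq_intros simp: field_simps)
    from DERIV_divide[OF DERIV_const this, of "- (\<delta> / \<kappa>)"]
    have "(H has_real_derivative (0 * sqrt (q t) - - (\<delta> / \<kappa>) * (\<kappa> * (2 * (t - t0)) * (inverse (sqrt (q t)) / 2))) / (sqrt (q t) * sqrt (q t))) (at t within S)"
      using q[of t] by (simp add: H_def[abs_def])
    moreover have "(0 * sqrt (q t) - - (\<delta> / \<kappa>) * (\<kappa> * (2 * (t - t0)) * (inverse (sqrt (q t)) / 2))) / (sqrt (q t) * sqrt (q t)) = (t - t0) * \<delta> / sqrt (q t) ^ 3"
      using \<kappa> q[of t] by (simp add: divide_simps power3_eq_cube del: real_sqrt_mult_self)
    ultimately show ?thesis by simp
  qed
  have H0: "H t0 = - (1 / \<kappa>)" using \<delta> by (simp add: H_def q_def)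
  have Hneg: "H t \<le> 0" for t using \<delta> \<kappa> q[of t] by (simp add: H_def)
  have i2: "((\<lambda>t. (t - t0) * \<delta> / sqrt (q t) ^ 3) has_integral (H b - H t0)) {t0..b}"
    using dH ab by (intro fundamental_theorem_of_calculus) (auto simp: has_real_derivative_iff_has_vector_derivative[symmetric])
  have i1: "((\<lambda>t. (t - t0) * \<delta> / sqrt (q t) ^ 3) has_integral (H t0 - H a)) {a..t0}"
    using dH ab by (intro fundamental_theorem_of_calculus) (auto simp: has_real_derivative_iff_has_vector_derivative[symmetric])
  have j2: "((\<lambda>t. \<bar>t - t0\<bar> * \<delta> / sqrt (q t) ^ 3) has_integral (H b - H t0)) {t0..b}"
    by (rule has_integral_eq[OF _ i2]) auto
  have j1: "((\<lambda>t. \<bar>t - t0\<bar> * \<delta> / sqrt (q t) ^ 3) has_integral (- (H t0 - H a))) {a..t0}"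
    by (rule has_integral_eq[OF _ has_integral_neg[OF i1]]) (auto simp: left_diff_distrib minus_divide_left)
  have "((\<lambda>t. \<bar>t - t0\<bar> * \<delta> / sqrt (q t) ^ 3) has_integral (- (H t0 - H a) + (H b - H t0))) {a..b}"
    by (rule has_integral_combine[OF ab j1 j2])
  moreover have "- (H t0 - H a) + (H b - H t0) \<le> 2 / \<kappa>" using H0 Hneg[of a] Hneg[of b] by simp
  ultimately show ?thesis using that by (simp add: q_def)
qed

section \<open>Radial limits almost everywhere\<close>

text \<open>
  \<open>integrable_ccontinuous_explicit\<close> concerns boxes with a given lower corner, hence derivatives from the
  right. The derivative from the left is obtained from the reflected function.
\<close>

lemma lebesgue_differentiation_interval:
  fixes \<psi> :: "real \<Rightarrow> complex"
  assumes \<psi>: "\<psi> integrable_on {a..b}"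
  obtains N where "negligible N"
    "\<And>t \<eta>. t \<in> {a<..<b} \<Longrightarrow> t \<notin> N \<Longrightarrow> 0 < \<eta> \<Longrightarrow>
       \<exists>d>0. \<forall>x\<in>{a..b}. \<bar>x - t\<bar> < d \<longrightarrow>
         cmod (integral {a..x} \<psi> - integral {a..t} \<psi> - of_real (x - t) * \<psi> t) \<le> \<eta> * \<bar>x - t\<bar>"
proof -
  define \<phi> where "\<phi> x = (if x \<in> {a..b} then \<psi> x else 0)" for x
  have iU: "\<phi> integrable_on UNIV"
    using \<psi> unfolding \<phi>_def[abs_def] by (simp only: integrable_restrict_UNIV)
  have i\<phi>: "\<phi> integrable_on {u..v}" for u v
    using integrable_on_subcbox[OF iU, of u v] by simp
  have i\<phi>': "(\<lambda>x. \<phi> (- x)) integrable_on {u..v}" for u v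
    using i\<phi>[of "-v" "-u"] Henstock_Kurzweil_Integration.integrable_reflect_real[of \<phi> "-u" "-v"] by simp
  obtain N1 where N1: "negligible N1" "\<And>x e. x \<notin> N1 \<Longrightarrow> 0 < e \<Longrightarrow>
     \<exists>d>0. \<forall>h. 0 < h \<and> h < d \<longrightarrow> norm (integral {x..x + h} \<phi> /\<^sub>R h - \<phi> x) < e"
    using integrable_ccontinuous_explicit[of \<phi>] i\<phi> by auto
  obtain N2 where N2: "negligible N2" "\<And>x e. x \<notin> N2 \<Longrightarrow> 0 < e \<Longrightarrow>
     \<exists>d>0. \<forall>h. 0 < h \<and> h < d \<longrightarrow> norm (integral {x..x + h} (\<lambda>x. \<phi> (- x)) /\<^sub>R h - \<phi> (- x)) < e"
    using integrable_ccontinuous_explicit[of "\<lambda>x. \<phi> (- x)"] i\<phi>' by auto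
  show ?thesis
  proof (rule that[of "N1 \<union> uminus ` N2"])
    show "negligible (N1 \<union> uminus ` N2)"
      using N1(1) N2(1)
      by (intro negligible_Un negligible_differentiable_image_negligible) (auto simp: differentiable_on_def)
    fix t \<eta> :: real assume t: "t \<in> {a<..<b}" "t \<notin> N1 \<union> uminus ` N2" and \<eta>: "0 < \<eta>"
    have tN: "t \<notin> N1" "- t \<notin> N2" using t(2) by (auto simp: image_iff)
    have \<phi>\<psi>: "integral {u..v} \<phi> = integral {u..v} \<psi>" if "a \<le> u" "v \<le> b" for u v
      using that by (intro integral_cong) (auto simp: \<phi>_def)
    have \<phi>t: "\<phi> t = \<psi> t" using t by (auto simp: \<phi>_def)
    obtain d1 where d1: "0 < d1" "\<And>h. 0 < h \<Longrightarrow> h < d1 \<Longrightarrow> norm (integral {t..t + h} \<phi> /\<^sub>R h - \<psi> t) < \<eta>"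
      using N1(2)[OF tN(1) \<eta>] \<phi>t by auto
    obtain d2 where d2: "0 < d2" "\<And>h. 0 < h \<Longrightarrow> h < d2 \<Longrightarrow> norm (integral {- t..- t + h} (\<lambda>x. \<phi> (- x)) /\<^sub>R h - \<psi> t) < \<eta>"
      using N2(2)[OF tN(2) \<eta>] \<phi>t by auto
    have scale: "cmod (I - of_real h * c) \<le> \<eta> * h" if "0 < h" "norm (I /\<^sub>R h - c) < \<eta>" for h :: real and I c :: complex
    proof -
      have "I - of_real h * c = h *\<^sub>R (I /\<^sub>R h - c)" 
        using that(1) by (simp add: scaleR_right_diff_distrib) (simp add: scaleR_conv_of_real)
      then have "cmod (I - of_real h * c) = h * norm (I /\<^sub>R h - c)" using that by simp
      also have "\<dots> \<le> h * \<eta>" using that by (intro mult_left_mono) auto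
      finally show ?thesis by (simp add: mult.commute)
    qed
    have i\<psi>: "\<psi> integrable_on {u..v}" if "a \<le> u" "v \<le> b" for u v
      using integrable_on_subinterval[OF \<psi>] that by auto
    show "\<exists>d>0. \<forall>x\<in>{a..b}. \<bar>x - t\<bar> < d \<longrightarrow>
         cmod (integral {a..x} \<psi> - integral {a..t} \<psi> - of_real (x - t) * \<psi> t) \<le> \<eta> * \<bar>x - t\<bar>"
    proof (intro exI[of _ "min d1 d2"] conjI ballI impI)
      show "0 < min d1 d2" using d1 d2 by simp
      fix x assume x: "x \<in> {a..b}" "\<bar>x - t\<bar> < min d1 d2"
      consider "x = t" | "t < x" | "x < t" by linarith
      then show "cmod (integral {a..x} \<psi> - integral {a..t} \<psi> - of_real (x - t) * \<psi> t) \<le> \<eta> * \<bar>x - t\<bar>"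
      proof cases
        case 2
        have "integral {a..x} \<psi> = integral {a..t} \<psi> + integral {t..x} \<psi>"
          using 2 t x Henstock_Kurzweil_Integration.integral_combine[of a t x \<psi>] i\<psi>[of a x] by simp
        moreover have "cmod (integral {t..x} \<psi> - of_real (x - t) * \<psi> t) \<le> \<eta> * (x - t)"
          using scale[of "x - t" "integral {t..x} \<psi>" "\<psi> t"] d1(2)[of "x - t"] 2 x t \<phi>\<psi>[of t x] by simp
        ultimately show ?thesis using 2 by simp
      next
        case 3
        have "integral {a..t} \<psi> = integral {a..x} \<psi> + integral {x..t} \<psi>"
          using 3 t x Henstock_Kurzweil_Integration.integral_combine[of a x t \<psi>] i\<psi>[of a t] by simp
        moreover have "integral {- t..- t + (t - x)} (\<lambda>x. \<phi> (- x)) = integral {x..t} \<psi>"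
          using Henstock_Kurzweil_Integration.integral_reflect_real[of t x \<phi>] \<phi>\<psi>[of x t] t x by simp
        then have "cmod (integral {x..t} \<psi> - of_real (t - x) * \<psi> t) \<le> \<eta> * (t - x)"
          using scale[of "t - x" "integral {x..t} \<psi>" "\<psi> t"] d2(2)[of "t - x"] 3 x by simp
        moreover have "cmod (- (integral {x..t} \<psi>) - of_real (x - t) * \<psi> t) = cmod (integral {x..t} \<psi> - of_real (t - x) * \<psi> t)"
          by (subst norm_minus_cancel[symmetric]) (simp add: algebra_simps)
        ultimately show ?thesis using 3 by simp
      qed simp
    qed
  qed
qed

text \<open>
  Close to \<open>t0\<close> the integrand is at most \<open>\<eta> |t - t0|\<close> times the kernel, whose integral is bounded by a
  multiple of \<open>\<eta>\<close> independent of \<open>r\<close>; away from \<open>t0\<close> the kernel tends to 0 uniformly.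
\<close>

lemma radial_limit_at_differentiability_point:
  fixes e :: "real \<Rightarrow> complex"
  assumes t0: "0 < t0" "t0 < 2 * pi"
    and ce: "continuous_on {0..2 * pi} e"
    and small: "\<And>\<eta>. 0 < \<eta> \<Longrightarrow> \<exists>d>0. \<forall>t\<in>{0..2 * pi}. \<bar>t - t0\<bar> < d \<longrightarrow> cmod (e t) \<le> \<eta> * \<bar>t - t0\<bar>"
  shows "((\<lambda>r. integral {0..2 * pi} (\<lambda>t. e t * fatou_kernel t0 r t)) \<longlongrightarrow> 0) (at_left 1)"
proof -
  obtain \<kappa> where \<kappa>: "0 < \<kappa>" "\<And>r t. 1 / 2 \<le> r \<Longrightarrow> r < 1 \<Longrightarrow> 0 \<le> t \<Longrightarrow> t \<le> 2 * pi \<Longrightarrow>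
     (1 - r)\<^sup>2 + \<kappa> * (t - t0)\<^sup>2 \<le> (cmod (cis t - of_real r * cis t0))\<^sup>2"
    using dist_sq_circle_lower[OF t0] by blast
  have "compact (e ` {0..2 * pi})" by (intro compact_continuous_image ce) auto
  then obtain B where B: "0 < B" "\<And>t. t \<in> {0..2 * pi} \<Longrightarrow> cmod (e t) \<le> B"
    using compact_imp_bounded bounded_pos by (metis image_eqI)
  show ?thesis
  proof (rule tendstoI)
    fix \<epsilon> :: real assume \<epsilon>: "0 < \<epsilon>"
    define \<eta> where "\<eta> = \<epsilon> * \<kappa> / 16"
    have \<eta>: "0 < \<eta>" using \<epsilon> \<kappa> by (simp add: \<eta>_def)
    obtain d where d: "0 < d" "\<And>t. t \<in> {0..2 * pi} \<Longrightarrow> \<bar>t - t0\<bar> < d \<Longrightarrow> cmod (e t) \<le> \<eta> * \<bar>t - t0\<bar>"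
      using small[OF \<eta>] by blast
    define M where "M = 4 * B / (sqrt \<kappa> * d) ^ 3"
    have M: "0 < M" using B \<kappa> d by (simp add: M_def)
    define r0 where "r0 = max (1 / 2) (1 - \<epsilon> / (8 * pi * M))"
    have "r0 < 1" using \<epsilon> M by (simp add: r0_def)
    then show "\<forall>\<^sub>F r in at_left 1. dist (integral {0..2 * pi} (\<lambda>t. e t * fatou_kernel t0 r t)) 0 < \<epsilon>"
    proof (rule eventually_mono[OF eventually_at_left_real])
      fix r assume "r \<in> {r0<..<1}"
      then have r: "1 / 2 \<le> r" "0 < r" "r < 1" "1 - \<epsilon> / (8 * pi * M) < r" by (auto simp: r0_def)
      define \<delta> where "\<delta> = 1 - r"
      have \<delta>: "0 < \<delta>" using r by (simp add: \<delta>_def)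
      obtain I where I: "((\<lambda>t. \<bar>t - t0\<bar> * \<delta> / sqrt (\<delta>\<^sup>2 + \<kappa> * (t - t0)\<^sup>2) ^ 3) has_integral I) {0..2 * pi}" "I \<le> 2 / \<kappa>"
        using has_integral_kernel_majorant[OF \<delta> \<kappa>(1), of 0 t0 "2 * pi"] t0 by auto
      have Iscaled: "((\<lambda>t. 4 * \<eta> * (\<bar>t - t0\<bar> * \<delta> / sqrt (\<delta>\<^sup>2 + \<kappa> * (t - t0)\<^sup>2) ^ 3) + M * \<delta>) has_integral (4 * \<eta> * I + 2 * pi * (M * \<delta>))) {0..2 * pi}"
        using has_integral_add[OF has_integral_mult_right[OF I(1)] has_integral_const_real[of "M * \<delta>" 0 "2 * pi"]] by simp
      have "norm (integral {0..2 * pi} (\<lambda>t. e t * fatou_kernel t0 r t)) \<le>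
        integral {0..2 * pi} (\<lambda>t. 4 * \<eta> * (\<bar>t - t0\<bar> * \<delta> / sqrt (\<delta>\<^sup>2 + \<kappa> * (t - t0)\<^sup>2) ^ 3) + M * \<delta>)"
      proof (rule Henstock_Kurzweil_Integration.integral_norm_bound_integral)
        show "(\<lambda>t. e t * fatou_kernel t0 r t) integrable_on {0..2 * pi}"
          by (intro integrable_continuous_real continuous_intros ce continuous_on_fatou_kernel r)
        show "(\<lambda>t. 4 * \<eta> * (\<bar>t - t0\<bar> * \<delta> / sqrt (\<delta>\<^sup>2 + \<kappa> * (t - t0)\<^sup>2) ^ 3) + M * \<delta>) integrable_on {0..2 * pi}"
          using Iscaled by blast
        fix t assume t: "t \<in> {0..2 * pi}"
        define q where "q = sqrt (\<delta>\<^sup>2 + \<kappa> * (t - t0)\<^sup>2)"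
        have q: "0 < q" using \<delta> \<kappa> by (simp add: q_def add_pos_nonneg)
        have "q \<le> cmod (cis t - of_real r * cis t0)"
          unfolding q_def using \<kappa>(2)[of r t] r t by (intro real_le_lsqrt) (auto simp: \<delta>_def)
        then have "q ^ 3 \<le> cmod (cis t - of_real r * cis t0) ^ 3" using q by (intro power_mono) auto
        then have "4 * (1 - r) / cmod (cis t - of_real r * cis t0) ^ 3 \<le> 4 * \<delta> / q ^ 3"
          using q \<delta> unfolding \<delta>_def[symmetric] by (intro divide_left_mono mult_pos_pos) (auto intro: less_le_trans[of 0 "q ^ 3"])
        then have K: "cmod (fatou_kernel t0 r t) \<le> 4 * \<delta> / q ^ 3"
          using norm_fatou_kernel_le[of r t0 t] r by linarith
        show "norm (e t * fatou_kernel t0 r t) \<le> 4 * \<eta> * (\<bar>t - t0\<bar> * \<delta> / sqrt (\<delta>\<^sup>2 + \<kappa> * (t - t0)\<^sup>2) ^ 3) + M * \<delta>"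
        proof (cases "\<bar>t - t0\<bar> < d")
          case True
          have "norm (e t * fatou_kernel t0 r t) \<le> (\<eta> * \<bar>t - t0\<bar>) * (4 * \<delta> / q ^ 3)"
            unfolding norm_mult using d(2)[OF t True] K \<eta> by (intro mult_mono) auto
          also have "\<dots> = 4 * \<eta> * (\<bar>t - t0\<bar> * \<delta> / q ^ 3)" by simp
          also have "\<dots> \<le> 4 * \<eta> * (\<bar>t - t0\<bar> * \<delta> / q ^ 3) + M * \<delta>" using M \<delta> by simp
          finally show ?thesis by (simp add: q_def)
        next
          case False
          have "sqrt (\<kappa> * (t - t0)\<^sup>2) \<le> q" unfolding q_def by (intro real_sqrt_le_mono) auto
          then have "sqrt \<kappa> * \<bar>t - t0\<bar> \<le> q" by (simp add: real_sqrt_mult)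
          moreover have "sqrt \<kappa> * d \<le> sqrt \<kappa> * \<bar>t - t0\<bar>" using False \<kappa> by (intro mult_left_mono) auto
          ultimately have "sqrt \<kappa> * d \<le> q" by linarith
          then have qd: "(sqrt \<kappa> * d) ^ 3 \<le> q ^ 3" using \<kappa> d by (intro power_mono) auto
          have "norm (e t * fatou_kernel t0 r t) \<le> B * (4 * \<delta> / q ^ 3)"
            unfolding norm_mult using B(2)[OF t] K B(1) by (intro mult_mono) auto
          also have "\<dots> \<le> B * (4 * \<delta> / (sqrt \<kappa> * d) ^ 3)"
            using qd B(1) \<delta> \<kappa> d q by (intro mult_left_mono divide_left_mono mult_pos_pos) auto
          also have "\<dots> = M * \<delta>" by (simp add: M_def)
          also have "\<dots> \<le> 4 * \<eta> * (\<bar>t - t0\<bar> * \<delta> / q ^ 3) + M * \<delta>" using \<eta> \<delta> q by simp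
          finally show ?thesis by (simp add: q_def)
        qed
      qed
      also have "\<dots> = 4 * \<eta> * I + 2 * pi * (M * \<delta>)" using Iscaled by (rule integral_unique)
      also have "\<dots> \<le> 4 * \<eta> * (2 / \<kappa>) + 2 * pi * (M * \<delta>)" using mult_left_mono[OF I(2), of "4 * \<eta>"] \<eta> by simp
      also have "4 * \<eta> * (2 / \<kappa>) = \<epsilon> / 2" using \<kappa> by (simp add: \<eta>_def)
      also have "2 * pi * (M * \<delta>) \<le> 2 * pi * (M * (\<epsilon> / (8 * pi * M)))"
        using r(4) M by (intro mult_left_mono) (auto simp: \<delta>_def)
      also have "\<dots> = \<epsilon> / 4" using M by (simp add: field_simps)
      finally show "dist (integral {0..2 * pi} (\<lambda>t. e t * fatou_kernel t0 r t)) 0 < \<epsilon>" using \<epsilon> by simp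
    qed
  qed
qed

text \<open>
  Let \<open>A\<close> be the integral of \<open>G(w) dw\<close> along the circle. Primitives of the dilates of \<open>g\<close>, restricted to the
  circle, converge uniformly to \<open>A\<close> up to constants, because the dilates converge to \<open>G\<close> in the mean. Hence
  \<open>2 pi g(r e^(i t0))\<close> is the integral of \<open>A - A t0\<close> against the kernel. At almost every \<open>t0\<close> the
  function \<open>A\<close> has the expected derivative, so it differs from the restriction of \<open>c (w - e^(i t0))\<close>,
  \<open>c = G(e^(i t0))\<close>, by a function \<open>e\<close> that is \<open>o(|t - t0|)\<close>. The linear function contributes
  \<open>2 pi c\<close>, and the contribution of \<open>e\<close> tends to 0.
\<close>

lemma fatou_radial_limit:
  assumes g: "g holomorphic_on ball 0 1" and G: "integrable circle_measure G"
    and L1: "((\<lambda>r. LINT \<zeta>|circle_measure. cmod (g (of_real r * \<zeta>) - G \<zeta>)) \<longlongrightarrow> 0) (at_left 1)"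
  shows "AE t in lborel. t \<in> {0..2 * pi} \<longrightarrow> ((\<lambda>r. g (of_real r * cis t)) \<longlongrightarrow> G (cis t)) (at_left 1)"
proof -
  note cg = holomorphic_on_imp_continuous_on[OF g]
  define \<psi> where "\<psi> t = G (cis t) * (\<i> * cis t)" for t
  define A where "A t = integral {0..t} \<psi>" for t
  have Gm: "G \<in> borel_measurable circle_measure" using G by simp
  have idm: "(\<lambda>\<zeta>. \<zeta>) \<in> borel_measurable circle_measure"
    by (intro continuous_on_sphere_measurable continuous_intros)
  have iG: "integrable circle_measure (\<lambda>\<zeta>. G \<zeta> * (\<i> * \<zeta>))"
    by (rule Bochner_Integration.integrable_bound[OF G])
      (use Gm idm in \<open>auto intro!: AE_I2 simp: norm_mult space_circle_measure\<close>)
  have a\<psi>: "\<psi> absolutely_integrable_on {0..2 * pi}"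
    using integral_circle_measure(2)[OF iG] by (simp add: \<psi>_def[abs_def])
  then have i\<psi>: "\<psi> integrable_on {0..2 * pi}" by (simp add: absolutely_integrable_on_def)
  have i\<psi>': "\<psi> integrable_on {u..v}" if "0 \<le> u" "v \<le> 2 * pi" for u v
    using integrable_on_subinterval[OF i\<psi>] that by auto
  have cA: "continuous_on {0..2 * pi} A" unfolding A_def by (rule indefinite_integral_continuous_1[OF i\<psi>])
  obtain N where N: "negligible N"
    "\<And>t \<eta>. t \<in> {0<..<2 * pi} \<Longrightarrow> t \<notin> N \<Longrightarrow> 0 < \<eta> \<Longrightarrow>
       \<exists>d>0. \<forall>x\<in>{0..2 * pi}. \<bar>x - t\<bar> < d \<longrightarrow>
         cmod (A x - A t - of_real (x - t) * \<psi> t) \<le> \<eta> * \<bar>x - t\<bar>"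
    unfolding A_def by (rule lebesgue_differentiation_interval[OF i\<psi>]) blast
  have main: "((\<lambda>r. g (of_real r * cis t0)) \<longlongrightarrow> G (cis t0)) (at_left 1)" if t0: "t0 \<in> {0<..<2 * pi}" "t0 \<notin> N" for t0
  proof -
    define c where "c = G (cis t0)"
    define e where "e t = A t - A t0 - c * (cis t - cis t0)" for t
    have ce: "continuous_on {0..2 * pi} e" unfolding e_def by (intro continuous_intros cA)
    have small: "\<exists>d>0. \<forall>t\<in>{0..2 * pi}. \<bar>t - t0\<bar> < d \<longrightarrow> cmod (e t) \<le> \<eta> * \<bar>t - t0\<bar>" if \<eta>: "0 < \<eta>" for \<eta>
    proof -
      obtain d1 where d1: "0 < d1" "\<And>t. t \<in> {0..2 * pi} \<Longrightarrow> \<bar>t - t0\<bar> < d1 \<Longrightarrow>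
          cmod (A t - A t0 - of_real (t - t0) * \<psi> t0) \<le> (\<eta> / 2) * \<bar>t - t0\<bar>"
        using N(2)[OF t0, of "\<eta> / 2"] \<eta> by auto
      have "((\<lambda>t. c * (cis t - cis t0)) has_derivative (\<lambda>h. of_real h * \<psi> t0)) (at t0)"
        unfolding \<psi>_def c_def[symmetric] by (auto intro!: derivative_eq_intros simp: has_vector_derivative_def scaleR_conv_of_real mult_ac)
      then obtain d2 where d2: "0 < d2" "\<And>t. norm (t - t0) < d2 \<Longrightarrow>
          norm (c * (cis t - cis t0) - c * (cis t0 - cis t0) - of_real (t - t0) * \<psi> t0) \<le> (\<eta> / 2) * norm (t - t0)"
        unfolding has_derivative_at_alt using \<eta> by (meson half_gt_zero)
      show ?thesis
      proof (intro exI[of _ "min d1 d2"] conjI ballI impI)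
        fix t assume t: "t \<in> {0..2 * pi}" "\<bar>t - t0\<bar> < min d1 d2"
        have "e t = (A t - A t0 - of_real (t - t0) * \<psi> t0) - (c * (cis t - cis t0) - of_real (t - t0) * \<psi> t0)"
          by (simp add: e_def)
        then have "cmod (e t) \<le> cmod (A t - A t0 - of_real (t - t0) * \<psi> t0) + cmod (c * (cis t - cis t0) - of_real (t - t0) * \<psi> t0)"
          by (simp only: norm_triangle_ineq4)
        also have "\<dots> \<le> (\<eta> / 2) * \<bar>t - t0\<bar> + (\<eta> / 2) * \<bar>t - t0\<bar>"
          using d1(2)[of t] d2(2)[of t] t by (intro add_mono) auto
        finally show "cmod (e t) \<le> \<eta> * \<bar>t - t0\<bar>" by simp
      qed (use d1 d2 in auto)
    qed
    have rep: "integral {0..2 * pi} (\<lambda>t. e t * fatou_kernel t0 r t) = 2 * of_real pi * (g (of_real r * cis t0) - c)"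
      if r: "0 < r" "r < 1" for r
    proof -
      note cK = continuous_on_fatou_kernel[OF r, of "{0..2 * pi}" t0]
      define L where "L R = (LINT \<zeta>|circle_measure. cmod (g (of_real R * \<zeta>) - G \<zeta>))" for R
      have "compact (fatou_kernel t0 r ` {0..2 * pi})" by (intro compact_continuous_image cK) auto
      then obtain Km where Km: "0 < Km" "\<And>t. t \<in> {0..2 * pi} \<Longrightarrow> cmod (fatou_kernel t0 r t) \<le> Km"
        using compact_imp_bounded bounded_pos by (metis image_eqI)
      define \<Gamma>K where "\<Gamma>K = integral {0..2 * pi} (\<lambda>t. (A t - A t0) * fatou_kernel t0 r t)"
      have i\<Gamma>: "(\<lambda>t. (A t - A t0) * fatou_kernel t0 r t) integrable_on {0..2 * pi}"
        by (intro integrable_continuous_real continuous_intros cA cK)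
      have step: "cmod (2 * of_real pi * g (of_real R * (of_real r * cis t0)) - \<Gamma>K) \<le> 8 * pi\<^sup>2 * Km * L R"
        if R: "0 < R" "R < 1" for R
      proof -
        define S where "S = ball (0::complex) (1 / R)"
        have RS: "of_real R * w \<in> ball 0 1" if "w \<in> S" for w
          using that R by (simp add: S_def norm_mult field_simps)
        have "(\<lambda>w. g (of_real R * w)) holomorphic_on S"
          using RS by (intro holomorphic_on_compose_gen[OF _ g, unfolded o_def] holomorphic_intros) auto
        then obtain P where P: "\<And>w. w \<in> S \<Longrightarrow> (P has_field_derivative g (of_real R * w)) (at w within S)"
          using holomorphic_convex_primitive'[of S] by (auto simp: S_def)
        have oS: "open S" by (simp add: S_def)
        have P': "(P has_field_derivative g (of_real R * w)) (at w)" if "w \<in> S" for w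
          using P[OF that] by (simp only: at_within_open[OF that oS])
        have Ph: "P holomorphic_on S" unfolding holomorphic_on_def field_differentiable_def using P by blast
        have cisS: "cis t \<in> S" for t using R by (simp add: S_def)
        define \<psi>R where "\<psi>R t = g (of_real R * cis t) * (\<i> * cis t)" for t
        have FTC: "(\<psi>R has_integral (P (cis v) - P (cis u))) {u..v}" if "u \<le> v" for u v
        proof (rule fundamental_theorem_of_calculus[OF that])
          fix t assume "t \<in> {u..v}"
          have "(cis has_vector_derivative \<i> * cis t) (at t within {u..v})"
            by (rule has_vector_derivative_at_within) (auto intro!: derivative_eq_intros simp: has_vector_derivative_def scaleR_conv_of_real)
          from field_vector_diff_chain_within[OF this has_field_derivative_at_within[OF P'[OF cisS]]]
          show "((\<lambda>t. P (cis t)) has_vector_derivative \<psi>R t) (at t within {u..v})"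
            by (simp add: o_def \<psi>R_def mult_ac)
        qed
        have "((\<lambda>t. (\<lambda>w. P w - P (cis t0)) (cis t) * fatou_kernel t0 r t) has_integral 2 * of_real pi * g (of_real R * (of_real r * cis t0))) {0..2 * pi}"
        proof (rule fatou_kernel_reproduces[OF _ _ r])
          show "(\<lambda>w. P w - P (cis t0)) holomorphic_on ball 0 (1 / R)" using Ph by (intro holomorphic_intros) (simp add: S_def)
          show "1 < 1 / R" using R by simp
          have "of_real r * cis t0 \<in> S" using R r by (simp add: S_def norm_mult) (smt (verit) less_divide_eq_1_pos)
          then show "((\<lambda>w. P w - P (cis t0)) has_field_derivative g (of_real R * (of_real r * cis t0))) (at (of_real r * cis t0))"
            by (auto intro!: derivative_eq_intros P')
        qed
        then have hP: "((\<lambda>t. (P (cis t) - P (cis t0)) * fatou_kernel t0 r t) has_integral 2 * of_real pi * g (of_real R * (of_real r * cis t0))) {0..2 * pi}"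
          by simp
        have diffc: "continuous_on (sphere 0 1) (\<lambda>\<zeta>. g (of_real R * \<zeta>))"
          using R by (intro continuous_on_sphere_dilate[OF cg]) auto
        have iD: "integrable circle_measure (\<lambda>\<zeta>. cmod (g (of_real R * \<zeta>) - G \<zeta>))"
          by (intro integrable_norm Bochner_Integration.integrable_diff continuous_on_sphere_integrable[OF diffc] G)
        have LD: "L R = integral {0..2 * pi} (\<lambda>t. cmod (g (of_real R * cis t) - G (cis t))) / (2 * pi)"
          unfolding L_def integral_circle_measure(1)[OF iD] by simp
        have iD': "(\<lambda>t. cmod (g (of_real R * cis t) - G (cis t))) integrable_on {0..2 * pi}"
          using integral_circle_measure(2)[OF iD] by (simp add: absolutely_integrable_on_def)
        have inc: "cmod ((P (cis v) - P (cis u)) - integral {u..v} \<psi>) \<le> 2 * pi * L R"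
          if "0 \<le> u" "u \<le> v" "v \<le> 2 * pi" for u v
        proof -
          have iD'': "(\<lambda>t. cmod (g (of_real R * cis t) - G (cis t))) integrable_on {u..v}"
            using integrable_on_subinterval[OF iD'] that by auto
          have "(P (cis v) - P (cis u)) - integral {u..v} \<psi> = integral {u..v} (\<lambda>t. \<psi>R t - \<psi> t)"
            using FTC[OF that(2)] i\<psi>'[of u v] that
            by (subst Henstock_Kurzweil_Integration.integral_diff) (auto simp: integral_unique)
          also have "cmod \<dots> \<le> integral {u..v} (\<lambda>t. cmod (g (of_real R * cis t) - G (cis t)))"
          proof (rule Henstock_Kurzweil_Integration.integral_norm_bound_integral[OF _ iD''])
            show "(\<lambda>t. \<psi>R t - \<psi> t) integrable_on {u..v}"
              using FTC[OF that(2)] i\<psi>'[of u v] that by (intro Henstock_Kurzweil_Integration.integrable_diff) auto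
            have "\<psi>R t - \<psi> t = (g (of_real R * cis t) - G (cis t)) * (\<i> * cis t)" for t
              by (simp add: \<psi>R_def \<psi>_def algebra_simps)
            then show "norm (\<psi>R t - \<psi> t) \<le> cmod (g (of_real R * cis t) - G (cis t))" for t
              by (simp add: norm_mult)
          qed
          also have "\<dots> \<le> integral {0..2 * pi} (\<lambda>t. cmod (g (of_real R * cis t) - G (cis t)))"
            using that iD' iD'' by (intro integral_subset_le) auto
          also have "\<dots> = 2 * pi * L R" by (simp add: LD)
          finally show ?thesis .
        qed
        have inc': "cmod ((P (cis t) - P (cis t0)) - (A t - A t0)) \<le> 2 * pi * L R" if t: "t \<in> {0..2 * pi}" for t
        proof (cases "t0 \<le> t")
          case True
          have "A t = A t0 + integral {t0..t} \<psi>"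
            unfolding A_def using Henstock_Kurzweil_Integration.integral_combine[of 0 t0 t \<psi>] i\<psi>'[of 0 t] True t t0 by simp
          then show ?thesis using inc[of t0 t] True t t0 by simp
        next
          case False
          have "A t0 = A t + integral {t..t0} \<psi>"
            unfolding A_def using Henstock_Kurzweil_Integration.integral_combine[of 0 t t0 \<psi>] i\<psi>'[of 0 t0] False t t0 by simp
          then show ?thesis using inc[of t t0] False t t0 norm_minus_commute[of "P (cis t0) - P (cis t)" "integral {t..t0} \<psi>"]
            by (simp add: algebra_simps)
        qed
        have L0: "0 \<le> L R" by (simp add: L_def)
        have "2 * of_real pi * g (of_real R * (of_real r * cis t0)) - \<Gamma>K
          = integral {0..2 * pi} (\<lambda>t. (P (cis t) - P (cis t0)) * fatou_kernel t0 r t - (A t - A t0) * fatou_kernel t0 r t)"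
          using hP i\<Gamma> unfolding \<Gamma>K_def by (subst Henstock_Kurzweil_Integration.integral_diff) (auto simp: integral_unique)
        also have "cmod \<dots> \<le> (2 * pi * L R * Km) * (2 * pi - 0)"
        proof (rule integral_bound)
          show "continuous_on {0..2 * pi} (\<lambda>t. (P (cis t) - P (cis t0)) * fatou_kernel t0 r t - (A t - A t0) * fatou_kernel t0 r t)"
            by (intro continuous_intros cA cK continuous_on_compose2[OF holomorphic_on_imp_continuous_on[OF Ph]]) (auto simp: cisS)
          fix t assume t: "t \<in> {0..2 * pi}"
          have "(P (cis t) - P (cis t0)) * fatou_kernel t0 r t - (A t - A t0) * fatou_kernel t0 r t
            = ((P (cis t) - P (cis t0)) - (A t - A t0)) * fatou_kernel t0 r t" by (simp add: algebra_simps)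
          then show "norm ((P (cis t) - P (cis t0)) * fatou_kernel t0 r t - (A t - A t0) * fatou_kernel t0 r t) \<le> 2 * pi * L R * Km"
            unfolding norm_mult[symmetric] using inc'[OF t] Km L0 t by (simp add: norm_mult mult_mono)
        qed simp
        also have "\<dots> \<le> 8 * pi\<^sup>2 * Km * L R" using Km L0 by (simp add: power2_eq_square)
        finally show ?thesis .
      qed
      have "((\<lambda>R. 2 * of_real pi * g (of_real R * (of_real r * cis t0)) - \<Gamma>K) \<longlongrightarrow> 0) (at_left 1)"
      proof (rule Lim_null_comparison)
        show "\<forall>\<^sub>F R in at_left 1. norm (2 * of_real pi * g (of_real R * (of_real r * cis t0)) - \<Gamma>K) \<le> 8 * pi\<^sup>2 * Km * L R"
          using step by (intro eventually_mono[OF eventually_at_left_real[of 0 1]]) auto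
        show "((\<lambda>R. 8 * pi\<^sup>2 * Km * L R) \<longlongrightarrow> 0) (at_left 1)"
          using tendsto_mult_right_zero[OF L1, of "8 * pi\<^sup>2 * Km"] by (simp add: L_def)
      qed
      moreover have "((\<lambda>R. 2 * of_real pi * g (of_real R * (of_real r * cis t0)) - \<Gamma>K) \<longlongrightarrow>
          2 * of_real pi * g (of_real 1 * (of_real r * cis t0)) - \<Gamma>K) (at_left 1)"
      proof -
        have "isCont g (of_real 1 * (of_real r * cis t0))"
          using cg r by (auto simp: continuous_on_eq_continuous_at norm_mult)
        then have "((\<lambda>R. g (of_real R * (of_real r * cis t0))) \<longlongrightarrow> g (of_real 1 * (of_real r * cis t0))) (at_left 1)"
          by (rule isCont_tendsto_compose) (intro tendsto_intros)
        then show ?thesis by (intro tendsto_intros)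
      qed
      ultimately have "2 * of_real pi * g (of_real 1 * (of_real r * cis t0)) - \<Gamma>K = 0"
        by (intro tendsto_unique[of "at_left (1::real)"]) auto
      then have \<Gamma>: "\<Gamma>K = 2 * of_real pi * g (of_real r * cis t0)" by simp
      have hc: "((\<lambda>t. (\<lambda>w. c * (w - cis t0)) (cis t) * fatou_kernel t0 r t) has_integral 2 * of_real pi * c) {0..2 * pi}"
        by (rule fatou_kernel_reproduces[of _ 2, OF _ _ r]) (auto intro!: holomorphic_intros derivative_eq_intros)
      have "integral {0..2 * pi} (\<lambda>t. e t * fatou_kernel t0 r t)
        = integral {0..2 * pi} (\<lambda>t. (A t - A t0) * fatou_kernel t0 r t - c * (cis t - cis t0) * fatou_kernel t0 r t)"
        by (simp add: e_def algebra_simps)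
      also have "\<dots> = \<Gamma>K - 2 * of_real pi * c"
        using hc i\<Gamma> unfolding \<Gamma>K_def by (subst Henstock_Kurzweil_Integration.integral_diff) (auto simp: integral_unique)
      finally show ?thesis by (simp add: \<Gamma> algebra_simps)
    qed
    have "((\<lambda>r. integral {0..2 * pi} (\<lambda>t. e t * fatou_kernel t0 r t)) \<longlongrightarrow> 0) (at_left 1)"
      using radial_limit_at_differentiability_point[OF _ _ ce small] t0 by auto
    then have "((\<lambda>r. 2 * of_real pi * (g (of_real r * cis t0) - c)) \<longlongrightarrow> 0) (at_left 1)"
    proof (rule Lim_transform_eventually)
      show "\<forall>\<^sub>F r in at_left 1. integral {0..2 * pi} (\<lambda>t. e t * fatou_kernel t0 r t) = 2 * of_real pi * (g (of_real r * cis t0) - c)"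
        using rep by (intro eventually_mono[OF eventually_at_left_real[of 0 1]]) auto
    qed
    then have "((\<lambda>r. 1 / (2 * of_real pi) * (2 * of_real pi * (g (of_real r * cis t0) - c)) + c) \<longlongrightarrow> 1 / (2 * of_real pi) * 0 + c) (at_left 1)"
      by (intro tendsto_intros)
    then show ?thesis by (simp add: c_def)
  qed
  have "N \<union> {0, 2 * pi} \<in> null_sets lebesgue"
    using N(1) by (simp add: negligible_iff_null_sets[symmetric] negligible_Un_eq negligible_insert)
  then have "AE t in lebesgue. t \<notin> N \<union> {0, 2 * pi}" by (rule AE_not_in)
  then have "AE t in lborel. t \<notin> N \<union> {0, 2 * pi}" by (simp only: AE_completion_iff)
  then show ?thesis by eventually_elim (use main in force)
qed

section \<open>Measurability of radial limits\<close>

text \<open>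
  Cauchy's criterion needs only rational radii. The set of points that have a radial limit is thereby
  obtained from measurable sets by countable operations.
\<close>

lemma tendsto_at_left_iff_rational:
  fixes f :: "real \<Rightarrow> complex"
  assumes cf: "continuous_on {0..<1} f"
  shows "(\<exists>l. (f \<longlongrightarrow> l) (at_left 1)) \<longleftrightarrow>
    (\<forall>k::nat. \<exists>n::nat. \<forall>q\<in>\<rat> \<inter> {1 - 1 / (real n + 1)<..<1}. \<forall>q'\<in>\<rat> \<inter> {1 - 1 / (real n + 1)<..<1}.
        cmod (f q - f q') \<le> 1 / (real k + 1))" (is "?L \<longleftrightarrow> ?R")
proof
  assume ?L
  then obtain l where l: "(f \<longlongrightarrow> l) (at_left 1)" by blast
  show ?R
  proof
    fix k :: nat
    have "eventually (\<lambda>r. dist (f r) l < 1 / (2 * (real k + 1))) (at_left 1)"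
      using l by (rule tendstoD) simp
    then obtain b where b: "b < 1" "\<And>r. b < r \<Longrightarrow> r < 1 \<Longrightarrow> dist (f r) l < 1 / (2 * (real k + 1))"
      unfolding eventually_at_left_field by blast
    obtain n :: nat where "1 / (real n + 1) < 1 - b"
      using reals_Archimedean[of "1 - b"] b by (auto simp: inverse_eq_divide add.commute)
    then have n: "b < 1 - 1 / (real n + 1)" by simp
    have "cmod (f q - f q') \<le> 1 / (real k + 1)" if "1 - 1 / (real n + 1) < q" "q < 1" "1 - 1 / (real n + 1) < q'" "q' < 1" for q q'
    proof -
      have "dist (f q) (f q') \<le> dist (f q) l + dist (f q') l" by (rule dist_triangle2)
      also have "\<dots> \<le> 1 / (2 * (real k + 1)) + 1 / (2 * (real k + 1))"
        using b(2)[of q] b(2)[of q'] that n by (intro add_mono less_imp_le) auto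
      also have "\<dots> = 1 / (real k + 1)" by (simp add: field_simps)
      finally show ?thesis by (simp add: dist_norm)
    qed
    then show "\<exists>n::nat. \<forall>q\<in>\<rat> \<inter> {1 - 1 / (real n + 1)<..<1}. \<forall>q'\<in>\<rat> \<inter> {1 - 1 / (real n + 1)<..<1}.
        cmod (f q - f q') \<le> 1 / (real k + 1)" by (intro exI[of _ n]) auto
  qed
next
  assume R: ?R
  have dense: "cmod (f r - f r') \<le> c"
    if H: "\<forall>q\<in>\<rat> \<inter> {b<..<1}. \<forall>q'\<in>\<rat> \<inter> {b<..<1}. cmod (f q - f q') \<le> c"
      and r: "b < r" "r < 1" "b < r'" "r' < 1" and b: "0 \<le> b" for b c r r'
  proof -
    have cb: "continuous_on {b<..<1} f" by (rule continuous_on_subset[OF cf]) (use b in auto)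
    have rat: "\<exists>q. (\<forall>n::nat. q n \<in> \<rat> \<inter> {b<..<1}) \<and> q \<longlonglongrightarrow> x" if x: "b < x" "x < 1" for x
    proof -
      have "\<exists>y\<in>\<rat>. max b (x - 1 / (real n + 1)) < y \<and> y < x" for n :: nat
        by (rule Rats_dense_in_real) (use x in auto)
      then obtain q where q: "\<And>n. q n \<in> \<rat>" "\<And>n. max b (x - 1 / (real n + 1)) < q n" "\<And>n. q n < x" by metis
      have "q \<longlonglongrightarrow> x"
      proof (rule tendsto_sandwich)
        show "(\<lambda>n. x - 1 / (real n + 1)) \<longlonglongrightarrow> x" by real_asymp
        show "\<forall>\<^sub>F n in sequentially. x - 1 / (real n + 1) \<le> q n"
          using q(2) by (intro always_eventually allI) (simp add: less_imp_le)
        show "\<forall>\<^sub>F n in sequentially. q n \<le> x" using q(3) by (intro always_eventually allI less_imp_le)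
      qed simp
      moreover have "q n \<in> \<rat> \<inter> {b<..<1}" for n using q[of n] x by auto
      ultimately show ?thesis by blast
    qed
    obtain q where q: "\<And>n::nat. q n \<in> \<rat> \<inter> {b<..<1}" "q \<longlonglongrightarrow> r" using rat[of r] r by blast
    obtain q' where q': "\<And>n::nat. q' n \<in> \<rat> \<inter> {b<..<1}" "q' \<longlonglongrightarrow> r'" using rat[of r'] r by blast
    have "(\<lambda>n. f (q n)) \<longlonglongrightarrow> f r" by (rule continuous_on_tendsto_compose[OF cb q(2)]) (use q r in auto)
    moreover have "(\<lambda>n. f (q' n)) \<longlonglongrightarrow> f r'" by (rule continuous_on_tendsto_compose[OF cb q'(2)]) (use q' r in auto)
    ultimately have "(\<lambda>n. cmod (f (q n) - f (q' n))) \<longlonglongrightarrow> cmod (f r - f r')" by (intro tendsto_intros)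
    then show ?thesis by (rule LIMSEQ_le_const2) (use H q q' in blast)
  qed
  have "cauchy_filter (filtermap f (at_left 1))"
    unfolding cauchy_filter_metric_filtermap
  proof (intro allI impI)
    fix e :: real assume e: "0 < e"
    obtain k :: nat where k: "1 / (real k + 1) < e" using reals_Archimedean[OF e] by (auto simp: inverse_eq_divide add.commute)
    obtain n :: nat where n: "\<forall>q\<in>\<rat> \<inter> {1 - 1 / (real n + 1)<..<1}. \<forall>q'\<in>\<rat> \<inter> {1 - 1 / (real n + 1)<..<1}.
        cmod (f q - f q') \<le> 1 / (real k + 1)" using R by blast
    show "\<exists>P. eventually P (at_left 1) \<and> (\<forall>x y. P x \<and> P y \<longrightarrow> dist (f x) (f y) < e)"
    proof (intro exI[of _ "\<lambda>r. r \<in> {1 - 1 / (real n + 1)<..<1}"] conjI allI impI)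
      show "\<forall>\<^sub>F r in at_left 1. r \<in> {1 - 1 / (real n + 1)<..<1}" by (rule eventually_at_left_real) simp
      fix x y assume "x \<in> {1 - 1 / (real n + 1)<..<1} \<and> y \<in> {1 - 1 / (real n + 1)<..<1}"
      then have "cmod (f x - f y) \<le> 1 / (real k + 1)" by (intro dense[OF n]) auto
      then show "dist (f x) (f y) < e" using k by (simp add: dist_norm)
    qed
  qed
  then have "convergent_filter (filtermap f (at_left 1))"
    by (rule cauchy_filter_convergent)
  then show ?L by (auto simp: convergent_filter_iff filterlim_def)
qed

lemma sets_has_radial_limit:
  assumes g: "continuous_on (ball 0 1) g"
  shows "{\<zeta> \<in> sphere 0 1. has_radial_limit g \<zeta>} \<in> sets circle_measure"
proof -
  have mgr: "(\<lambda>\<zeta>. g (of_real r * \<zeta>)) \<in> borel_measurable circle_measure" if "0 \<le> r" "r < 1" for r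
    by (intro continuous_on_sphere_measurable continuous_on_sphere_dilate g that)
  define Q where "Q n = \<rat> \<inter> {1 - 1 / (real n + 1)<..<1::real}" for n :: nat
  have Q: "countable (Q n)" "\<And>q. q \<in> Q n \<Longrightarrow> 0 \<le> q \<and> q < 1" for n
  proof -
    show "countable (Q n)" unfolding Q_def by (intro countable_Int1 countable_rat)
    fix q assume "q \<in> Q n"
    then have "1 - 1 / (real n + 1) < q" "q < 1" by (auto simp: Q_def)
    moreover have "0 \<le> 1 - 1 / (real n + 1)" by simp
    ultimately show "0 \<le> q \<and> q < 1" by linarith
  qed
  define E where "E k q q' = {\<zeta> \<in> space circle_measure. cmod (g (of_real q * \<zeta>) - g (of_real q' * \<zeta>)) \<le> 1 / (real k + 1)}"
    for k :: nat and q q'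
  have E: "E k q q' \<in> sets circle_measure" if "q \<in> Q n" "q' \<in> Q n" for k q q' n
  proof -
    have [measurable]: "(\<lambda>\<zeta>. g (of_real q * \<zeta>)) \<in> borel_measurable circle_measure"
      "(\<lambda>\<zeta>. g (of_real q' * \<zeta>)) \<in> borel_measurable circle_measure"
      using mgr Q(2) that by auto
    show ?thesis unfolding E_def by measurable
  qed
  have "{\<zeta> \<in> sphere 0 1. has_radial_limit g \<zeta>}
    = {\<zeta> \<in> space circle_measure. \<forall>k::nat. \<exists>n::nat. \<forall>q\<in>Q n. \<forall>q'\<in>Q n. \<zeta> \<in> E k q q'}"
  proof (intro Collect_cong conj_cong)
    fix \<zeta> :: complex
    show "\<zeta> \<in> sphere 0 1 \<longleftrightarrow> \<zeta> \<in> space circle_measure" by (simp add: space_circle_measure)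
    assume \<zeta>: "\<zeta> \<in> space circle_measure"
    then have "cmod \<zeta> = 1" by (simp add: space_circle_measure)
    then have "continuous_on {0..<1} (\<lambda>r. g (of_real r * \<zeta>))"
      by (intro continuous_on_compose2[OF g]) (auto intro!: continuous_intros simp: norm_mult)
    from tendsto_at_left_iff_rational[OF this]
    show "has_radial_limit g \<zeta> \<longleftrightarrow> (\<forall>k::nat. \<exists>n::nat. \<forall>q\<in>Q n. \<forall>q'\<in>Q n. \<zeta> \<in> E k q q')"
      using \<zeta> unfolding has_radial_limit_def Q_def E_def by simp
  qed
  also have "\<dots> \<in> sets circle_measure"
    using E Q(1)
    by (intro sets.sets_Collect_countable_All sets.sets_Collect_countable_Ex sets.sets_Collect_countable_Ball)
      (auto simp: Collect_conj_eq intro!: sets.Int)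
  finally show ?thesis .
qed

lemma radial_limit_tendsto:
  assumes "has_radial_limit g \<zeta>"
  shows "((\<lambda>r. g (of_real r * \<zeta>)) \<longlongrightarrow> radial_limit g \<zeta>) (at_left 1)"
  using assms tendsto_Lim[of "at_left (1::real)"] unfolding has_radial_limit_def radial_limit_def
  by (metis trivial_limit_at_left_real)

lemma radial_limit_eqI:
  assumes "((\<lambda>r. g (of_real r * \<zeta>)) \<longlongrightarrow> l) (at_left 1)"
  shows "has_radial_limit g \<zeta>" "radial_limit g \<zeta> = l"
  using assms tendsto_Lim[of "at_left (1::real)"] unfolding has_radial_limit_def radial_limit_def
  by (auto simp: trivial_limit_at_left_real)

definition radii :: "nat \<Rightarrow> real" where "radii n = 1 - 1 / (real n + 2)"

lemma radii: "0 < radii n" "radii n < 1" "filterlim radii (at_left 1) sequentially"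
proof -
  have "1 / (real n + 2) < 1" for n by simp
  then show r: "0 < radii n" "radii n < 1" for n by (simp_all add: radii_def)
  have "radii \<longlonglongrightarrow> 1" unfolding radii_def[abs_def] by real_asymp
  then show "filterlim radii (at_left 1) sequentially"
    unfolding filterlim_at using r by (auto intro!: always_eventually simp: less_imp_neq)
qed

lemma borel_measurable_radial_limit:
  assumes g: "continuous_on (ball 0 1) g"
  shows "radial_limit g \<in> borel_measurable circle_measure"
proof -
  have mgr: "(\<lambda>\<zeta>. g (of_real (radii n) * \<zeta>)) \<in> borel_measurable circle_measure" for n
    using radii(1,2)[of n] by (intro continuous_on_sphere_measurable continuous_on_sphere_dilate g) auto
  have S: "{\<zeta> \<in> sphere 0 1. has_radial_limit g \<zeta>} \<in> sets circle_measure"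
    by (rule sets_has_radial_limit[OF g])
  \<comment> \<open>\<^const>\<open>Lim\<close> has the same value \<open>THE l. False\<close> at all points without a radial limit.\<close>
  have "(\<lambda>\<zeta>. if \<zeta> \<in> {\<zeta> \<in> sphere 0 1. has_radial_limit g \<zeta>} then lim (\<lambda>n. g (of_real (radii n) * \<zeta>)) else (THE l. False))
      \<in> borel_measurable circle_measure"
    by (intro measurable_If_set borel_measurable_lim_metric mgr sets.Int[OF S sets.top] measurable_const) simp_all
  moreover have "radial_limit g \<zeta> = (if \<zeta> \<in> {\<zeta> \<in> sphere 0 1. has_radial_limit g \<zeta>} then lim (\<lambda>n. g (of_real (radii n) * \<zeta>)) else (THE l. False))"
    if "\<zeta> \<in> space circle_measure" for \<zeta>
  proof (cases "has_radial_limit g \<zeta>")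
    case True
    have "(\<lambda>n. g (of_real (radii n) * \<zeta>)) \<longlonglongrightarrow> radial_limit g \<zeta>"
      by (rule filterlim_compose[OF radial_limit_tendsto[OF True] radii(3)])
    then have "lim (\<lambda>n. g (of_real (radii n) * \<zeta>)) = radial_limit g \<zeta>" by (rule limI)
    then show ?thesis using True that by (simp add: space_circle_measure)
  next
    case False
    then have "\<And>l. ((\<lambda>r. g (of_real r * \<zeta>)) \<longlongrightarrow> l) (at_left 1) = False" by (auto simp: has_radial_limit_def)
    then show ?thesis using False by (simp add: radial_limit_def t2_space_class.Lim_def)
  qed
  ultimately show ?thesis by (subst measurable_cong) auto
qed

text \<open>
  This reduces convergence in the first mean to convergence in the \<open>p\<close>-th mean.
\<close>

lemma le_add_weighted_powr:
  fixes x :: real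
  assumes "0 \<le> x" "1 < p" "0 < \<eta>" shows "x \<le> \<eta> + \<eta> powr (1 - p) * x powr p"
proof (cases "x \<le> \<eta>")
  case False
  then have x: "\<eta> < x" "0 < x" using assms by auto
  have "\<eta> powr (p - 1) \<le> x powr (p - 1)" using x assms by (intro powr_mono2) auto
  then have "\<eta> powr (1 - p) * \<eta> powr (p - 1) * x \<le> \<eta> powr (1 - p) * x powr (p - 1) * x"
    using x assms by (intro mult_right_mono mult_left_mono) auto
  moreover have "\<eta> powr (1 - p) * \<eta> powr (p - 1) = 1" using assms by (simp add: powr_add[symmetric])
  moreover have "x powr (p - 1) * x = x powr p" using x powr_add[of x "p - 1" 1] by simp
  ultimately show ?thesis using assms by (simp add: mult.assoc)
qed (use assms in \<open>simp add: add_increasing2\<close>)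

text \<open>
  The boundary function \<open>G\<close> is determined only almost everywhere. It is replaced by the radial limit, which agrees
  with it almost everywhere and is measurable itself.
\<close>

lemma hardy_radial_limits:
  assumes p: "1 < p" and g: "g holomorphic_on ball 0 1"
    and bd: "\<And>r. 0 < r \<Longrightarrow> r < 1 \<Longrightarrow> (LINT \<zeta>|circle_measure. cmod (g (of_real r * \<zeta>)) powr p) \<le> C"
  shows "AE \<zeta> in circle_measure. has_radial_limit g \<zeta>"
    and "integrable circle_measure (\<lambda>\<zeta>. cmod (radial_limit g \<zeta>) powr p)"
    and "\<And>r. 0 < r \<Longrightarrow> r < 1 \<Longrightarrow> integrable circle_measure (\<lambda>\<zeta>. cmod (g (of_real r * \<zeta>) - radial_limit g \<zeta>) powr p)"
    and "((\<lambda>r. LINT \<zeta>|circle_measure. cmod (g (of_real r * \<zeta>) - radial_limit g \<zeta>) powr p) \<longlongrightarrow> 0) (at_left 1)"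
proof -
  note cg = holomorphic_on_imp_continuous_on[OF g]
  have mgr: "(\<lambda>\<zeta>. g (of_real r * \<zeta>)) \<in> borel_measurable circle_measure" if "0 \<le> r" "r < 1" for r
    by (intro continuous_on_sphere_measurable continuous_on_sphere_dilate cg that)
  obtain G where G: "G \<in> borel_measurable circle_measure"
    "integrable circle_measure (\<lambda>\<zeta>. cmod (G \<zeta>) powr p)"
    "\<And>r. 0 < r \<Longrightarrow> r < 1 \<Longrightarrow> integrable circle_measure (\<lambda>\<zeta>. cmod (g (of_real r * \<zeta>) - G \<zeta>) powr p)"
    "((\<lambda>r. LINT \<zeta>|circle_measure. cmod (g (of_real r * \<zeta>) - G \<zeta>) powr p) \<longlongrightarrow> 0) (at_left 1)"
    by (rule hardy_boundary_function[OF p g bd]) auto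
  have iG: "integrable circle_measure G"
  proof (rule Bochner_Integration.integrable_bound)
    show "integrable circle_measure (\<lambda>\<zeta>. 1 + 1 powr (1 - p) * cmod (G \<zeta>) powr p)"
      using G(2) by (intro Bochner_Integration.integrable_add integrable_mult_right) auto
    show "AE \<zeta> in circle_measure. norm (G \<zeta>) \<le> norm (1 + 1 powr (1 - p) * cmod (G \<zeta>) powr p)"
      using le_add_weighted_powr[of "cmod (G \<zeta>)" p 1 for \<zeta>] p by (intro AE_I2) (simp add: abs_of_nonneg)
  qed (rule G(1))
  have iD: "integrable circle_measure (\<lambda>\<zeta>. cmod (g (of_real r * \<zeta>) - G \<zeta>))" if "0 < r" "r < 1" for r
    using that by (intro integrable_norm Bochner_Integration.integrable_diff iG continuous_on_sphere_integrable
        continuous_on_sphere_dilate cg) auto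
  have L1: "((\<lambda>r. LINT \<zeta>|circle_measure. cmod (g (of_real r * \<zeta>) - G \<zeta>)) \<longlongrightarrow> 0) (at_left 1)"
  proof (rule tendstoI)
    fix \<epsilon> :: real assume \<epsilon>: "0 < \<epsilon>"
    define \<eta> where "\<eta> = \<epsilon> / 2"
    have \<eta>: "0 < \<eta>" using \<epsilon> by (simp add: \<eta>_def)
    have "eventually (\<lambda>r. (LINT \<zeta>|circle_measure. cmod (g (of_real r * \<zeta>) - G \<zeta>) powr p) < \<eta> powr p) (at_left 1)"
      using order_tendstoD(2)[OF G(4), of "\<eta> powr p"] \<eta> by simp
    moreover have "eventually (\<lambda>r. r \<in> {0<..<1::real}) (at_left 1)" by (rule eventually_at_left_real) simp
    ultimately show "\<forall>\<^sub>F r in at_left 1. dist (LINT \<zeta>|circle_measure. cmod (g (of_real r * \<zeta>) - G \<zeta>)) 0 < \<epsilon>"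
    proof eventually_elim
      case (elim r)
      have "(LINT \<zeta>|circle_measure. cmod (g (of_real r * \<zeta>) - G \<zeta>))
        \<le> (LINT \<zeta>|circle_measure. \<eta> + \<eta> powr (1 - p) * cmod (g (of_real r * \<zeta>) - G \<zeta>) powr p)"
        using iD[of r] G(3)[of r] elim le_add_weighted_powr[OF _ p \<eta>]
        by (intro integral_mono Bochner_Integration.integrable_add integrable_mult_right) auto
      also have "\<dots> = \<eta> + \<eta> powr (1 - p) * (LINT \<zeta>|circle_measure. cmod (g (of_real r * \<zeta>) - G \<zeta>) powr p)"
        using G(3)[of r] elim by (simp add: space_circle_measure measure_circle_measure)
      also have "\<dots> < \<eta> + \<eta> powr (1 - p) * \<eta> powr p"
        using elim \<eta> by (intro add_strict_left_mono mult_strict_left_mono) auto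
      also have "\<eta> powr (1 - p) * \<eta> powr p = \<eta>" using \<eta> by (simp add: powr_add[symmetric])
      finally have "(LINT \<zeta>|circle_measure. cmod (g (of_real r * \<zeta>) - G \<zeta>)) < \<epsilon>" by (simp add: \<eta>_def)
      then show ?case by simp
    qed
  qed
  have ae: "AE t in lborel. t \<in> {0..2 * pi} \<longrightarrow> ((\<lambda>r. g (of_real r * cis t)) \<longlongrightarrow> G (cis t)) (at_left 1)"
    by (rule fatou_radial_limit[OF g iG L1])
  show h: "AE \<zeta> in circle_measure. has_radial_limit g \<zeta>"
    by (rule AE_circle_measureI[OF sets_has_radial_limit[OF cg]])
      (use ae in \<open>auto elim!: eventually_mono simp: has_radial_limit_def\<close>)
  note Rm = borel_measurable_radial_limit[OF cg]
  have eq: "AE \<zeta> in circle_measure. radial_limit g \<zeta> = G \<zeta>"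
  proof (rule AE_circle_measureI)
    have "{\<zeta> \<in> space circle_measure. radial_limit g \<zeta> = G \<zeta>} \<in> sets circle_measure"
      using Rm G(1) by measurable
    then show "{\<zeta> \<in> sphere 0 1. radial_limit g \<zeta> = G \<zeta>} \<in> sets circle_measure" by (simp add: space_circle_measure)
    show "AE t in lborel. t \<in> {0..2 * pi} \<longrightarrow> radial_limit g (cis t) = G (cis t)"
      using ae by eventually_elim (auto dest: radial_limit_eqI)
  qed
  have pm: "(\<lambda>\<zeta>. cmod (f \<zeta>) powr p) \<in> borel_measurable circle_measure" if "f \<in> borel_measurable circle_measure" for f :: "complex \<Rightarrow> complex"
    using that by measurable
  show "integrable circle_measure (\<lambda>\<zeta>. cmod (radial_limit g \<zeta>) powr p)"
    by (rule integrable_cong_AE_imp[OF G(2) pm[OF Rm]]) (use eq in \<open>auto elim!: eventually_mono\<close>)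
  show i3: "integrable circle_measure (\<lambda>\<zeta>. cmod (g (of_real r * \<zeta>) - radial_limit g \<zeta>) powr p)" if "0 < r" "r < 1" for r
    by (rule integrable_cong_AE_imp[OF G(3)[OF that] pm])
      (use mgr[of r] Rm that eq in \<open>auto elim!: eventually_mono\<close>)
  show "((\<lambda>r. LINT \<zeta>|circle_measure. cmod (g (of_real r * \<zeta>) - radial_limit g \<zeta>) powr p) \<longlongrightarrow> 0) (at_left 1)"
  proof (rule Lim_transform_eventually[OF G(4)])
    show "\<forall>\<^sub>F r in at_left 1. (LINT \<zeta>|circle_measure. cmod (g (of_real r * \<zeta>) - G \<zeta>) powr p)
        = (LINT \<zeta>|circle_measure. cmod (g (of_real r * \<zeta>) - radial_limit g \<zeta>) powr p)"
    proof (rule eventually_mono[OF eventually_at_left_real[of 0 1]])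
      fix r :: real assume "r \<in> {0<..<1}"
      then have r: "0 < r" "r < 1" by auto
      show "(LINT \<zeta>|circle_measure. cmod (g (of_real r * \<zeta>) - G \<zeta>) powr p)
        = (LINT \<zeta>|circle_measure. cmod (g (of_real r * \<zeta>) - radial_limit g \<zeta>) powr p)"
        by (rule integral_cong_AE) (use G(3)[OF r] i3[OF r] eq in \<open>auto elim!: eventually_mono\<close>)
    qed simp
  qed
qed

section \<open>The inequality for boundary values\<close>

lemma hp_space_means_bounded:
  assumes p: "1 < p" and f: "f \<in> hp_space p"
  obtains M where "\<And>r. 0 < r \<Longrightarrow> r < 1 \<Longrightarrow> (LINT \<zeta>|circle_measure. cmod (f (of_real r * \<zeta>)) powr p) \<le> M"
proof -
  define I where "I r = (LINT \<zeta>|circle_measure. cmod (f (of_real r * \<zeta>)) powr p)" for r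
  have I0: "0 \<le> I r" for r by (simp add: I_def)
  have "hp_norm p f < \<infinity>" using f by (simp add: hp_space_def)
  then have "(SUP r\<in>{0<..<1}. ereal (I r powr (1 / p))) < \<infinity>" by (simp add: hp_norm_def I_def)
  then have "(SUP r\<in>{0<..<1}. ereal (I r powr (1 / p))) \<noteq> \<infinity>" by simp
  then obtain n :: nat where "(SUP r\<in>{0<..<1}. ereal (I r powr (1 / p))) < ereal (real n)"
    unfolding less_PInf_Ex_of_nat by blast
  then obtain B where B: "(SUP r\<in>{0<..<1}. ereal (I r powr (1 / p))) < ereal B" by blast
  have "I r \<le> B powr p" if r: "0 < r" "r < 1" for r
  proof -
    have "ereal (I r powr (1 / p)) < ereal B"
      using r by (intro le_less_trans[OF SUP_upper B]) auto
    then have "I r powr (1 / p) \<le> B" by simp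
    then have "(I r powr (1 / p)) powr p \<le> B powr p" using p by (intro powr_mono2) auto
    then show ?thesis using p I0[of r] by (simp add: powr_powr)
  qed
  then show ?thesis using that unfolding I_def by blast
qed

text \<open>
  The pointwise inequality is integrated over the circle; the mean of the kernel at \<open>g h\<close> is nonnegative.
\<close>

lemma riesz_inequality_dilates:
  assumes p: "1 < p" and g: "g holomorphic_on ball 0 1" and h: "h holomorphic_on ball 0 1"
    and gh: "0 \<le> Re (g 0 * h 0)" and r: "0 < r" "r < 1"
  shows "(LINT \<zeta>|circle_measure. ((cmod (g (of_real r * \<zeta>)))\<^sup>2 + (cmod (h (of_real r * \<zeta>)))\<^sup>2) powr (p / 2))
    \<le> (1 - \<bar>cos (pi / p)\<bar>) powr (- (p / 2)) *
      (LINT \<zeta>|circle_measure. cmod (g (of_real r * \<zeta>) + cnj (h (of_real r * \<zeta>))) powr p)"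
proof -
  define a where "a = (1 - \<bar>cos (pi / p)\<bar>) powr (- (p / 2))"
  obtain b where b: "0 \<le> b" "\<And>z w. ((cmod z)\<^sup>2 + (cmod w)\<^sup>2) powr (p / 2)
      \<le> a * cmod (z + cnj w) powr p - b * riesz_kernel p (z * w)"
    unfolding a_def using riesz_pointwise[OF p] by blast
  have cg: "continuous_on (sphere 0 1) (\<lambda>\<zeta>. g (of_real r * \<zeta>))" "continuous_on (sphere 0 1) (\<lambda>\<zeta>. h (of_real r * \<zeta>))"
    using r by (intro continuous_on_sphere_dilate[OF holomorphic_on_imp_continuous_on[OF g]]
        continuous_on_sphere_dilate[OF holomorphic_on_imp_continuous_on[OF h]]; simp)+
  have i1: "integrable circle_measure (\<lambda>\<zeta>. ((cmod (g (of_real r * \<zeta>)))\<^sup>2 + (cmod (h (of_real r * \<zeta>)))\<^sup>2) powr (p / 2))"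
    using p by (intro continuous_on_sphere_integrable continuous_on_powr' continuous_intros cg) auto
  have i2: "integrable circle_measure (\<lambda>\<zeta>. cmod (g (of_real r * \<zeta>) + cnj (h (of_real r * \<zeta>))) powr p)"
    using p by (intro continuous_on_sphere_integrable continuous_on_powr' continuous_intros cg) auto
  have ck: "continuous_on (sphere 0 1) (\<lambda>\<zeta>. riesz_kernel p (g (of_real r * \<zeta>) * h (of_real r * \<zeta>)))"
    by (rule continuous_on_compose2[OF continuous_on_riesz_kernel[OF p]]) (auto intro!: continuous_intros cg)
  note i3 = continuous_on_sphere_integrable[OF ck]
  have "0 \<le> circle_mean r (\<lambda>z. riesz_kernel p (g z * h z))"
    using gh r by (intro circle_mean_riesz_kernel_nonneg p holomorphic_intros g h) auto
  then have nn: "0 \<le> (LINT \<zeta>|circle_measure. riesz_kernel p (g (of_real r * \<zeta>) * h (of_real r * \<zeta>)))"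
    using integral_circle_measure_mean[OF ck] by simp
  have "(LINT \<zeta>|circle_measure. ((cmod (g (of_real r * \<zeta>)))\<^sup>2 + (cmod (h (of_real r * \<zeta>)))\<^sup>2) powr (p / 2))
    \<le> (LINT \<zeta>|circle_measure. a * cmod (g (of_real r * \<zeta>) + cnj (h (of_real r * \<zeta>))) powr p
        - b * riesz_kernel p (g (of_real r * \<zeta>) * h (of_real r * \<zeta>)))"
    by (intro integral_mono i1 Bochner_Integration.integrable_diff integrable_mult_right i2 i3 b(2))
  also have "\<dots> = a * (LINT \<zeta>|circle_measure. cmod (g (of_real r * \<zeta>) + cnj (h (of_real r * \<zeta>))) powr p)
      - b * (LINT \<zeta>|circle_measure. riesz_kernel p (g (of_real r * \<zeta>) * h (of_real r * \<zeta>)))"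
    using i2 i3 by simp
  also have "\<dots> \<le> a * (LINT \<zeta>|circle_measure. cmod (g (of_real r * \<zeta>) + cnj (h (of_real r * \<zeta>))) powr p)"
    using mult_nonneg_nonneg[OF b(1) nn] by simp
  finally show ?thesis by (simp add: a_def)
qed

lemma norm_powr_le_quadratic_mean:
  assumes "0 < p"
  shows "cmod z powr p \<le> ((cmod z)\<^sup>2 + (cmod w)\<^sup>2) powr (p / 2)"
    and "cmod w powr p \<le> ((cmod z)\<^sup>2 + (cmod w)\<^sup>2) powr (p / 2)"
proof -
  have sq: "cmod u powr p = ((cmod u)\<^sup>2) powr (p / 2)" for u :: complex
  proof (cases "u = 0")
    case False
    then have "(cmod u)\<^sup>2 = cmod u powr 2" by simp
    then show ?thesis by (simp only: powr_powr) simp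
  qed (use assms in simp)
  show "cmod z powr p \<le> ((cmod z)\<^sup>2 + (cmod w)\<^sup>2) powr (p / 2)"
    "cmod w powr p \<le> ((cmod z)\<^sup>2 + (cmod w)\<^sup>2) powr (p / 2)"
    unfolding sq using assms by (auto intro!: powr_mono2)
qed

lemma quadratic_mean_powr_le:
  assumes "0 < p"
  shows "((cmod z)\<^sup>2 + (cmod w)\<^sup>2) powr (p / 2) \<le> 2 powr p * cmod z powr p + 2 powr p * cmod w powr p"
proof -
  have "((cmod z)\<^sup>2 + (cmod w)\<^sup>2) powr (p / 2) \<le> ((cmod z + cmod w)\<^sup>2) powr (p / 2)"
    using assms by (intro powr_mono2) (auto simp: power2_sum)
  also have "\<dots> = (cmod z + cmod w) powr p"
  proof (cases "cmod z + cmod w = 0")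
    case False
    then have "0 < cmod z + cmod w" using add_nonneg_nonneg[OF norm_ge_zero norm_ge_zero, of z w] by linarith
    then have "(cmod z + cmod w)\<^sup>2 = (cmod z + cmod w) powr 2" by simp
    then show ?thesis by (simp only: powr_powr) simp
  qed (use assms in simp)
  also have "\<dots> \<le> (1 + 1) powr p * cmod z powr p + (1 + 1 / 1) powr p * cmod w powr p"
    using assms by (intro powr_add_le_weighted) auto
  finally show ?thesis by simp
qed

lemma norm_add_powr_le:
  fixes z w :: complex
  assumes "0 < p"
  shows "cmod (z + w) powr p \<le> 2 powr p * cmod z powr p + 2 powr p * cmod w powr p"
proof -
  have "cmod (z + w) powr p \<le> (cmod z + cmod w) powr p"
    using assms by (intro powr_mono2 norm_triangle_ineq) auto
  also have "\<dots> \<le> (1 + 1) powr p * cmod z powr p + (1 + 1 / 1) powr p * cmod w powr p"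
    using assms by (intro powr_add_le_weighted) auto
  finally show ?thesis by simp
qed

text \<open>
  Moving the constant \<open>h 0\<close> from \<open>h\<close> to \<open>g\<close> leaves the sum unchanged and makes the product vanish at 0, so
  the inequality on circles bounds the means of both parts.
\<close>

lemma hardy_parts_of_hp:
  assumes p: "1 < p" and g: "g holomorphic_on ball 0 1" and h: "h holomorphic_on ball 0 1"
    and f: "(\<lambda>z. g z + cnj (h z)) \<in> hp_space p"
  obtains C where "\<And>r. 0 < r \<Longrightarrow> r < 1 \<Longrightarrow> (LINT \<zeta>|circle_measure. cmod (g (of_real r * \<zeta>)) powr p) \<le> C"
    "\<And>r. 0 < r \<Longrightarrow> r < 1 \<Longrightarrow> (LINT \<zeta>|circle_measure. cmod (h (of_real r * \<zeta>)) powr p) \<le> C"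
proof -
  define a where "a = (1 - \<bar>cos (pi / p)\<bar>) powr (- (p / 2))"
  have a0: "0 \<le> a" by (simp add: a_def)
  obtain M where M: "\<And>r. 0 < r \<Longrightarrow> r < 1 \<Longrightarrow> (LINT \<zeta>|circle_measure. cmod (g (of_real r * \<zeta>) + cnj (h (of_real r * \<zeta>))) powr p) \<le> M"
    using hp_space_means_bounded[OF p f] by blast
  define c where "c = h 0"
  define g1 where "g1 z = g z + cnj c" for z
  define h1 where "h1 z = h z - c" for z
  have g1: "g1 holomorphic_on ball 0 1" unfolding g1_def by (intro holomorphic_intros g)
  have h1: "h1 holomorphic_on ball 0 1" unfolding h1_def by (intro holomorphic_intros h)
  have cr: "continuous_on (sphere 0 1) (\<lambda>\<zeta>. u (of_real r * \<zeta>))" if "u holomorphic_on ball 0 1" "0 < r" "r < 1" for u r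
    using that by (intro continuous_on_sphere_dilate holomorphic_on_imp_continuous_on) auto
  have ip: "integrable circle_measure (\<lambda>\<zeta>. cmod (u (of_real r * \<zeta>)) powr p)" if "u holomorphic_on ball 0 1" "0 < r" "r < 1" for u r
    using p by (intro continuous_on_sphere_integrable continuous_on_powr' continuous_intros cr that) auto
  have Q: "(LINT \<zeta>|circle_measure. ((cmod (g1 (of_real r * \<zeta>)))\<^sup>2 + (cmod (h1 (of_real r * \<zeta>)))\<^sup>2) powr (p / 2)) \<le> a * M"
    if r: "0 < r" "r < 1" for r
  proof -
    have eq: "g1 z + cnj (h1 z) = g z + cnj (h z)" for z by (simp add: g1_def h1_def)
    have "0 \<le> Re (g1 0 * h1 0)" by (simp add: h1_def c_def)
    from riesz_inequality_dilates[OF p g1 h1 this r]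
    have "(LINT \<zeta>|circle_measure. ((cmod (g1 (of_real r * \<zeta>)))\<^sup>2 + (cmod (h1 (of_real r * \<zeta>)))\<^sup>2) powr (p / 2))
      \<le> a * (LINT \<zeta>|circle_measure. cmod (g (of_real r * \<zeta>) + cnj (h (of_real r * \<zeta>))) powr p)"
      unfolding eq a_def .
    also have "\<dots> \<le> a * M" using M[OF r] a0 by (intro mult_left_mono)
    finally show ?thesis .
  qed
  have iQ: "integrable circle_measure (\<lambda>\<zeta>. ((cmod (g1 (of_real r * \<zeta>)))\<^sup>2 + (cmod (h1 (of_real r * \<zeta>)))\<^sup>2) powr (p / 2))"
    if r: "0 < r" "r < 1" for r
    using p by (intro continuous_on_sphere_integrable continuous_on_powr' continuous_intros cr g1 h1 r) auto
  have b1: "(LINT \<zeta>|circle_measure. cmod (g1 (of_real r * \<zeta>)) powr p) \<le> a * M"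
    "(LINT \<zeta>|circle_measure. cmod (h1 (of_real r * \<zeta>)) powr p) \<le> a * M" if r: "0 < r" "r < 1" for r
  proof -
    have p0: "0 < p" using p by simp
    have "(LINT \<zeta>|circle_measure. cmod (g1 (of_real r * \<zeta>)) powr p)
        \<le> (LINT \<zeta>|circle_measure. ((cmod (g1 (of_real r * \<zeta>)))\<^sup>2 + (cmod (h1 (of_real r * \<zeta>)))\<^sup>2) powr (p / 2))"
      by (rule integral_mono[OF ip[OF g1 r] iQ[OF r] norm_powr_le_quadratic_mean(1)[OF p0]])
    then show "(LINT \<zeta>|circle_measure. cmod (g1 (of_real r * \<zeta>)) powr p) \<le> a * M"
      using Q[OF r] by linarith
    have "(LINT \<zeta>|circle_measure. cmod (h1 (of_real r * \<zeta>)) powr p)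
        \<le> (LINT \<zeta>|circle_measure. ((cmod (g1 (of_real r * \<zeta>)))\<^sup>2 + (cmod (h1 (of_real r * \<zeta>)))\<^sup>2) powr (p / 2))"
      by (rule integral_mono[OF ip[OF h1 r] iQ[OF r] norm_powr_le_quadratic_mean(2)[OF p0]])
    then show "(LINT \<zeta>|circle_measure. cmod (h1 (of_real r * \<zeta>)) powr p) \<le> a * M"
      using Q[OF r] by linarith
  qed
  have shift: "(LINT \<zeta>|circle_measure. cmod (u (of_real r * \<zeta>) + k) powr p) \<le> 2 powr p * (a * M) + 2 powr p * cmod k powr p"
    if u: "u holomorphic_on ball 0 1" and r: "0 < r" "r < 1"
      and le: "(LINT \<zeta>|circle_measure. cmod (u (of_real r * \<zeta>)) powr p) \<le> a * M" for u k r
  proof -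
    have uk: "(\<lambda>z. u z + k) holomorphic_on ball 0 1" by (intro holomorphic_intros u)
    have "(LINT \<zeta>|circle_measure. cmod (u (of_real r * \<zeta>) + k) powr p)
      \<le> (LINT \<zeta>|circle_measure. 2 powr p * cmod (u (of_real r * \<zeta>)) powr p + 2 powr p * cmod k powr p)"
      using p ip[OF u r] ip[OF uk r]
      by (intro integral_mono norm_add_powr_le Bochner_Integration.integrable_add integrable_mult_right) auto
    also have "\<dots> = 2 powr p * (LINT \<zeta>|circle_measure. cmod (u (of_real r * \<zeta>)) powr p) + 2 powr p * cmod k powr p"
      using ip[OF u r] by (simp add: space_circle_measure measure_circle_measure)
    also have "\<dots> \<le> 2 powr p * (a * M) + 2 powr p * cmod k powr p" using le by (intro add_right_mono mult_left_mono) auto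
    finally show ?thesis .
  qed
  show ?thesis
  proof (rule that)
    fix r :: real assume r: "0 < r" "r < 1"
    show "(LINT \<zeta>|circle_measure. cmod (g (of_real r * \<zeta>)) powr p) \<le> 2 powr p * (a * M) + 2 powr p * cmod c powr p"
      using shift[OF g1 r b1(1)[OF r], of "- cnj c"] by (simp add: g1_def)
    show "(LINT \<zeta>|circle_measure. cmod (h (of_real r * \<zeta>)) powr p) \<le> 2 powr p * (a * M) + 2 powr p * cmod c powr p"
      using shift[OF h1 r b1(2)[OF r], of c] by (simp add: h1_def)
  qed
qed

text \<open>
  The last claim is the limit of the inequality on circles: the left-hand side is lower semicontinuous by
  Fatou's lemma, and on the right-hand side the means converge because the dilates of \<open>g\<close> and \<open>h\<close> do so in
  the \<open>p\<close>-th mean.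
\<close>

lemma boundary_values_of_hp:
  assumes p: "1 < p" and g: "g holomorphic_on ball 0 1" and h: "h holomorphic_on ball 0 1"
    and f: "(\<lambda>z. g z + cnj (h z)) \<in> hp_space p"
  shows "AE \<zeta> in circle_measure. has_radial_limit g \<zeta> \<and> has_radial_limit h \<zeta>"
    and "integrable circle_measure (\<lambda>\<zeta>. ((cmod (radial_limit g \<zeta>))\<^sup>2 + (cmod (radial_limit h \<zeta>))\<^sup>2) powr (p / 2))"
    and "integrable circle_measure (\<lambda>\<zeta>. cmod (radial_limit g \<zeta> + cnj (radial_limit h \<zeta>)) powr p)"
    and "0 \<le> Re (g 0 * h 0) \<Longrightarrow>
      (LINT \<zeta>|circle_measure. ((cmod (radial_limit g \<zeta>))\<^sup>2 + (cmod (radial_limit h \<zeta>))\<^sup>2) powr (p / 2))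
      \<le> (1 - \<bar>cos (pi / p)\<bar>) powr (- (p / 2)) *
        (LINT \<zeta>|circle_measure. cmod (radial_limit g \<zeta> + cnj (radial_limit h \<zeta>)) powr p)"
proof -
  obtain C where C: "\<And>r. 0 < r \<Longrightarrow> r < 1 \<Longrightarrow> (LINT \<zeta>|circle_measure. cmod (g (of_real r * \<zeta>)) powr p) \<le> C"
    "\<And>r. 0 < r \<Longrightarrow> r < 1 \<Longrightarrow> (LINT \<zeta>|circle_measure. cmod (h (of_real r * \<zeta>)) powr p) \<le> C"
    by (rule hardy_parts_of_hp[OF p g h f]) auto
  note G = hardy_radial_limits[OF p g C(1)] and H = hardy_radial_limits[OF p h C(2)]
  note mG[measurable] = borel_measurable_radial_limit[OF holomorphic_on_imp_continuous_on[OF g]]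
  note mH[measurable] = borel_measurable_radial_limit[OF holomorphic_on_imp_continuous_on[OF h]]
  have mcnj[measurable]: "cnj \<in> borel_measurable borel" by (intro borel_measurable_continuous_onI continuous_intros)
  show ae: "AE \<zeta> in circle_measure. has_radial_limit g \<zeta> \<and> has_radial_limit h \<zeta>"
    using G(1) H(1) by simp
  define F where "F \<zeta> = radial_limit g \<zeta> + cnj (radial_limit h \<zeta>)" for \<zeta>
  define W where "W \<zeta> = ((cmod (radial_limit g \<zeta>))\<^sup>2 + (cmod (radial_limit h \<zeta>))\<^sup>2) powr (p / 2)" for \<zeta>
  have mF[measurable]: "F \<in> borel_measurable circle_measure" unfolding F_def by measurable
  have mW[measurable]: "W \<in> borel_measurable circle_measure" unfolding W_def by measurable
  have iGH: "integrable circle_measure (\<lambda>\<zeta>. 2 powr p * cmod (radial_limit g \<zeta>) powr p + 2 powr p * cmod (radial_limit h \<zeta>) powr p)"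
    using G(2) H(2) by (intro Bochner_Integration.integrable_add integrable_mult_right) auto
  have iW: "integrable circle_measure W"
    by (rule Bochner_Integration.integrable_bound[OF iGH mW])
      (use quadratic_mean_powr_le[of p] p in \<open>auto simp: W_def\<close>)
  then show "integrable circle_measure (\<lambda>\<zeta>. ((cmod (radial_limit g \<zeta>))\<^sup>2 + (cmod (radial_limit h \<zeta>))\<^sup>2) powr (p / 2))"
    by (simp add: W_def[abs_def])
  have iF: "integrable circle_measure (\<lambda>\<zeta>. cmod (F \<zeta>) powr p)"
    by (rule Bochner_Integration.integrable_bound[OF iGH])
      (use norm_add_powr_le[of p "radial_limit g \<zeta>" "cnj (radial_limit h \<zeta>)" for \<zeta>] p in \<open>auto simp: F_def\<close>)
  then show "integrable circle_measure (\<lambda>\<zeta>. cmod (radial_limit g \<zeta> + cnj (radial_limit h \<zeta>)) powr p)"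
    by (simp add: F_def)
  assume gh: "0 \<le> Re (g 0 * h 0)"
  define a where "a = (1 - \<bar>cos (pi / p)\<bar>) powr (- (p / 2))"
  have a0: "0 \<le> a" by (simp add: a_def)
  define I where "I = (LINT \<zeta>|circle_measure. cmod (F \<zeta>) powr p)"
  have cr: "continuous_on (sphere 0 1) (\<lambda>\<zeta>. g (of_real r * \<zeta>))" "continuous_on (sphere 0 1) (\<lambda>\<zeta>. h (of_real r * \<zeta>))"
    if "0 < r" "r < 1" for r
    using that by (intro continuous_on_sphere_dilate[OF holomorphic_on_imp_continuous_on[OF g]]
        continuous_on_sphere_dilate[OF holomorphic_on_imp_continuous_on[OF h]]; simp)+
  define E where "E r = (LINT \<zeta>|circle_measure. 2 powr p * cmod (g (of_real r * \<zeta>) - radial_limit g \<zeta>) powr p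
      + 2 powr p * cmod (h (of_real r * \<zeta>) - radial_limit h \<zeta>) powr p)" for r
  have iE: "integrable circle_measure (\<lambda>\<zeta>. 2 powr p * cmod (g (of_real r * \<zeta>) - radial_limit g \<zeta>) powr p
      + 2 powr p * cmod (h (of_real r * \<zeta>) - radial_limit h \<zeta>) powr p)" if "0 < r" "r < 1" for r
    using G(3)[OF _ _ that] H(3)[OF _ _ that] by (intro Bochner_Integration.integrable_add integrable_mult_right) auto
  have E0: "(E \<longlongrightarrow> 0) (at_left 1)"
  proof (rule Lim_transform_eventually)
    have "((\<lambda>r. 2 powr p * (LINT \<zeta>|circle_measure. cmod (g (of_real r * \<zeta>) - radial_limit g \<zeta>) powr p)
        + 2 powr p * (LINT \<zeta>|circle_measure. cmod (h (of_real r * \<zeta>) - radial_limit h \<zeta>) powr p)) \<longlongrightarrow> 2 powr p * 0 + 2 powr p * 0) (at_left 1)"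
      using G(4) H(4) by (intro tendsto_intros) auto
    then show "((\<lambda>r. 2 powr p * (LINT \<zeta>|circle_measure. cmod (g (of_real r * \<zeta>) - radial_limit g \<zeta>) powr p)
        + 2 powr p * (LINT \<zeta>|circle_measure. cmod (h (of_real r * \<zeta>) - radial_limit h \<zeta>) powr p)) \<longlongrightarrow> 0) (at_left 1)" by simp
    show "\<forall>\<^sub>F r in at_left 1. 2 powr p * (LINT \<zeta>|circle_measure. cmod (g (of_real r * \<zeta>) - radial_limit g \<zeta>) powr p)
        + 2 powr p * (LINT \<zeta>|circle_measure. cmod (h (of_real r * \<zeta>) - radial_limit h \<zeta>) powr p) = E r"
      by (rule eventually_mono[OF eventually_at_left_real[of 0 1]])
        (use G(3) H(3) in \<open>auto simp: E_def\<close>)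
  qed
  have upper: "(LINT \<zeta>|circle_measure. cmod (g (of_real r * \<zeta>) + cnj (h (of_real r * \<zeta>))) powr p)
      \<le> (1 + \<epsilon>) powr p * I + (1 + 1 / \<epsilon>) powr p * E r" if r: "0 < r" "r < 1" and \<epsilon>: "0 < \<epsilon>" for r \<epsilon>
  proof -
    have "(LINT \<zeta>|circle_measure. cmod (g (of_real r * \<zeta>) + cnj (h (of_real r * \<zeta>))) powr p)
      \<le> (LINT \<zeta>|circle_measure. (1 + \<epsilon>) powr p * cmod (F \<zeta>) powr p + (1 + 1 / \<epsilon>) powr p *
        (2 powr p * cmod (g (of_real r * \<zeta>) - radial_limit g \<zeta>) powr p + 2 powr p * cmod (h (of_real r * \<zeta>) - radial_limit h \<zeta>) powr p))"
    proof (rule integral_mono)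
      show "integrable circle_measure (\<lambda>\<zeta>. cmod (g (of_real r * \<zeta>) + cnj (h (of_real r * \<zeta>))) powr p)"
        using p by (intro continuous_on_sphere_integrable continuous_on_powr' continuous_intros cr r) auto
      show "integrable circle_measure (\<lambda>\<zeta>. (1 + \<epsilon>) powr p * cmod (F \<zeta>) powr p + (1 + 1 / \<epsilon>) powr p *
        (2 powr p * cmod (g (of_real r * \<zeta>) - radial_limit g \<zeta>) powr p + 2 powr p * cmod (h (of_real r * \<zeta>) - radial_limit h \<zeta>) powr p))"
        by (intro Bochner_Integration.integrable_add integrable_mult_right iF iE[OF r])
      fix \<zeta>
      define u where "u = g (of_real r * \<zeta>) - radial_limit g \<zeta>"
      define v where "v = cnj (h (of_real r * \<zeta>) - radial_limit h \<zeta>)"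
      have "g (of_real r * \<zeta>) + cnj (h (of_real r * \<zeta>)) = F \<zeta> + (u + v)" by (simp add: u_def v_def F_def)
      then have "cmod (g (of_real r * \<zeta>) + cnj (h (of_real r * \<zeta>))) powr p \<le> (cmod (F \<zeta>) + cmod (u + v)) powr p"
        using p norm_triangle_ineq[of "F \<zeta>" "u + v"] by (intro powr_mono2) auto
      also have "\<dots> \<le> (1 + \<epsilon>) powr p * cmod (F \<zeta>) powr p + (1 + 1 / \<epsilon>) powr p * cmod (u + v) powr p"
        using p \<epsilon> by (intro powr_add_le_weighted) auto
      also have "\<dots> \<le> (1 + \<epsilon>) powr p * cmod (F \<zeta>) powr p + (1 + 1 / \<epsilon>) powr p * (2 powr p * cmod u powr p + 2 powr p * cmod v powr p)"
        using p by (intro add_left_mono mult_left_mono norm_add_powr_le) auto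
      also have "cmod v = cmod (h (of_real r * \<zeta>) - radial_limit h \<zeta>)" unfolding v_def by (rule complex_mod_cnj)
      finally show "cmod (g (of_real r * \<zeta>) + cnj (h (of_real r * \<zeta>))) powr p \<le> (1 + \<epsilon>) powr p * cmod (F \<zeta>) powr p + (1 + 1 / \<epsilon>) powr p *
        (2 powr p * cmod (g (of_real r * \<zeta>) - radial_limit g \<zeta>) powr p + 2 powr p * cmod (h (of_real r * \<zeta>) - radial_limit h \<zeta>) powr p)"
        unfolding u_def .
    qed
    also have "\<dots> = (1 + \<epsilon>) powr p * I + (1 + 1 / \<epsilon>) powr p * E r"
      unfolding I_def E_def using iF iE[OF r] by (subst Bochner_Integration.integral_add) auto
    finally show ?thesis .
  qed
  have le: "integral\<^sup>L circle_measure W \<le> a * ((1 + \<epsilon>) powr p * I + \<epsilon>)" if \<epsilon>: "0 < \<epsilon>" for \<epsilon>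
  proof (rule integral_le_AE_limit(2)[where f = "\<lambda>n \<zeta>. ((cmod (g (of_real (radii n) * \<zeta>)))\<^sup>2 + (cmod (h (of_real (radii n) * \<zeta>)))\<^sup>2) powr (p / 2)"])
    show "integrable circle_measure (\<lambda>\<zeta>. ((cmod (g (of_real (radii n) * \<zeta>)))\<^sup>2 + (cmod (h (of_real (radii n) * \<zeta>)))\<^sup>2) powr (p / 2))" for n
      using p by (intro continuous_on_sphere_integrable continuous_on_powr' continuous_intros cr radii) auto
    show "AE \<zeta> in circle_measure. (\<lambda>n. ((cmod (g (of_real (radii n) * \<zeta>)))\<^sup>2 + (cmod (h (of_real (radii n) * \<zeta>)))\<^sup>2) powr (p / 2)) \<longlonglongrightarrow> W \<zeta>"
      using ae
    proof eventually_elim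
      case (elim \<zeta>)
      have "(\<lambda>n. g (of_real (radii n) * \<zeta>)) \<longlonglongrightarrow> radial_limit g \<zeta>" "(\<lambda>n. h (of_real (radii n) * \<zeta>)) \<longlonglongrightarrow> radial_limit h \<zeta>"
        using elim by (auto intro: filterlim_compose[OF radial_limit_tendsto radii(3)])
      then show ?case unfolding W_def using p by (intro tendsto_powr2 tendsto_intros) auto
    qed
    have "((\<lambda>r. (1 + 1 / \<epsilon>) powr p * E r) \<longlongrightarrow> (1 + 1 / \<epsilon>) powr p * 0) (at_left 1)"
      by (intro tendsto_intros E0)
    then have "(\<lambda>n. (1 + 1 / \<epsilon>) powr p * E (radii n)) \<longlonglongrightarrow> 0"
      using filterlim_compose[OF _ radii(3)] by auto
    then have "eventually (\<lambda>n. (1 + 1 / \<epsilon>) powr p * E (radii n) < \<epsilon>) sequentially"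
      using \<epsilon> by (rule order_tendstoD)
    then show "\<forall>\<^sub>F n in sequentially. (LINT \<zeta>|circle_measure. ((cmod (g (of_real (radii n) * \<zeta>)))\<^sup>2 + (cmod (h (of_real (radii n) * \<zeta>)))\<^sup>2) powr (p / 2))
        \<le> a * ((1 + \<epsilon>) powr p * I + \<epsilon>)"
    proof eventually_elim
      case (elim n)
      have "(LINT \<zeta>|circle_measure. ((cmod (g (of_real (radii n) * \<zeta>)))\<^sup>2 + (cmod (h (of_real (radii n) * \<zeta>)))\<^sup>2) powr (p / 2))
        \<le> a * (LINT \<zeta>|circle_measure. cmod (g (of_real (radii n) * \<zeta>) + cnj (h (of_real (radii n) * \<zeta>))) powr p)"
        unfolding a_def by (rule riesz_inequality_dilates[OF p g h gh radii(1,2)])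
      also have "\<dots> \<le> a * ((1 + \<epsilon>) powr p * I + \<epsilon>)"
        using upper[OF radii(1,2)[of n] \<epsilon>] elim a0 by (intro mult_left_mono) auto
      finally show ?case .
    qed
  qed (use mW in auto)
  have "((\<lambda>\<epsilon>. a * ((1 + \<epsilon>) powr p * I + \<epsilon>)) \<longlongrightarrow> a * ((1 + 0) powr p * I + 0)) (at_right 0)"
    by (intro tendsto_intros) auto
  moreover have "eventually (\<lambda>\<epsilon>. integral\<^sup>L circle_measure W \<le> a * ((1 + \<epsilon>) powr p * I + \<epsilon>)) (at_right 0)"
    using le by (intro eventually_mono[OF eventually_at_right_less]) auto
  ultimately have "integral\<^sup>L circle_measure W \<le> a * ((1 + 0) powr p * I + 0)"
    by (intro tendsto_lowerbound) auto
  then show "(LINT \<zeta>|circle_measure. ((cmod (radial_limit g \<zeta>))\<^sup>2 + (cmod (radial_limit h \<zeta>))\<^sup>2) powr (p / 2))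
      \<le> (1 - \<bar>cos (pi / p)\<bar>) powr (- (p / 2)) *
        (LINT \<zeta>|circle_measure. cmod (radial_limit g \<zeta> + cnj (radial_limit h \<zeta>)) powr p)"
    by (simp add: W_def[abs_def] I_def F_def a_def)
qed

section \<open>Sharpness of the constant\<close>

definition cayley :: "complex \<Rightarrow> complex" where "cayley z = (1 + z) / (1 - z)"

definition cayley_power :: "real \<Rightarrow> complex \<Rightarrow> complex" where
  "cayley_power \<gamma> z = exp (of_real \<gamma> * Ln (cayley z))"

lemma Re_cayley: "Re (cayley z) = (1 - (cmod z)\<^sup>2) / (cmod (1 - z))\<^sup>2"
proof -
  have "Re (cayley z) = Re ((1 + z) * cnj (1 - z)) / (cmod (1 - z))\<^sup>2"
    unfolding cayley_def complex_div_cnj[of "1 + z" "1 - z"] by simp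
  also have "Re ((1 + z) * cnj (1 - z)) = 1 - (cmod z)\<^sup>2"
    unfolding cmod_power2 by (simp add: power2_eq_square algebra_simps)
  finally show ?thesis .
qed

lemma cayley_disk:
  assumes "cmod z < 1" shows "0 < Re (cayley z)" "cayley z \<noteq> 0" "cayley z \<notin> \<real>\<^sub>\<le>\<^sub>0"
proof -
  have "z \<noteq> 1" using assms by auto
  moreover have "(cmod z)\<^sup>2 < 1" using assms by (simp add: power_less_one_iff abs_square_less_1)
  ultimately show 1: "0 < Re (cayley z)" by (simp add: Re_cayley)
  then show "cayley z \<noteq> 0" "cayley z \<notin> \<real>\<^sub>\<le>\<^sub>0" by (auto simp: complex_nonpos_Reals_iff)
qed

lemma cayley_circle:
  assumes "cmod z = 1" "z \<noteq> 1" "z \<noteq> - 1"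
  shows "Re (cayley z) = 0" "cayley z \<noteq> 0" "cayley z \<notin> \<real>\<^sub>\<le>\<^sub>0"
proof -
  show 1: "Re (cayley z) = 0" using assms by (simp add: Re_cayley)
  show 2: "cayley z \<noteq> 0" using assms by (auto simp: cayley_def add_eq_0_iff)
  show "cayley z \<notin> \<real>\<^sub>\<le>\<^sub>0"
  proof
    assume "cayley z \<in> \<real>\<^sub>\<le>\<^sub>0"
    then have "Im (cayley z) = 0" by (simp add: complex_nonpos_Reals_iff)
    then show False using 1 2 by (simp add: complex_eq_iff)
  qed
qed

lemma holomorphic_cayley_power: "cayley_power \<gamma> holomorphic_on ball 0 1"
proof -
  have "cayley holomorphic_on ball 0 1" unfolding cayley_def[abs_def] by (intro holomorphic_intros) auto
  then show ?thesis unfolding cayley_power_def[abs_def]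
    using cayley_disk(3) by (intro holomorphic_intros) auto
qed

lemma cmod_cayley_power:
  assumes "cayley z \<noteq> 0" shows "cmod (cayley_power \<gamma> z) = cmod (cayley z) powr \<gamma>"
  using assms by (simp add: cayley_power_def powr_def)

text \<open>
  On the circle \<open>cayley\<close> is purely imaginary, so the argument of its power has the constant modulus
  \<open>\<gamma> pi / 2\<close>.
\<close>

lemma cayley_power_circle:
  assumes "cmod z = 1" "z \<noteq> 1" "z \<noteq> - 1" and \<gamma>: "0 \<le> \<gamma>" "\<gamma> \<le> 1"
  shows "\<bar>Re (cayley_power \<gamma> z)\<bar> = cmod (cayley z) powr \<gamma> * cos (\<gamma> * pi / 2)"
    and "\<bar>Im (cayley_power \<gamma> z)\<bar> = cmod (cayley z) powr \<gamma> * sin (\<gamma> * pi / 2)"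
proof -
  note c = cayley_circle[OF assms(1-3)]
  have "\<bar>Arg (cayley z)\<bar> = pi / 2" using arccos_Re_over_cmod[OF c(2)] c(1) by simp
  then have A: "Arg (cayley z) = pi / 2 \<or> Arg (cayley z) = - (pi / 2)" by linarith
  have g: "0 \<le> \<gamma> * pi / 2" "\<gamma> * pi / 2 \<le> pi / 2" using \<gamma> by auto
  then have nn: "0 \<le> cos (\<gamma> * pi / 2)" "0 \<le> sin (\<gamma> * pi / 2)"
  proof -
    have b: "- (pi / 2) \<le> \<gamma> * pi / 2" "\<gamma> * pi / 2 \<le> pi" using g pi_gt_zero by linarith+
    show "0 \<le> cos (\<gamma> * pi / 2)" by (rule cos_ge_zero[OF b(1) g(2)])
    show "0 \<le> sin (\<gamma> * pi / 2)" by (rule sin_ge_zero[OF g(1) b(2)])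
  qed
  have "cos (\<gamma> * Arg (cayley z)) = cos (\<gamma> * pi / 2)" "\<bar>sin (\<gamma> * Arg (cayley z))\<bar> = sin (\<gamma> * pi / 2)"
  proof -
    have "\<gamma> * Arg (cayley z) = \<gamma> * pi / 2 \<or> \<gamma> * Arg (cayley z) = - (\<gamma> * pi / 2)"
      using A by (elim disjE) simp_all
    then show "cos (\<gamma> * Arg (cayley z)) = cos (\<gamma> * pi / 2)" "\<bar>sin (\<gamma> * Arg (cayley z))\<bar> = sin (\<gamma> * pi / 2)"
      using nn by (auto simp only: cos_minus sin_minus abs_minus_cancel abs_of_nonneg)
  qed
  moreover have "Im (cayley_power \<gamma> z) = cmod (cayley z) powr \<gamma> * sin (\<gamma> * Arg (cayley z))"
    using c(2) by (simp add: cayley_power_def Im_exp powr_def Arg_eq_Im_Ln)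
  moreover have "Re (cayley_power \<gamma> z) = cmod (cayley z) powr \<gamma> * cos (\<gamma> * Arg (cayley z))"
    unfolding cayley_power_def by (rule Re_exp_real_Ln[OF c(2)])
  ultimately show "\<bar>Re (cayley_power \<gamma> z)\<bar> = cmod (cayley z) powr \<gamma> * cos (\<gamma> * pi / 2)"
    "\<bar>Im (cayley_power \<gamma> z)\<bar> = cmod (cayley z) powr \<gamma> * sin (\<gamma> * pi / 2)"
    using nn by (simp_all add: abs_mult)
qed

lemma radial_limit_cayley_power:
  assumes "cmod z = 1" "z \<noteq> 1" "z \<noteq> - 1"
  shows "((\<lambda>r. cayley_power \<gamma> (of_real r * z)) \<longlongrightarrow> cayley_power \<gamma> z) (at_left 1)"
proof -
  have "isCont (cayley_power \<gamma>) z"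
    unfolding cayley_power_def[abs_def] cayley_def[abs_def]
    using assms cayley_circle(3)[OF assms] by (intro continuous_intros) (auto simp: cayley_def)
  moreover have "((\<lambda>r. of_real r * z) \<longlongrightarrow> of_real 1 * z) (at_left 1)" by (intro tendsto_intros)
  ultimately show ?thesis by (intro isCont_tendsto_compose[of z "cayley_power \<gamma>"]) simp_all
qed

lemma AE_circle_not_real: "AE \<zeta> in circle_measure. cmod \<zeta> = 1 \<and> \<zeta> \<noteq> 1 \<and> \<zeta> \<noteq> - 1"
proof (rule AE_circle_measureI)
  have "sphere 0 1 \<inter> - {1, - 1 :: complex} \<in> sets (restrict_space borel (sphere 0 1))"
    unfolding sets_restrict_space by auto
  moreover have "sphere 0 1 \<inter> - {1, - 1 :: complex} = {\<zeta> \<in> sphere 0 1. cmod \<zeta> = 1 \<and> \<zeta> \<noteq> 1 \<and> \<zeta> \<noteq> - 1}" by auto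
  ultimately show "{\<zeta> \<in> sphere 0 1. cmod \<zeta> = 1 \<and> \<zeta> \<noteq> 1 \<and> \<zeta> \<noteq> - 1} \<in> sets circle_measure"
    by (simp only: sets_circle_measure)
  have "AE t in lborel. t \<notin> {0, pi, 2 * pi}"
    by (intro AE_not_in finite_imp_null_set_lborel) auto
  then show "AE t in lborel. t \<in> {0..2 * pi} \<longrightarrow> cmod (cis t) = 1 \<and> cis t \<noteq> 1 \<and> cis t \<noteq> - 1"
  proof eventually_elim
    case (elim t)
    show ?case
    proof (intro impI conjI)
      assume t: "t \<in> {0..2 * pi}"
      have "sin t \<noteq> 0"
      proof (cases "t < pi")
        case True
        then show ?thesis using t elim sin_gt_zero[of t] by auto
      next
        case False
        then show ?thesis using t elim sin_gt_zero[of "t - pi"] by (auto simp: sin_diff)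
      qed
      then show "cis t \<noteq> 1" "cis t \<noteq> - 1" by (auto simp: complex_eq_iff)
    qed simp
  qed
qed

lemma cmod_one_minus_cis:
  assumes "0 \<le> t" "t \<le> 2 * pi" shows "cmod (1 - cis t) = 2 * sin (t / 2)"
proof (rule power2_eq_imp_eq)
  have "(cmod (1 - cis t))\<^sup>2 = (1 - cos t)\<^sup>2 + (sin t)\<^sup>2" by (simp add: cmod_power2)
  also have "\<dots> = 2 - 2 * cos t" using sin_cos_squared_add[of t] by (simp add: power2_eq_square algebra_simps)
  also have "\<dots> = (2 * sin (t / 2))\<^sup>2" using cos_double_sin[of "t / 2"] by (simp add: power_mult_distrib)
  finally show "(cmod (1 - cis t))\<^sup>2 = (2 * sin (t / 2))\<^sup>2" .
  show "0 \<le> 2 * sin (t / 2)" using assms by (auto intro!: sin_ge_zero)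
qed simp

lemma set_integrable_powr_from_0:
  fixes q c :: real
  assumes "0 \<le> q" "q < 1" shows "set_integrable lborel {0..c} (\<lambda>t. t powr (- q))"
proof (cases "0 \<le> c")
  case True
  have "(\<lambda>t. t powr (- q)) integrable_on {0..c}"
    using has_integral_powr_from_0[of "- q" c] assms True by (auto simp: integrable_on_def)
  then have "(\<lambda>t. t powr (- q)) absolutely_integrable_on {0..c}"
    by (intro nonnegative_absolutely_integrable_1) auto
  then show ?thesis
    by (simp add: absolutely_integrable_on_def set_integrable_def integrable_completion)
qed (simp add: set_integrable_def)

text \<open>
  On the circle \<open>|1 - e^(i t)| = 2 sin (t / 2)\<close> is at least \<open>2 / pi\<close> times the distance of \<open>t\<close> from the
  nearer end of \<open>[0, 2 pi]\<close>.
\<close>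

lemma integrable_singularity:
  assumes q: "0 \<le> q" "q < 1"
  shows "integrable circle_measure (\<lambda>\<zeta>. cmod (1 - \<zeta>) powr (- q))"
proof -
  have [measurable]: "(\<lambda>\<zeta>. \<zeta>) \<in> borel_measurable circle_measure"
    by (intro continuous_on_sphere_measurable continuous_intros)
  have m: "(\<lambda>\<zeta>. cmod (1 - \<zeta>) powr (- q)) \<in> borel_measurable circle_measure" by measurable
  have i1: "integrable lborel (\<lambda>t. indicator {0..2 * pi} t *\<^sub>R t powr (- q))"
    using set_integrable_powr_from_0[OF q, of "2 * pi"] by (simp add: set_integrable_def)
  have "integrable lborel (\<lambda>t. indicator {0..2 * pi} (2 * pi + (-1) * t) *\<^sub>R (2 * pi + (-1) * t) powr (- q))"
    by (rule lborel_integrable_real_affine[OF i1]) simp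
  moreover have "indicator {0..2 * pi} (2 * pi + (-1) * t) = (indicator {0..2 * pi} t :: real)" for t
    by (auto simp: indicator_def)
  ultimately have i2: "integrable lborel (\<lambda>t. indicator {0..2 * pi} t *\<^sub>R (2 * pi - t) powr (- q))" by simp
  have i3: "integrable lborel (\<lambda>t. (2 / pi) powr (- q) * (indicator {0..2 * pi} t *\<^sub>R t powr (- q)
      + indicator {0..2 * pi} t *\<^sub>R (2 * pi - t) powr (- q)))"
    by (intro integrable_mult_right Bochner_Integration.integrable_add i1 i2)
  have lower: "2 / pi * t \<le> 2 * sin (t / 2)" if "0 \<le> t" "t \<le> pi" for t
    using sin_ge_linear[of "pi / 2" "t / 2"] that by (simp add: field_simps)
  show ?thesis
    unfolding integrable_circle_measure_iff[OF m] set_integrable_def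
  proof (rule Bochner_Integration.integrable_bound[OF i3])
    have [measurable]: "cis \<in> borel_measurable borel" by (intro borel_measurable_continuous_onI continuous_intros)
    show "(\<lambda>t. indicator {0..2 * pi} t *\<^sub>R cmod (1 - cis t) powr (- q)) \<in> borel_measurable lborel" by measurable
    show "AE t in lborel. norm (indicator {0..2 * pi} t *\<^sub>R cmod (1 - cis t) powr (- q))
      \<le> norm ((2 / pi) powr (- q) * (indicator {0..2 * pi} t *\<^sub>R t powr (- q) + indicator {0..2 * pi} t *\<^sub>R (2 * pi - t) powr (- q)))"
    proof (rule AE_I2)
      fix t :: real
      have "cmod (1 - cis t) powr (- q) \<le> (2 / pi) powr (- q) * (t powr (- q) + (2 * pi - t) powr (- q))"
        if t: "t \<in> {0..2 * pi}"
      proof -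
        consider "t = 0 \<or> t = 2 * pi" | "0 < t" "t \<le> pi" | "pi < t" "t < 2 * pi" using t by force
        then show ?thesis
        proof cases
          case 1
          then have "cis t = 1" by auto
          then show ?thesis by simp
        next
          case 2
          have "cmod (1 - cis t) powr (- q) \<le> (2 / pi * t) powr (- q)"
            using 2 lower[of t] cmod_one_minus_cis[of t] q by (intro powr_mono2') auto
          also have "\<dots> = (2 / pi) powr (- q) * t powr (- q)" by (rule powr_mult)
          also have "\<dots> \<le> (2 / pi) powr (- q) * (t powr (- q) + (2 * pi - t) powr (- q))" by (intro mult_left_mono) auto
          finally show ?thesis .
        next
          case 3
          have "sin (t / 2) = sin ((2 * pi - t) / 2)" by (simp add: diff_divide_distrib sin_diff)
          then have "2 / pi * (2 * pi - t) \<le> 2 * sin (t / 2)" using lower[of "2 * pi - t"] 3 by simp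
          then have "cmod (1 - cis t) powr (- q) \<le> (2 / pi * (2 * pi - t)) powr (- q)"
            using 3 cmod_one_minus_cis[of t] q by (intro powr_mono2') auto
          also have "\<dots> = (2 / pi) powr (- q) * (2 * pi - t) powr (- q)" by (rule powr_mult)
          also have "\<dots> \<le> (2 / pi) powr (- q) * (t powr (- q) + (2 * pi - t) powr (- q))" by (intro mult_left_mono) auto
          finally show ?thesis .
        qed
      qed
      then show "norm (indicator {0..2 * pi} t *\<^sub>R cmod (1 - cis t) powr (- q))
        \<le> norm ((2 / pi) powr (- q) * (indicator {0..2 * pi} t *\<^sub>R t powr (- q) + indicator {0..2 * pi} t *\<^sub>R (2 * pi - t) powr (- q)))"
        by (cases "t \<in> {0..2 * pi}") auto
    qed
  qed
qed

lemma cmod_cayley_le: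
  assumes "cmod z \<le> 1" shows "cmod (cayley z) \<le> 2 / cmod (1 - z)"
proof -
  have "cmod (1 + z) \<le> 2" using norm_triangle_ineq[of 1 z] assms by simp
  then show ?thesis by (simp add: cayley_def norm_divide divide_right_mono)
qed

text \<open>
  On the circle \<open>|cayley|\<close> behaves like \<open>2 / t\<close> at \<open>t = 0\<close>, so its \<open>q\<close>-th power is integrable for
  \<open>q < 1\<close>, and the lower bound \<open>1 / t\<close> on \<open>[0, 1]\<close> shows that the means diverge as \<open>q\<close> tends to 1.
\<close>

lemma cayley_circle_mean:
  assumes q: "0 \<le> q" "q < 1"
  shows "integrable circle_measure (\<lambda>\<zeta>. cmod (cayley \<zeta>) powr q)"
    and "1 / (2 * pi * (1 - q)) \<le> (LINT \<zeta>|circle_measure. cmod (cayley \<zeta>) powr q)"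
proof -
  have [measurable]: "(\<lambda>\<zeta>. \<zeta>) \<in> borel_measurable circle_measure"
    by (intro continuous_on_sphere_measurable continuous_intros)
  have m: "(\<lambda>\<zeta>. cmod (cayley \<zeta>) powr q) \<in> borel_measurable circle_measure" unfolding cayley_def by measurable
  show i: "integrable circle_measure (\<lambda>\<zeta>. cmod (cayley \<zeta>) powr q)"
  proof (rule Bochner_Integration.integrable_bound[OF integrable_mult_right[OF integrable_singularity[OF q], of "2 powr q"] m])
    show "AE \<zeta> in circle_measure. norm (cmod (cayley \<zeta>) powr q) \<le> norm (2 powr q * cmod (1 - \<zeta>) powr (- q))"
    proof (rule AE_I2)
      fix \<zeta> assume "\<zeta> \<in> space circle_measure"
      then have "cmod (cayley \<zeta>) powr q \<le> (2 / cmod (1 - \<zeta>)) powr q"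
        using q by (intro powr_mono2 cmod_cayley_le) (auto simp: space_circle_measure)
      also have "\<dots> = 2 powr q * cmod (1 - \<zeta>) powr (- q)" unfolding powr_divide powr_minus by (simp add: field_simps)
      finally show "norm (cmod (cayley \<zeta>) powr q) \<le> norm (2 powr q * cmod (1 - \<zeta>) powr (- q))" by simp
    qed
  qed
  have a: "(\<lambda>t. cmod (cayley (cis t)) powr q) integrable_on {0..2 * pi}"
    using integral_circle_measure(2)[OF i] by (simp add: absolutely_integrable_on_def)
  have h: "((\<lambda>t. t powr (- q)) has_integral (1 / (1 - q))) {0..1}"
    using has_integral_powr_from_0[of "- q" 1] q by simp
  have "1 / (1 - q) \<le> integral {0..1} (\<lambda>t. cmod (cayley (cis t)) powr q)"
  proof (rule has_integral_le[OF h])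
    have sub: "(\<lambda>t. cmod (cayley (cis t)) powr q) integrable_on {0..1}"
      by (rule integrable_on_subinterval[OF a]) (use pi_ge_two in auto)
    then show "((\<lambda>t. cmod (cayley (cis t)) powr q) has_integral integral {0..1} (\<lambda>t. cmod (cayley (cis t)) powr q)) {0..1}"
      by (rule integrable_integral)
    fix t :: real assume t: "t \<in> {0..1}"
    show "t powr (- q) \<le> cmod (cayley (cis t)) powr q"
    proof (cases "t = 0")
      case False
      then have t: "0 < t" "t \<le> 1" using t by auto
      have s: "0 < 2 * sin (t / 2)" "2 * sin (t / 2) \<le> t"
        using t pi_ge_two sin_gt_zero[of "t / 2"] sin_x_le_x[of "t / 2"] by auto
      have D: "cmod (1 - cis t) = 2 * sin (t / 2)" using cmod_one_minus_cis[of t] t pi_ge_two by simp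
      have "1 \<le> 1 + cos t" using t pi_ge_two by (simp add: cos_ge_zero)
      also have "\<dots> = Re (1 + cis t)" by simp
      also have "\<dots> \<le> cmod (1 + cis t)" by (rule complex_Re_le_cmod)
      finally have "1 / t \<le> cmod (1 + cis t) / (2 * sin (t / 2))" using s t by (intro frac_le) auto
      then have "1 / t \<le> cmod (cayley (cis t))" by (simp add: cayley_def norm_divide D)
      then have "(1 / t) powr q \<le> cmod (cayley (cis t)) powr q" using q t by (intro powr_mono2) auto
      then show ?thesis using t by (simp add: powr_divide powr_minus_divide)
    qed simp
  qed
  also have "\<dots> \<le> integral {0..2 * pi} (\<lambda>t. cmod (cayley (cis t)) powr q)"
    using a pi_ge_two by (intro integral_subset_le integrable_on_subinterval[OF a]) auto
  finally have "1 / (1 - q) / (2 * pi) \<le> integral {0..2 * pi} (\<lambda>t. cmod (cayley (cis t)) powr q) / (2 * pi)"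
    by (intro divide_right_mono) auto
  also have "\<dots> = (LINT \<zeta>|circle_measure. cmod (cayley \<zeta>) powr q)"
    by (simp add: integral_circle_measure(1)[OF i])
  finally show "1 / (2 * pi * (1 - q)) \<le> (LINT \<zeta>|circle_measure. cmod (cayley \<zeta>) powr q)"
    by (simp add: mult.commute)
qed

lemma hp_space_of_bound:
  assumes p: "1 < p" and g: "g holomorphic_on ball 0 1" and h: "h holomorphic_on ball 0 1"
    and M: "\<And>r. 0 < r \<Longrightarrow> r < 1 \<Longrightarrow>
       (LINT \<zeta>|circle_measure. cmod (g (of_real r * \<zeta>) + cnj (h (of_real r * \<zeta>))) powr p) \<le> M"
  shows "(\<lambda>z. g z + cnj (h z)) \<in> hp_space p"
proof -
  have "hp_norm p (\<lambda>z. g z + cnj (h z)) \<le> ereal (M powr (1 / p))"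
    unfolding hp_norm_def
  proof (rule SUP_least)
    fix r :: real assume "r \<in> {0<..<1}"
    then have "(LINT \<zeta>|circle_measure. cmod (g (of_real r * \<zeta>) + cnj (h (of_real r * \<zeta>))) powr p) \<le> M"
      using M by auto
    then have "(LINT \<zeta>|circle_measure. cmod (g (of_real r * \<zeta>) + cnj (h (of_real r * \<zeta>))) powr p) powr (1 / p) \<le> M powr (1 / p)"
      using p by (intro powr_mono2) auto
    then show "ereal ((LINT \<zeta>|circle_measure. cmod (g (of_real r * \<zeta>) + cnj (h (of_real r * \<zeta>))) powr p) powr (1 / p)) \<le> ereal (M powr (1 / p))"
      by simp
  qed
  also have "\<dots> < \<infinity>" by simp
  finally show ?thesis unfolding hp_space_def using g h by blast
qed

text \<open>
  Let \<open>G\<close> be the power \<open>cayley_power \<gamma>\<close>. The inequality is applied to \<open>G - 1\<close> and \<open>\<plusminus> (G - 1)\<close>; the sum is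
  \<open>2 Re (G - 1)\<close> for \<open>p \<le> 2\<close> and \<open>2 \<i> Im G\<close> for \<open>p > 2\<close>. On the circle \<open>|Re G|\<close> or \<open>|Im G|\<close>, respectively, is the
  constant multiple \<open>\<kappa>\<close> of \<open>|G|\<close>, so that, apart from the subtracted 1, both sides are multiples of the
  mean \<open>I\<close> of \<open>|G|^p\<close>. The subtraction makes the product vanish at 0 and costs the factors \<open>1 + \<eta>\<close> and
  the terms with \<open>L\<close>, which do not depend on \<open>\<gamma>\<close>.
\<close>

lemma sharpness_estimate:
  fixes p C \<eta> \<gamma> :: real
  defines "\<kappa> \<equiv> (if p \<le> 2 then cos (\<gamma> * pi / 2) else sin (\<gamma> * pi / 2))"
  defines "I \<equiv> (LINT \<zeta>|circle_measure. cmod (cayley \<zeta>) powr (\<gamma> * p))"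
  defines "L \<equiv> (1 + 1 / \<eta>) powr p"
  assumes p: "1 < p" and C: "0 \<le> C" and \<eta>: "0 < \<eta>" and \<gamma>: "0 < \<gamma>" "\<gamma> * p < 1"
    and ineq: "\<And>g h. g holomorphic_on ball 0 1 \<Longrightarrow> h holomorphic_on ball 0 1 \<Longrightarrow>
        (\<lambda>z. g z + cnj (h z)) \<in> hp_space p \<Longrightarrow> Re (g 0 * h 0) = 0 \<Longrightarrow>
        (LINT \<zeta>|circle_measure. ((cmod (radial_limit g \<zeta>))\<^sup>2 + (cmod (radial_limit h \<zeta>))\<^sup>2) powr (p / 2)) powr (1 / p)
        \<le> C * (LINT \<zeta>|circle_measure. cmod (radial_limit g \<zeta> + cnj (radial_limit h \<zeta>)) powr p) powr (1 / p)"
  shows "(2 powr (p / 2) - (1 + \<eta>) powr p * (C powr p * ((1 + \<eta>) powr p * (2 * \<kappa>) powr p))) * I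
    \<le> 2 powr (p / 2) * L + (1 + \<eta>) powr p * (C powr p * (L * 2 powr p))"
proof -
  define \<sigma> :: real where "\<sigma> = (if p \<le> 2 then 1 else - 1)"
  have \<sigma>: "\<bar>\<sigma>\<bar> = 1" by (simp add: \<sigma>_def)
  define B where "B = cayley_power \<gamma>"
  define g where "g z = B z - 1" for z
  define h where "h z = of_real \<sigma> * (B z - 1)" for z
  have Bh: "B holomorphic_on ball 0 1" unfolding B_def by (rule holomorphic_cayley_power)
  have gh: "g holomorphic_on ball 0 1" "h holomorphic_on ball 0 1"
    unfolding g_def[abs_def] h_def[abs_def] by (intro holomorphic_intros Bh)+
  have "\<gamma> * 1 \<le> \<gamma> * p" using \<gamma> p by (intro mult_left_mono) auto
  then have \<gamma>1: "0 \<le> \<gamma>" "\<gamma> \<le> 1" using \<gamma> by linarith+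
  have q: "0 \<le> \<gamma> * p" "\<gamma> * p < 1" using \<gamma> p by auto
  have f: "(\<lambda>z. g z + cnj (h z)) \<in> hp_space p"
  proof (rule hp_space_of_bound[OF p gh])
    fix r :: real assume r: "0 < r" "r < 1"
    define m where "m \<zeta> = 2 powr p * (2 powr p * (4 powr (\<gamma> * p) * cmod (1 - \<zeta>) powr (- (\<gamma> * p)))) + 2 powr p * 2 powr p" for \<zeta>
    have im: "integrable circle_measure m" unfolding m_def
      by (intro Bochner_Integration.integrable_add integrable_mult_right integrable_singularity q) simp
    show "(LINT \<zeta>|circle_measure. cmod (g (of_real r * \<zeta>) + cnj (h (of_real r * \<zeta>))) powr p) \<le> integral\<^sup>L circle_measure m"
    proof (rule integral_mono_AE[OF _ im])
      show "integrable circle_measure (\<lambda>\<zeta>. cmod (g (of_real r * \<zeta>) + cnj (h (of_real r * \<zeta>))) powr p)"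
        using p r
        by (intro continuous_on_sphere_integrable continuous_on_powr' continuous_intros
            continuous_on_sphere_dilate[OF holomorphic_on_imp_continuous_on[OF gh(1)]]
            continuous_on_sphere_dilate[OF holomorphic_on_imp_continuous_on[OF gh(2)]]) auto
      show "AE \<zeta> in circle_measure. cmod (g (of_real r * \<zeta>) + cnj (h (of_real r * \<zeta>))) powr p \<le> m \<zeta>"
        using AE_circle_not_real
      proof eventually_elim
        case (elim \<zeta>)
        define z where "z = of_real r * \<zeta>"
        have z: "cmod z = r" using elim r by (simp add: z_def norm_mult)
        have "cmod (1 - \<zeta>) \<le> cmod (1 - z) + cmod (z - \<zeta>)" using norm_triangle_ineq[of "1 - z" "z - \<zeta>"] by simp
        also have "cmod (z - \<zeta>) = 1 - r"
        proof -
          have "z - \<zeta> = of_real (r - 1) * \<zeta>" by (simp add: z_def algebra_simps)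
          then have "cmod (z - \<zeta>) = \<bar>r - 1\<bar> * cmod \<zeta>" by (simp only: norm_mult norm_of_real)
          then show ?thesis using elim r by simp
        qed
        also have "1 - r \<le> cmod (1 - z)" using norm_triangle_ineq2[of 1 z] z by simp
        finally have d: "cmod (1 - \<zeta>) \<le> 2 * cmod (1 - z)" by simp
        have nz: "0 < cmod (1 - \<zeta>)" using elim by auto
        have "cmod (cayley z) \<le> 2 / cmod (1 - z)" using z r by (intro cmod_cayley_le) simp
        also have "\<dots> \<le> 4 / cmod (1 - \<zeta>)" using d nz by (simp add: divide_simps)
        finally have cb: "cmod (cayley z) \<le> 4 / cmod (1 - \<zeta>)" .
        have "cmod (B z) powr p = cmod (cayley z) powr (\<gamma> * p)"
          unfolding B_def using cayley_disk(2)[of z] z r by (simp add: cmod_cayley_power powr_powr)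
        also have "\<dots> \<le> (4 / cmod (1 - \<zeta>)) powr (\<gamma> * p)" using cb q by (intro powr_mono2) auto
        also have "\<dots> = 4 powr (\<gamma> * p) * cmod (1 - \<zeta>) powr (- (\<gamma> * p))"
          unfolding powr_divide powr_minus by (simp add: field_simps)
        finally have Bb: "cmod (B z) powr p \<le> 4 powr (\<gamma> * p) * cmod (1 - \<zeta>) powr (- (\<gamma> * p))" .
        have "cmod (g z + cnj (h z)) \<le> cmod (g z) + cmod (h z)" using norm_triangle_ineq[of "g z" "cnj (h z)"] by simp
        also have "\<dots> = 2 * cmod (B z + - 1)" using \<sigma> by (simp add: g_def h_def norm_mult)
        finally have "cmod (g z + cnj (h z)) powr p \<le> (2 * cmod (B z + - 1)) powr p" using p by (intro powr_mono2) auto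
        also have "\<dots> = 2 powr p * cmod (B z + - 1) powr p" by (rule powr_mult)
        also have "\<dots> \<le> 2 powr p * (2 powr p * cmod (B z) powr p + 2 powr p * cmod (- 1) powr p)"
          using p by (intro mult_left_mono norm_add_powr_le) auto
        also have "\<dots> \<le> m \<zeta>" unfolding m_def distrib_left
          using Bb by (intro add_mono mult_left_mono) auto
        finally show ?case by (simp add: z_def)
      qed
    qed
  qed
  define A where "A = (LINT \<zeta>|circle_measure. ((cmod (radial_limit g \<zeta>))\<^sup>2 + (cmod (radial_limit h \<zeta>))\<^sup>2) powr (p / 2))"
  define D where "D = (LINT \<zeta>|circle_measure. cmod (radial_limit g \<zeta> + cnj (radial_limit h \<zeta>)) powr p)"
  note iA = boundary_values_of_hp(2)[OF p gh f] and iD = boundary_values_of_hp(3)[OF p gh f]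
  note iI = cayley_circle_mean(1)[OF q]
  have g0: "Re (g 0 * h 0) = 0" by (simp add: g_def h_def B_def cayley_power_def cayley_def)
  have AD: "A \<le> C powr p * D"
  proof -
    have A0: "0 \<le> A" "0 \<le> D" unfolding A_def D_def by (auto intro!: integral_nonneg_AE)
    have "A powr (1 / p) \<le> C * D powr (1 / p)" unfolding A_def D_def by (rule ineq[OF gh f g0])
    then have "(A powr (1 / p)) powr p \<le> (C * D powr (1 / p)) powr p" using p by (intro powr_mono2) auto
    then show ?thesis using A0 p by (simp add: powr_powr powr_mult)
  qed
  have bdry: "AE \<zeta> in circle_measure. radial_limit g \<zeta> = B \<zeta> - 1 \<and> radial_limit h \<zeta> = of_real \<sigma> * (B \<zeta> - 1) \<and>
     cmod (B \<zeta>) = cmod (cayley \<zeta>) powr \<gamma> \<and> cmod (B \<zeta> + of_real \<sigma> * cnj (B \<zeta>)) = 2 * \<kappa> * cmod (B \<zeta>)"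
    using AE_circle_not_real
  proof eventually_elim
    case (elim \<zeta>)
    have l: "((\<lambda>r. B (of_real r * \<zeta>)) \<longlongrightarrow> B \<zeta>) (at_left 1)"
      unfolding B_def using elim by (intro radial_limit_cayley_power) auto
    have "radial_limit g \<zeta> = B \<zeta> - 1" "radial_limit h \<zeta> = of_real \<sigma> * (B \<zeta> - 1)"
      unfolding g_def[abs_def] h_def[abs_def] by (rule radial_limit_eqI(2); intro tendsto_intros l)+
    moreover have cb: "cmod (B \<zeta>) = cmod (cayley \<zeta>) powr \<gamma>"
      unfolding B_def using elim cayley_circle(2)[of \<zeta>] by (intro cmod_cayley_power) auto
    moreover have "cmod (B \<zeta> + of_real \<sigma> * cnj (B \<zeta>)) = 2 * \<kappa> * cmod (B \<zeta>)"
    proof (cases "p \<le> 2")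
      case True
      have "B \<zeta> + of_real \<sigma> * cnj (B \<zeta>) = of_real (2 * Re (B \<zeta>))"
        using True by (simp add: \<sigma>_def complex_add_cnj)
      then have "cmod (B \<zeta> + of_real \<sigma> * cnj (B \<zeta>)) = 2 * \<bar>Re (B \<zeta>)\<bar>" by (simp only: norm_of_real abs_mult abs_numeral)
      then show ?thesis
        using True elim cayley_power_circle(1)[of \<zeta>, OF _ _ _ \<gamma>1] unfolding cb by (simp add: B_def \<kappa>_def)
    next
      case False
      have "B \<zeta> + of_real \<sigma> * cnj (B \<zeta>) = of_real (2 * Im (B \<zeta>)) * \<i>"
        using False by (simp add: \<sigma>_def complex_diff_cnj)
      then have "cmod (B \<zeta> + of_real \<sigma> * cnj (B \<zeta>)) = 2 * \<bar>Im (B \<zeta>)\<bar>" by (simp only: norm_mult norm_of_real abs_mult norm_ii abs_numeral mult_1_right)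
      then show ?thesis
        using False elim cayley_power_circle(2)[of \<zeta>, OF _ _ _ \<gamma>1] unfolding cb by (simp add: B_def \<kappa>_def)
    qed
    ultimately show ?case by blast
  qed
  have \<kappa>0: "0 \<le> \<kappa>"
  proof -
    have "0 \<le> \<gamma> * pi / 2" "\<gamma> * pi / 2 \<le> pi / 2" using \<gamma>1 by auto
    moreover from this have "- (pi / 2) \<le> \<gamma> * pi / 2" "\<gamma> * pi / 2 \<le> pi" using pi_gt_zero by linarith+
    ultimately show ?thesis unfolding \<kappa>_def using cos_ge_zero[of "\<gamma> * pi / 2"] sin_ge_zero[of "\<gamma> * pi / 2"] by simp
  qed
  have one: "measure circle_measure (space circle_measure) = 1"
    by (simp add: space_circle_measure measure_circle_measure)
  have low: "2 powr (p / 2) * I \<le> (1 + \<eta>) powr p * A + 2 powr (p / 2) * L"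
  proof -
    have "(LINT \<zeta>|circle_measure. 2 powr (p / 2) * cmod (cayley \<zeta>) powr (\<gamma> * p))
      \<le> (LINT \<zeta>|circle_measure. (1 + \<eta>) powr p * ((cmod (radial_limit g \<zeta>))\<^sup>2 + (cmod (radial_limit h \<zeta>))\<^sup>2) powr (p / 2) + 2 powr (p / 2) * L)"
    proof (rule integral_mono_AE)
      show "AE \<zeta> in circle_measure. 2 powr (p / 2) * cmod (cayley \<zeta>) powr (\<gamma> * p)
        \<le> (1 + \<eta>) powr p * ((cmod (radial_limit g \<zeta>))\<^sup>2 + (cmod (radial_limit h \<zeta>))\<^sup>2) powr (p / 2) + 2 powr (p / 2) * L"
        using bdry
      proof eventually_elim
        case (elim \<zeta>)
        define x where "x = cmod (B \<zeta> - 1)"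
        have "cmod (cayley \<zeta>) powr (\<gamma> * p) = cmod (B \<zeta>) powr p" using elim by (simp add: powr_powr)
        also have "\<dots> \<le> (x + 1) powr p"
          unfolding x_def using p norm_triangle_ineq[of "B \<zeta> - 1" 1] by (intro powr_mono2) auto
        also have "\<dots> \<le> (1 + \<eta>) powr p * x powr p + (1 + 1 / \<eta>) powr p * 1 powr p"
          using p \<eta> by (intro powr_add_le_weighted) (auto simp: x_def)
        finally have b: "cmod (cayley \<zeta>) powr (\<gamma> * p) \<le> (1 + \<eta>) powr p * x powr p + L" by (simp add: L_def)
        have "(cmod (radial_limit g \<zeta>))\<^sup>2 + (cmod (radial_limit h \<zeta>))\<^sup>2 = 2 * x\<^sup>2"
          using elim \<sigma> by (simp add: x_def norm_mult power_mult_distrib)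
        then have "((cmod (radial_limit g \<zeta>))\<^sup>2 + (cmod (radial_limit h \<zeta>))\<^sup>2) powr (p / 2) = 2 powr (p / 2) * (x\<^sup>2) powr (p / 2)"
          by (simp only: powr_mult)
        also have "(x\<^sup>2) powr (p / 2) = x powr p"
        proof (cases "x = 0")
          case False
          then have "x\<^sup>2 = x powr 2" by (simp add: x_def)
          then show ?thesis by (simp only: powr_powr) simp
        qed (use p in simp)
        finally have e: "((cmod (radial_limit g \<zeta>))\<^sup>2 + (cmod (radial_limit h \<zeta>))\<^sup>2) powr (p / 2) = 2 powr (p / 2) * x powr p" .
        show ?case unfolding e using mult_left_mono[OF b, of "2 powr (p / 2)"] by (simp add: algebra_simps)
      qed
    qed (intro integrable_mult_right iI Bochner_Integration.integrable_add iA; simp)+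
    also have "\<dots> = (1 + \<eta>) powr p * A + 2 powr (p / 2) * L"
      using iA by (subst Bochner_Integration.integral_add) (simp_all add: A_def one)
    finally show ?thesis by (simp add: I_def)
  qed
  have up: "D \<le> (1 + \<eta>) powr p * (2 * \<kappa>) powr p * I + L * 2 powr p"
  proof -
    have "D \<le> (LINT \<zeta>|circle_measure. (1 + \<eta>) powr p * (2 * \<kappa>) powr p * cmod (cayley \<zeta>) powr (\<gamma> * p) + L * 2 powr p)"
      unfolding D_def
    proof (rule integral_mono_AE[OF iD])
      show "AE \<zeta> in circle_measure. cmod (radial_limit g \<zeta> + cnj (radial_limit h \<zeta>)) powr p
        \<le> (1 + \<eta>) powr p * (2 * \<kappa>) powr p * cmod (cayley \<zeta>) powr (\<gamma> * p) + L * 2 powr p"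
        using bdry
      proof eventually_elim
        case (elim \<zeta>)
        have "radial_limit g \<zeta> + cnj (radial_limit h \<zeta>) = (B \<zeta> + of_real \<sigma> * cnj (B \<zeta>)) - of_real (1 + \<sigma>)"
        proof -
          have e: "radial_limit g \<zeta> = B \<zeta> - 1" "radial_limit h \<zeta> = of_real \<sigma> * (B \<zeta> - 1)"
            using elim by blast+
          show ?thesis unfolding e by (simp add: algebra_simps)
        qed
        then have "cmod (radial_limit g \<zeta> + cnj (radial_limit h \<zeta>)) \<le> cmod (B \<zeta> + of_real \<sigma> * cnj (B \<zeta>)) + cmod (of_real (1 + \<sigma>))"
          by (simp only: norm_triangle_ineq4)
        also have "cmod (B \<zeta> + of_real \<sigma> * cnj (B \<zeta>)) = 2 * \<kappa> * cmod (B \<zeta>)" using elim by blast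
        also have "cmod (of_real (1 + \<sigma>)) \<le> 2" by (simp only: norm_of_real) (simp add: \<sigma>_def)
        finally have "cmod (radial_limit g \<zeta> + cnj (radial_limit h \<zeta>)) powr p \<le> (2 * \<kappa> * cmod (B \<zeta>) + 2) powr p"
          using p by (intro powr_mono2) auto
        also have "\<dots> \<le> (1 + \<eta>) powr p * (2 * \<kappa> * cmod (B \<zeta>)) powr p + L * 2 powr p"
          unfolding L_def using p \<eta> \<kappa>0 by (intro powr_add_le_weighted) auto
        also have "(2 * \<kappa> * cmod (B \<zeta>)) powr p = (2 * \<kappa>) powr p * cmod (B \<zeta>) powr p" by (rule powr_mult)
        also have "cmod (B \<zeta>) powr p = cmod (cayley \<zeta>) powr (\<gamma> * p)" using elim by (simp add: powr_powr)
        finally show ?case by (simp only: mult.assoc)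
      qed
    qed (intro integrable_mult_right iI Bochner_Integration.integrable_add; simp)
    also have "\<dots> = (1 + \<eta>) powr p * (2 * \<kappa>) powr p * I + L * 2 powr p"
      using iI by (subst Bochner_Integration.integral_add) (simp_all add: I_def one)
    finally show ?thesis .
  qed
  have "2 powr (p / 2) * I \<le> (1 + \<eta>) powr p * (C powr p * ((1 + \<eta>) powr p * (2 * \<kappa>) powr p * I + L * 2 powr p)) + 2 powr (p / 2) * L"
  proof -
    have "A \<le> C powr p * ((1 + \<eta>) powr p * (2 * \<kappa>) powr p * I + L * 2 powr p)"
      using AD mult_left_mono[OF up, of "C powr p"] by simp
    then have "(1 + \<eta>) powr p * A \<le> (1 + \<eta>) powr p * (C powr p * ((1 + \<eta>) powr p * (2 * \<kappa>) powr p * I + L * 2 powr p))"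
      by (intro mult_left_mono) auto
    then show ?thesis using low by linarith
  qed
  then show ?thesis by (simp add: algebra_simps)
qed

lemma one_minus_abs_cos:
  fixes p :: real
  defines "\<kappa> \<equiv> (if p \<le> 2 then cos (pi / (2 * p)) else sin (pi / (2 * p)))"
  assumes p: "1 < p"
  shows "0 < \<kappa>" "1 - \<bar>cos (pi / p)\<bar> = 2 * \<kappa>\<^sup>2"
proof -
  have a: "0 < pi / (2 * p)" "pi / (2 * p) < pi / 2" using p by (auto simp: field_simps)
  have d: "pi / p = 2 * (pi / (2 * p))" by simp
  show "0 < \<kappa>"
  proof (cases "p \<le> 2")
    case True
    have "- (pi / 2) < pi / (2 * p)" using a pi_gt_zero by linarith
    from cos_gt_zero_pi[OF this a(2)] show ?thesis using True unfolding \<kappa>_def by simp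
  next
    case False
    have "pi / (2 * p) < pi" using a pi_gt_zero by linarith
    from sin_gt_zero[OF a(1) this] show ?thesis using False unfolding \<kappa>_def by simp
  qed
  show "1 - \<bar>cos (pi / p)\<bar> = 2 * \<kappa>\<^sup>2"
  proof (cases "p \<le> 2")
    case True
    have "pi / 2 \<le> pi / p" using True p by (intro divide_left_mono) auto
    moreover have "pi / p \<le> pi" using p by (simp add: divide_le_eq)
    ultimately have "cos (pi / p) \<le> cos (pi / 2)" by (intro cos_monotone_0_pi_le) auto
    then have "1 - \<bar>cos (pi / p)\<bar> = 1 + cos (pi / p)" by simp
    also have "\<dots> = 2 * (cos (pi / (2 * p)))\<^sup>2" unfolding d cos_double_cos by simp
    finally show ?thesis using True by (simp add: \<kappa>_def)
  next
    case False
    have "pi / p \<le> pi / 2" using False by (intro divide_left_mono) auto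
    moreover have "0 \<le> pi / p" using p by simp
    moreover have "- (pi / 2) \<le> pi / p" using \<open>0 \<le> pi / p\<close> pi_gt_zero by linarith
    ultimately have "0 \<le> cos (pi / p)" by (intro cos_ge_zero)
    then have "1 - \<bar>cos (pi / p)\<bar> = 1 - cos (pi / p)" by simp
    also have "\<dots> = 2 * (sin (pi / (2 * p)))\<^sup>2" unfolding d cos_double_sin by simp
    finally show ?thesis using False by (simp add: \<kappa>_def)
  qed
qed

text \<open>
  As \<open>\<gamma>\<close> increases to \<open>1 / p\<close>, the mean \<open>I\<close> tends to infinity, while the right-hand side of
  \<open>sharpness_estimate\<close> stays fixed. For a constant \<open>C\<close> that is too small and a small \<open>\<eta>\<close>, the factor in
  front of \<open>I\<close> has a positive limit, a contradiction.
\<close>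

lemma riesz_constant_sharp:
  fixes p C :: real
  assumes p: "1 < p" and C: "C < 1 / (1 - \<bar>cos (pi / p)\<bar>) powr (1 / 2)"
  shows "\<exists>g h. g holomorphic_on ball 0 1 \<and> h holomorphic_on ball 0 1 \<and>
     (\<lambda>z. g z + cnj (h z)) \<in> hp_space p \<and> Re (g 0 * h 0) = 0 \<and>
     C * (LINT \<zeta>|circle_measure. cmod (radial_limit g \<zeta> + cnj (radial_limit h \<zeta>)) powr p) powr (1 / p)
     < (LINT \<zeta>|circle_measure. ((cmod (radial_limit g \<zeta>))\<^sup>2 + (cmod (radial_limit h \<zeta>))\<^sup>2) powr (p / 2)) powr (1 / p)"
proof (rule ccontr)
  assume contra: "\<not> ?thesis"
  \<comment> \<open>A negative constant may be raised to 0, which makes the powers of the constant monotone.\<close>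
  define C' where "C' = max C 0"
  have ineq: "(LINT \<zeta>|circle_measure. ((cmod (radial_limit g \<zeta>))\<^sup>2 + (cmod (radial_limit h \<zeta>))\<^sup>2) powr (p / 2)) powr (1 / p)
        \<le> C' * (LINT \<zeta>|circle_measure. cmod (radial_limit g \<zeta> + cnj (radial_limit h \<zeta>)) powr p) powr (1 / p)"
    if "g holomorphic_on ball 0 1" "h holomorphic_on ball 0 1" "(\<lambda>z. g z + cnj (h z)) \<in> hp_space p" "Re (g 0 * h 0) = 0" for g h
  proof -
    have "(LINT \<zeta>|circle_measure. ((cmod (radial_limit g \<zeta>))\<^sup>2 + (cmod (radial_limit h \<zeta>))\<^sup>2) powr (p / 2)) powr (1 / p)
        \<le> C * (LINT \<zeta>|circle_measure. cmod (radial_limit g \<zeta> + cnj (radial_limit h \<zeta>)) powr p) powr (1 / p)"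
      using contra that not_le by blast
    also have "\<dots> \<le> C' * (LINT \<zeta>|circle_measure. cmod (radial_limit g \<zeta> + cnj (radial_limit h \<zeta>)) powr p) powr (1 / p)"
      unfolding C'_def by (intro mult_right_mono) auto
    finally show ?thesis .
  qed
  define \<kappa> where "\<kappa> \<gamma> = (if p \<le> 2 then cos (\<gamma> * pi / 2) else sin (\<gamma> * pi / 2))" for \<gamma>
  define \<kappa>0 where "\<kappa>0 = \<kappa> (1 / p)"
  have "1 / p * pi / 2 = pi / (2 * p)" by simp
  then have "\<kappa>0 = (if p \<le> 2 then cos (pi / (2 * p)) else sin (pi / (2 * p)))"
    by (simp only: \<kappa>0_def \<kappa>_def)
  then have \<kappa>0: "0 < \<kappa>0" "1 - \<bar>cos (pi / p)\<bar> = 2 * \<kappa>0\<^sup>2"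
    using one_minus_abs_cos[OF p] by simp_all
  have "(1 - \<bar>cos (pi / p)\<bar>) powr (1 / 2) = sqrt 2 * \<kappa>0"
    unfolding \<kappa>0(2) using \<kappa>0(1) by (simp add: powr_half_sqrt real_sqrt_mult)
  then have "C' < 1 / (sqrt 2 * \<kappa>0)" using C \<kappa>0(1) by (simp add: C'_def)
  then have "C' * (sqrt 2 * \<kappa>0) < 1" using \<kappa>0(1) by (simp add: less_divide_eq)
  then have "sqrt 2 * (C' * (sqrt 2 * \<kappa>0)) < sqrt 2 * 1" by (intro mult_strict_left_mono) auto
  moreover have "sqrt 2 * (C' * (sqrt 2 * \<kappa>0)) = C' * (2 * \<kappa>0)"
    using real_sqrt_mult_self[of 2] by (simp add: algebra_simps)
  ultimately have "C' * (2 * \<kappa>0) < 2 powr (1 / 2)" by (simp add: powr_half_sqrt)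
  then have "(C' * (2 * \<kappa>0)) powr p < (2 powr (1 / 2)) powr p"
    using p \<kappa>0(1) by (intro powr_less_mono2) (auto simp: C'_def)
  then have strict: "C' powr p * (2 * \<kappa>0) powr p < 2 powr (p / 2)" by (simp only: powr_mult powr_powr) (simp add: mult.commute)
  have "((\<lambda>\<eta>. (1 + \<eta>) powr p * (C' powr p * ((1 + \<eta>) powr p * (2 * \<kappa>0) powr p))) \<longlongrightarrow>
     (1 + 0) powr p * (C' powr p * ((1 + 0) powr p * (2 * \<kappa>0) powr p))) (at_right 0)"
    by (intro tendsto_intros) auto
  then have "eventually (\<lambda>\<eta>. (1 + \<eta>) powr p * (C' powr p * ((1 + \<eta>) powr p * (2 * \<kappa>0) powr p)) < 2 powr (p / 2)) (at_right 0)"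
    by (rule order_tendstoD(2)) (use strict in simp)
  moreover have "eventually (\<lambda>\<eta>::real. 0 < \<eta>) (at_right 0)" by (rule eventually_at_right_less)
  ultimately have "eventually (\<lambda>\<eta>. 0 < \<eta> \<and> (1 + \<eta>) powr p * (C' powr p * ((1 + \<eta>) powr p * (2 * \<kappa>0) powr p)) < 2 powr (p / 2)) (at_right 0)"
    by (rule eventually_conj[rotated])
  then obtain \<eta> where \<eta>: "0 < \<eta>" "(1 + \<eta>) powr p * (C' powr p * ((1 + \<eta>) powr p * (2 * \<kappa>0) powr p)) < 2 powr (p / 2)"
    using eventually_happens'[OF trivial_limit_at_right_real] by blast
  define c where "c \<gamma> = 2 powr (p / 2) - (1 + \<eta>) powr p * (C' powr p * ((1 + \<eta>) powr p * (2 * \<kappa> \<gamma>) powr p))" for \<gamma>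
  define K where "K = 2 powr (p / 2) * (1 + 1 / \<eta>) powr p + (1 + \<eta>) powr p * (C' powr p * ((1 + 1 / \<eta>) powr p * 2 powr p))"
  have "(\<kappa> \<longlongrightarrow> \<kappa>0) (at_left (1 / p))"
  proof -
    have "((\<lambda>\<gamma>. cos (\<gamma> * pi / 2)) \<longlongrightarrow> cos (1 / p * pi / 2)) (at_left (1 / p))"
      "((\<lambda>\<gamma>. sin (\<gamma> * pi / 2)) \<longlongrightarrow> sin (1 / p * pi / 2)) (at_left (1 / p))"
      by (intro tendsto_intros; simp)+
    then show ?thesis unfolding \<kappa>0_def \<kappa>_def[abs_def] by (cases "p \<le> 2") (simp_all only: if_True if_False)
  qed
  then have clim: "(c \<longlongrightarrow> c (1 / p)) (at_left (1 / p))"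
    unfolding c_def using \<kappa>0(1) by (intro tendsto_intros) (auto simp: \<kappa>0_def)
  have cpos: "0 < c (1 / p)" using \<eta>(2) by (simp add: c_def \<kappa>0_def)
  have lt: "eventually (\<lambda>\<gamma>. \<gamma> \<in> {0<..<1 / p}) (at_left (1 / p))" using p by (intro eventually_at_left_real) auto
  have "filterlim (\<lambda>\<gamma>. inverse (2 * pi * (1 - \<gamma> * p))) at_top (at_left (1 / p))"
  proof (rule filterlim_inverse_at_top)
    have "((\<lambda>\<gamma>. 2 * pi * (1 - \<gamma> * p)) \<longlongrightarrow> 2 * pi * (1 - 1 / p * p)) (at_left (1 / p))" by (intro tendsto_intros)
    then show "((\<lambda>\<gamma>. 2 * pi * (1 - \<gamma> * p)) \<longlongrightarrow> 0) (at_left (1 / p))" using p by simp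
    show "\<forall>\<^sub>F \<gamma> in at_left (1 / p). 0 < 2 * pi * (1 - \<gamma> * p)"
      using lt by eventually_elim (use p in \<open>simp add: less_divide_eq\<close>)
  qed
  from filterlim_tendsto_pos_mult_at_top[OF clim cpos this]
  have "eventually (\<lambda>\<gamma>. K < c \<gamma> * inverse (2 * pi * (1 - \<gamma> * p))) (at_left (1 / p))"
    by (simp add: filterlim_at_top_dense)
  moreover have "eventually (\<lambda>\<gamma>. 0 < c \<gamma>) (at_left (1 / p))" using order_tendstoD(1)[OF clim cpos] .
  ultimately have "eventually (\<lambda>\<gamma>. False) (at_left (1 / p))"
    using lt
  proof eventually_elim
    case (elim \<gamma>)
    have \<gamma>: "0 < \<gamma>" "\<gamma> * p < 1" using elim p by (auto simp: less_divide_eq)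
    have "c \<gamma> * inverse (2 * pi * (1 - \<gamma> * p)) \<le> c \<gamma> * (LINT \<zeta>|circle_measure. cmod (cayley \<zeta>) powr (\<gamma> * p))"
      using cayley_circle_mean(2)[of "\<gamma> * p"] \<gamma> p elim by (intro mult_left_mono) (auto simp: inverse_eq_divide)
    also have "\<dots> \<le> K"
      unfolding c_def K_def \<kappa>_def using ineq by (intro sharpness_estimate p \<eta>(1) \<gamma>) (auto simp: C'_def)
    finally show ?case using elim by simp
  qed
  then show False by (simp add: eventually_False)
qed

theorem theorem2p1:
  fixes p :: real
  assumes "1 < p"
  shows
    "(\<forall>g h. g holomorphic_on ball 0 1 \<and> h holomorphic_on ball 0 1 \<and>
        (\<lambda>z. g z + cnj (h z)) \<in> hp_space p \<longrightarrow>
        (AE \<zeta> in circle_measure. has_radial_limit g \<zeta> \<and> has_radial_limit h \<zeta>) \<and>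
        integrable circle_measure
          (\<lambda>\<zeta>. ((cmod (radial_limit g \<zeta>))\<^sup>2 + (cmod (radial_limit h \<zeta>))\<^sup>2) powr (p / 2)) \<and>
        integrable circle_measure
          (\<lambda>\<zeta>. cmod (radial_limit g \<zeta> + cnj (radial_limit h \<zeta>)) powr p))
     \<and>
     (\<forall>g h. g holomorphic_on ball 0 1 \<and> h holomorphic_on ball 0 1 \<and>
        (\<lambda>z. g z + cnj (h z)) \<in> hp_space p \<and> Re (g 0 * h 0) = 0 \<longrightarrow>
        (LINT \<zeta>|circle_measure.
           ((cmod (radial_limit g \<zeta>))\<^sup>2 + (cmod (radial_limit h \<zeta>))\<^sup>2) powr (p / 2)) powr (1 / p)
        \<le> 1 / (1 - \<bar>cos (pi / p)\<bar>) powr (1 / 2) *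
          (LINT \<zeta>|circle_measure.
             cmod (radial_limit g \<zeta> + cnj (radial_limit h \<zeta>)) powr p) powr (1 / p))
     \<and>
     (\<forall>C::real. C < 1 / (1 - \<bar>cos (pi / p)\<bar>) powr (1 / 2) \<longrightarrow>
        \<not> (\<forall>g h. g holomorphic_on ball 0 1 \<and> h holomorphic_on ball 0 1 \<and>
            (\<lambda>z. g z + cnj (h z)) \<in> hp_space p \<and> Re (g 0 * h 0) = 0 \<longrightarrow>
            (LINT \<zeta>|circle_measure.
               ((cmod (radial_limit g \<zeta>))\<^sup>2 + (cmod (radial_limit h \<zeta>))\<^sup>2) powr (p / 2)) powr (1 / p)
            \<le> C *
              (LINT \<zeta>|circle_measure.
                 cmod (radial_limit g \<zeta> + cnj (radial_limit h \<zeta>)) powr p) powr (1 / p)))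
     \<and>
     (p \<le> 3 \<longrightarrow>
       (\<forall>g h. g holomorphic_on ball 0 1 \<and> h holomorphic_on ball 0 1 \<and>
          (\<lambda>z. g z + cnj (h z)) \<in> hp_space p \<and> Re (g 0 * h 0) \<ge> 0 \<longrightarrow>
          (LINT \<zeta>|circle_measure.
             ((cmod (radial_limit g \<zeta>))\<^sup>2 + (cmod (radial_limit h \<zeta>))\<^sup>2) powr (p / 2)) powr (1 / p)
          \<le> 1 / (1 - \<bar>cos (pi / p)\<bar>) powr (1 / 2) *
            (LINT \<zeta>|circle_measure.
               cmod (radial_limit g \<zeta> + cnj (radial_limit h \<zeta>)) powr p) powr (1 / p)))"
proof -
  have ineq: "(LINT \<zeta>|circle_measure.
           ((cmod (radial_limit g \<zeta>))\<^sup>2 + (cmod (radial_limit h \<zeta>))\<^sup>2) powr (p / 2)) powr (1 / p)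
        \<le> 1 / (1 - \<bar>cos (pi / p)\<bar>) powr (1 / 2) *
          (LINT \<zeta>|circle_measure.
             cmod (radial_limit g \<zeta> + cnj (radial_limit h \<zeta>)) powr p) powr (1 / p)"
    if "g holomorphic_on ball 0 1" "h holomorphic_on ball 0 1"
      "(\<lambda>z. g z + cnj (h z)) \<in> hp_space p" "0 \<le> Re (g 0 * h 0)" for g h
  proof -
    define A where "A = (LINT \<zeta>|circle_measure. ((cmod (radial_limit g \<zeta>))\<^sup>2 + (cmod (radial_limit h \<zeta>))\<^sup>2) powr (p / 2))"
    define D where "D = (LINT \<zeta>|circle_measure. cmod (radial_limit g \<zeta> + cnj (radial_limit h \<zeta>)) powr p)"
    define d where "d = 1 - \<bar>cos (pi / p)\<bar>"
    have "0 \<le> A" unfolding A_def by (intro integral_nonneg_AE) simp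
    moreover have "A \<le> d powr (- (p / 2)) * D"
      unfolding A_def D_def d_def by (rule boundary_values_of_hp(4)[OF assms that])
    ultimately have "A powr (1 / p) \<le> (d powr (- (p / 2)) * D) powr (1 / p)"
      using assms by (intro powr_mono2) auto
    also have "\<dots> = (d powr (- (p / 2))) powr (1 / p) * D powr (1 / p)" by (rule powr_mult)
    also have "(d powr (- (p / 2))) powr (1 / p) = d powr (- (1 / 2))" using assms by (simp add: powr_powr)
    also have "\<dots> = 1 / d powr (1 / 2)" by (rule powr_minus_divide)
    finally show ?thesis by (simp only: A_def D_def d_def)
  qed
  have sharp: "\<not> (\<forall>g h. g holomorphic_on ball 0 1 \<and> h holomorphic_on ball 0 1 \<and>
            (\<lambda>z. g z + cnj (h z)) \<in> hp_space p \<and> Re (g 0 * h 0) = 0 \<longrightarrow>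
            (LINT \<zeta>|circle_measure.
               ((cmod (radial_limit g \<zeta>))\<^sup>2 + (cmod (radial_limit h \<zeta>))\<^sup>2) powr (p / 2)) powr (1 / p)
            \<le> C *
              (LINT \<zeta>|circle_measure.
                 cmod (radial_limit g \<zeta> + cnj (radial_limit h \<zeta>)) powr p) powr (1 / p))"
    if "C < 1 / (1 - \<bar>cos (pi / p)\<bar>) powr (1 / 2)" for C
    using riesz_constant_sharp[OF assms that] by (meson not_le)
  show ?thesis
    using boundary_values_of_hp(1-3)[OF assms] ineq sharp by (intro conjI allI impI) auto
qed

end
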